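(* Let $\gamma>0$, $c\ge1$, and let $S^{\rm Tok}(t;c,\gamma)$ be the critical Tokunaga branching process, i.e. the hierarchical branching process with parameters $$\lambda_j=\gamma\,c^{2-j},\qquad p_K=2^{-K},\qquad T_k=(c-1)\,c^{k-1}\qquad(j,K,k\ge1).$$ Then $S^{\rm Tok}(t;c,\gamma)$ is a self-similar critical time-invariant process. Independently of the process's combinatorial shape, its edge lengths are i.i.d. exponential random variables with rate $\gamma c$. In addition, we have $$\hat t(z)=\frac{(1-2cz)(z-1)}{1-cz},\qquad R=w_0^{-1}=2c,\qquad \zeta=L=c,\qquad p_c=2^{-1}.$$
   Context: Trees. $\mathcal{T}$ is the space of finite unlabeled rooted reduced planted binary trees with no planar embedding (the root has degree 1, internal vertices have degree 3, leaves have degree 1), together with the empty tree $\phi$ (a single root vertex). $\mathcal{L}$ is the space of trees from $\mathcal{T}$ with positive edge lengths; $\mathrm{shape}$ forgets the lengths. Pruning $\mathcal{R}$ removes leaves with their parental edges and then performs series reduction (each degree-two vertex is removed by merging its two adjacent edges, adding lengths); $\mathcal{R}(\phi)=\phi$. The (Horton-Strahler) order is $\mathsf{k}(T)=\min\{k\ge0:\mathcal{R}^k(T)=\phi\}$. For a non-root vertex $v$, $T_v$ is the subtree rooted at the parent of $v$ and comprised of $v$ and its descendants with their parental edges; the order of $v$ is $\mathsf{k}(T_v)$; a branch is a maximal connected sequence of vertices of the same order with their parental edges; if $v$ is the vertex of a branch of order $K$ closest to the root, $T_v$ is a complete subtree of order $K$. Hierarchical branching process. Given nonnegative $\{T_k\}_{k\ge1}$,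 positive $\{\lambda_j\}_{j\ge1}$ and a probability mass function $\{p_K\}_{K\ge1}$, it is the multi-type continuous-time branching process that starts with a single root branch of order $K$ with probability $p_K$. Independently of the other branches, every branch of order $j$ produces offspring branches of each order $i<j$ with rate $\lambda_jT_{j-i}$, and terminates with rate $\lambda_j$. After termination, a branch of order $j\ge2$ splits into two branches of order $j-1$; a branch of order 1 terminates without leaving offspring. The branching history creates a random tree in $\mathcal{L}$. Self-similarity with scaling exponent $\zeta$ of the law of a random tree $T\in\mathcal{L}$: edges are labeled by depth-first search after a fixed proper planar embedding (one commuting with pruning), $\mathrm{length}(T)$ is the sum of edge lengths and $x_T$ the vector of edge lengths divided by $\mathrm{length}(T)$; $\mu$ is the law of $\mathrm{shape}(T)$, $\mu_K$ its conditional law given order $K$, $\chi_\tau$ the conditional law of $x_T$ given $\mathrm{shape}(T)=\tau$, $F_{\tau,\bar x}(\ell)$ the conditional density of $\mathrm{length}(T)$ given $x_T=\bar x$, $\mathrm{shape}(T)=\tau$. The law is self-similar with exponent $\zeta>0$ if (i)-(ii) (coordination) for every $H\ge K\ge1$, a uniformly chosen complete subtree of order $K$ of the random tree conditioned to have order $H$ has shape law $\mu_K$ and the same conditional laws $\chi_\tau$, $F_{\tau,\bar x}$ for $\tau$ of order $K$; (iii) $\nu(\tau\mid\tau\ne\phi)=\mu(\tau)$ for $\nu=\mu\circ\mathcal{R}^{-1}$; (iv) given $\mathrm{shape}(\mathcal{R}(T))=\tau$, $x_{\mathcal{R}(T)}$ has law $\chi_\tau$, and the conditional density of $\mathrm{length}(\mathcal{R}(T))$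 given $x_{\mathcal{R}(T)}=\bar x$, $\mathrm{shape}(\mathcal{R}(T))=\tau$ is $\zeta^{-1}F_{\tau,\bar x}(\ell/\zeta)$. Criticality and time-invariance. Let $\pi=\sum_{K\ge1}p_Ke_K$, where $e_K$ are the standard basis vectors, $\Lambda=\mathrm{diag}\{\lambda_1,\lambda_2,\dots\}$ and let $\mathbb{G}$ be the upper triangular Toeplitz operator with $\mathbb{G}_{i,i}=-1$, $\mathbb{G}_{i,i+1}=T_1+2$, $\mathbb{G}_{i,i+k}=T_k$ for $k\ge2$, $\mathbb{G}_{i,j}=0$ for $j<i$. The process is critical if the width function $C(s)=\|e^{\mathbb{G}\Lambda s}\pi\|_1$ (the average number of branches alive at time $s$) equals 1 for all $s\ge0$, and time-invariant if $e^{\mathbb{G}\Lambda s}\pi=\pi$ for all $s\ge0$. $L:=\limsup_{k\to\infty}T_k^{1/k}$; $\hat t(z)=-1+2z+\sum_{j\ge1}z^jT_j$ for $|z|<1/L$; $w_0$ is the unique real root of $\hat t$ in $(0,\tfrac12]$ and $R:=w_0^{-1}$; $\zeta$ is the scaling exponent; $p_c:=1-\zeta/R$.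
   Formalization: L = c is claimed only for c > 1 (for c = 1 all T_k = 0, so L = 0); the formula for t̂ is claimed where 1 - cz ≠ 0 (excludes only c = z = 1, where it reads 0/0); the proper embedding is also assumed measurable and compatible with rescaling all lengths, else (iv) can fail. *)

theory Defs
  imports "HOL-Probability.Probability"
begin

section \<open>Planted binary trees\<close>

text \<open>
  In a planted tree the non-root vertices correspond to their parental edges.  The planted tree
  \<open>Node l x r\<close> has a root of degree 1 whose only edge carries the mark \<open>x\<close>; \<open>l\<close> and \<open>r\<close> are the
  planted trees hanging off the lower end of that edge, where \<open>Leaf\<close> stands for "nothing there".
  So \<open>Leaf\<close> is the empty tree, a leaf vertex is \<open>Node Leaf x Leaf\<close>, and a vertex of degree two
  is a \<open>Node\<close> with exactly one \<open>Leaf\<close> below it.  The subtree \<open>T_v\<close> of the vertex \<open>v\<close> is the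
  \<open>Node\<close> of \<open>v\<close>.
\<close>

inductive same_up_to_swaps :: "'a tree \<Rightarrow> 'a tree \<Rightarrow> bool" where
  Leaf: "same_up_to_swaps Leaf Leaf"
| straight: "same_up_to_swaps l l' \<Longrightarrow> same_up_to_swaps r r' \<Longrightarrow>
    same_up_to_swaps (Node l x r) (Node l' x r')"
| crossed: "same_up_to_swaps l r' \<Longrightarrow> same_up_to_swaps r l' \<Longrightarrow>
    same_up_to_swaps (Node l x r) (Node l' x r')"

lemma same_up_to_swaps_refl: "same_up_to_swaps t t"
  by (induction t) (auto intro: same_up_to_swaps.intros)

lemma same_up_to_swaps_sym: "same_up_to_swaps s t \<Longrightarrow> same_up_to_swaps t s"
  by (induction rule: same_up_to_swaps.induct) (auto intro: same_up_to_swaps.intros)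

lemma same_up_to_swaps_trans:
  "same_up_to_swaps s t \<Longrightarrow> same_up_to_swaps t u \<Longrightarrow> same_up_to_swaps s u"
proof (induction arbitrary: u rule: same_up_to_swaps.induct)
  case (straight l l' r r' x)
  from straight.prems show ?case
    by cases (auto intro: same_up_to_swaps.intros straight.IH)
next
  case (crossed l r' r l' x)
  from crossed.prems show ?case
    by cases (auto intro: same_up_to_swaps.intros crossed.IH)
qed

quotient_type 'a utree = "'a tree" / same_up_to_swaps
  morphisms rep_utree forget_embedding
  by (intro equivpI reflpI sympI transpI)
    (auto intro: same_up_to_swaps_refl same_up_to_swaps_sym same_up_to_swaps_trans)

lift_definition empty_tree :: "'a utree" is Leaf .

lift_definition map_utree :: "('a \<Rightarrow> 'b) \<Rightarrow> 'a utree \<Rightarrow> 'b utree" is map_tree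
proof -
  fix f :: "'a \<Rightarrow> 'b" and s t :: "'a tree"
  show "same_up_to_swaps s t \<Longrightarrow> same_up_to_swaps (map_tree f s) (map_tree f t)"
    by (induction rule: same_up_to_swaps.induct) (auto intro: same_up_to_swaps.intros)
qed

definition shape :: "'a utree \<Rightarrow> unit utree" where
  "shape = map_utree (\<lambda>_. ())"

lift_definition num_edges :: "'a utree \<Rightarrow> nat" is size
proof -
  fix s t :: "'a tree"
  show "same_up_to_swaps s t \<Longrightarrow> size s = size t"
    by (induction rule: same_up_to_swaps.induct) auto
qed

lift_definition tree_length :: "real utree \<Rightarrow> real" is "\<lambda>t. sum_list (preorder t)"
proof -
  fix s t :: "real tree"
  show "same_up_to_swaps s t \<Longrightarrow> sum_list (preorder s) = sum_list (preorder t)"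
    by (induction rule: same_up_to_swaps.induct) auto
qed

definition scale_tree :: "real \<Rightarrow> real utree \<Rightarrow> real utree" where
  "scale_tree a = map_utree (\<lambda>x. a * x)"

fun reduced :: "'a tree \<Rightarrow> bool" where
  "reduced Leaf \<longleftrightarrow> True"
| "reduced (Node l x r) \<longleftrightarrow> (l = Leaf \<longleftrightarrow> r = Leaf) \<and> reduced l \<and> reduced r"

definition metric_trees :: "real utree set" where
  "metric_trees = {forget_embedding t | t. reduced t \<and> (\<forall>x\<in>set_tree t. 0 < x)}"


section \<open>Pruning, order, complete subtrees\<close>

fun cut_leaves :: "'a tree \<Rightarrow> 'a tree" where
  "cut_leaves Leaf = Leaf"
| "cut_leaves (Node l x r) =
    (if l = Leaf \<and> r = Leaf then Leaf else Node (cut_leaves l) x (cut_leaves r))"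

text \<open>The argument \<open>f\<close> computes the mark of a merged edge; it is addition for edge lengths.\<close>

fun merge_edge :: "('a \<Rightarrow> 'a \<Rightarrow> 'a) \<Rightarrow> 'a tree \<Rightarrow> 'a \<Rightarrow> 'a tree \<Rightarrow> 'a tree" where
  "merge_edge f Leaf x (Node l y r) = Node l (f x y) r"
| "merge_edge f (Node l y r) x Leaf = Node l (f x y) r"
| "merge_edge f l x r = Node l x r"

fun series_reduction :: "('a \<Rightarrow> 'a \<Rightarrow> 'a) \<Rightarrow> 'a tree \<Rightarrow> 'a tree" where
  "series_reduction f Leaf = Leaf"
| "series_reduction f (Node l x r) = merge_edge f (series_reduction f l) x (series_reduction f r)"

definition prune_planar :: "('a \<Rightarrow> 'a \<Rightarrow> 'a) \<Rightarrow> 'a tree \<Rightarrow> 'a tree" where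
  "prune_planar f t = series_reduction f (cut_leaves t)"

lemma same_up_to_swaps_Leaf_iff: "same_up_to_swaps s t \<Longrightarrow> s = Leaf \<longleftrightarrow> t = Leaf"
  by (auto elim: same_up_to_swaps.cases)

lemma cut_leaves_swaps:
  "same_up_to_swaps s t \<Longrightarrow> same_up_to_swaps (cut_leaves s) (cut_leaves t)"
proof (induction rule: same_up_to_swaps.induct)
  case (straight l l' r r' x)
  then show ?case
    using same_up_to_swaps_Leaf_iff[of l l'] same_up_to_swaps_Leaf_iff[of r r']
    by (auto intro: same_up_to_swaps.intros)
next
  case (crossed l r' r l' x)
  then show ?case
    using same_up_to_swaps_Leaf_iff[of l r'] same_up_to_swaps_Leaf_iff[of r l']
    by (auto intro: same_up_to_swaps.intros)
qed (auto intro: same_up_to_swaps.intros)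

lemma merge_edge_swap: "same_up_to_swaps (merge_edge f l x r) (merge_edge f r x l)"
  by (cases l; cases r) (auto intro: same_up_to_swaps.intros same_up_to_swaps_refl)

lemma same_up_to_swaps_mark:
  "same_up_to_swaps (Node l x r) (Node l' x' r') \<Longrightarrow>
    x = x' \<and> same_up_to_swaps (Node l y r) (Node l' y r')"
  by (erule same_up_to_swaps.cases) (auto intro: same_up_to_swaps.intros)

lemma merge_edge_cong:
  assumes "same_up_to_swaps l l'" "same_up_to_swaps r r'"
  shows "same_up_to_swaps (merge_edge f l x r) (merge_edge f l' x r')"
  using same_up_to_swaps_Leaf_iff[OF assms(1)] same_up_to_swaps_Leaf_iff[OF assms(2)] assms
  by (cases l; cases l'; cases r; cases r')
    (auto dest: same_up_to_swaps_mark intro: same_up_to_swaps.intros)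

lemma series_reduction_swaps:
  "same_up_to_swaps s t \<Longrightarrow> same_up_to_swaps (series_reduction f s) (series_reduction f t)"
  by (induction rule: same_up_to_swaps.induct)
    (auto intro: same_up_to_swaps.intros merge_edge_cong
      same_up_to_swaps_trans[OF merge_edge_cong merge_edge_swap])

lift_definition prune :: "('a \<Rightarrow> 'a \<Rightarrow> 'a) \<Rightarrow> 'a utree \<Rightarrow> 'a utree" is prune_planar
  unfolding prune_planar_def by (intro series_reduction_swaps cut_leaves_swaps)

abbreviation prune_metric :: "real utree \<Rightarrow> real utree" where
  "prune_metric \<equiv> prune (+)"

abbreviation prune_shape :: "unit utree \<Rightarrow> unit utree" where
  "prune_shape \<equiv> prune (\<lambda>_ _. ())"

definition order :: "real utree \<Rightarrow> nat" where
  "order t = (LEAST k. (prune_metric ^^ k) t = empty_tree)"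

text \<open>
  The first argument after \<open>K\<close> is the order of the parent vertex (0 if the parent is the root).
  A vertex is the vertex of its branch closest to the root iff its parent has a different order or
  is the root.
\<close>

fun complete_subtrees_below :: "nat \<Rightarrow> nat \<Rightarrow> real tree \<Rightarrow> real utree multiset" where
  "complete_subtrees_below K q Leaf = {#}"
| "complete_subtrees_below K q (Node l x r) =
    (let t = forget_embedding (Node l x r); k = order t in
      (if k = K \<and> k \<noteq> q then {#t#} else {#}) +
      complete_subtrees_below K k l + complete_subtrees_below K k r)"

lift_definition complete_subtrees :: "nat \<Rightarrow> real utree \<Rightarrow> real utree multiset"
  is "\<lambda>K. complete_subtrees_below K 0"
proof -
  fix K :: nat and s t :: "real tree"
  have "complete_subtrees_below K q s = complete_subtrees_below K q t"
    if "same_up_to_swaps s t" for q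
    using that
  proof (induction arbitrary: q rule: same_up_to_swaps.induct)
    case (straight l l' r r' x)
    then have "forget_embedding (Node l x r) = forget_embedding (Node l' x r')"
      by (auto simp: utree.abs_eq_iff intro: same_up_to_swaps.intros)
    then show ?case using straight.IH by (simp add: Let_def)
  next
    case (crossed l r' r l' x)
    then have "forget_embedding (Node l x r) = forget_embedding (Node l' x r')"
      by (auto simp: utree.abs_eq_iff intro: same_up_to_swaps.intros)
    then show ?case using crossed.IH by (simp add: Let_def)
  qed simp
  then show "same_up_to_swaps s t \<Longrightarrow>
      complete_subtrees_below K 0 s = complete_subtrees_below K 0 t" .
qed


section \<open>Laws of random metric trees\<close>

text \<open>The quotient sigma-algebra.  Laws on it are required to be concentrated on \<open>metric_trees\<close>.\<close>

definition tree_space :: "real utree measure" where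
  "tree_space = sigma UNIV {A. forget_embedding -` A \<in> sets (tree_sigma borel)}"

text \<open>
  A proper planar embedding.  Equivariance under a change of the unit of length makes the
  enumeration of the edges a function of their relative lengths.  Without it, an embedding could
  sort the two leaves of a cherry in increasing order in short trees and in decreasing order in
  long ones; rescaling all lengths would then change the law of the vector of relative lengths.
\<close>

definition proper_embedding :: "(real utree \<Rightarrow> real tree) \<Rightarrow> bool" where
  "proper_embedding E \<longleftrightarrow>
    E \<in> tree_space \<rightarrow>\<^sub>M tree_sigma borel \<and>
    (\<forall>t\<in>metric_trees. forget_embedding (E t) = t) \<and>
    (\<forall>t\<in>metric_trees. E (prune_metric t) = prune_planar (+) (E t)) \<and>
    (\<forall>t\<in>metric_trees. \<forall>a>0. E (scale_tree a t) = map_tree (\<lambda>x. a * x) (E t))"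

definition given_shape :: "real utree measure \<Rightarrow> unit utree \<Rightarrow> real utree measure" where
  "given_shape M \<tau> = uniform_measure M {t \<in> space M. shape t = \<tau>}"

definition given_order :: "real utree measure \<Rightarrow> nat \<Rightarrow> real utree measure" where
  "given_order M K = uniform_measure M {t \<in> space M. order t = K}"

definition shape_law :: "real utree measure \<Rightarrow> unit utree measure" where
  "shape_law M = distr M (count_space UNIV) shape"

text \<open>Vectors with \<open>n\<close> entries are functions on \<open>{..<n}\<close>; \<open>preorder\<close> is depth-first search.\<close>

abbreviation vectors :: "nat \<Rightarrow> (nat \<Rightarrow> real) measure" where
  "vectors n \<equiv> PiM {..<n} (\<lambda>_. borel)"

definition rel_lengths :: "(real utree \<Rightarrow> real tree) \<Rightarrow> nat \<Rightarrow> real utree \<Rightarrow> nat \<Rightarrow> real" where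
  "rel_lengths E n t = (\<lambda>i\<in>{..<n}. preorder (E t) ! i / tree_length t)"

definition rel_lengths_law ::
  "(real utree \<Rightarrow> real tree) \<Rightarrow> real utree measure \<Rightarrow> unit utree \<Rightarrow> (nat \<Rightarrow> real) measure" where
  "rel_lengths_law E M \<tau> =
    distr (given_shape M \<tau>) (vectors (num_edges \<tau>)) (rel_lengths E (num_edges \<tau>))"

definition cond_length_density ::
  "(real utree \<Rightarrow> real tree) \<Rightarrow> real utree measure \<Rightarrow> unit utree \<Rightarrow>
    ((nat \<Rightarrow> real) \<Rightarrow> real \<Rightarrow> real) \<Rightarrow> bool" where
  "cond_length_density E M \<tau> f \<longleftrightarrow>
    (\<lambda>(x, l). f x l) \<in> borel_measurable (vectors (num_edges \<tau>) \<Otimes>\<^sub>M lborel) \<and>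
    (\<forall>x l. 0 \<le> f x l) \<and>
    distr (given_shape M \<tau>) (vectors (num_edges \<tau>) \<Otimes>\<^sub>M lborel)
      (\<lambda>t. (rel_lengths E (num_edges \<tau>) t, tree_length t)) =
    density (rel_lengths_law E M \<tau> \<Otimes>\<^sub>M lborel) (\<lambda>(x, l). ennreal (f x l))"

text \<open>The law of a uniformly chosen complete subtree of order \<open>K\<close> of a tree of order \<open>H\<close>.\<close>

definition random_complete_subtree ::
  "real utree measure \<Rightarrow> nat \<Rightarrow> nat \<Rightarrow> real utree measure" where
  "random_complete_subtree M H K =
    given_order M H \<bind>
      (\<lambda>t. distr (measure_pmf (pmf_of_multiset (complete_subtrees K t))) tree_space (\<lambda>s. s))"

definition coordinated ::
  "(real utree \<Rightarrow> real tree) \<Rightarrow> real utree measure \<Rightarrow>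
    (unit utree \<Rightarrow> (nat \<Rightarrow> real) \<Rightarrow> real \<Rightarrow> real) \<Rightarrow> bool" where
  "coordinated E M F \<longleftrightarrow>
    (\<forall>H K. 1 \<le> K \<and> K \<le> H \<and> 0 < measure M {t \<in> space M. order t = H} \<and>
        0 < measure M {t \<in> space M. order t = K} \<longrightarrow>
      (let Q = random_complete_subtree M H K; \<mu>\<^sub>K = shape_law (given_order M K) in
        shape_law Q = \<mu>\<^sub>K \<and>
        (\<forall>\<tau>. 0 < measure \<mu>\<^sub>K {\<tau>} \<longrightarrow>
          rel_lengths_law E Q \<tau> = rel_lengths_law E M \<tau> \<and>
          cond_length_density E Q \<tau> (F \<tau>))))"

definition prune_invariant_shape :: "real utree measure \<Rightarrow> bool" where
  "prune_invariant_shape M \<longleftrightarrow>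
    (let \<mu> = shape_law M; \<nu> = distr \<mu> (count_space UNIV) prune_shape in
      uniform_measure \<nu> (- {empty_tree}) = \<mu>)"

definition prune_scales_lengths ::
  "(real utree \<Rightarrow> real tree) \<Rightarrow> real utree measure \<Rightarrow>
    (unit utree \<Rightarrow> (nat \<Rightarrow> real) \<Rightarrow> real \<Rightarrow> real) \<Rightarrow> real \<Rightarrow> bool" where
  "prune_scales_lengths E M F \<zeta> \<longleftrightarrow>
    (let N = distr M tree_space prune_metric in
      \<forall>\<tau>. \<tau> \<noteq> empty_tree \<and> 0 < measure (shape_law N) {\<tau>} \<longrightarrow>
        rel_lengths_law E N \<tau> = rel_lengths_law E M \<tau> \<and>
        cond_length_density E N \<tau> (\<lambda>x l. F \<tau> x (l / \<zeta>) / \<zeta>))"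

definition self_similar ::
  "(real utree \<Rightarrow> real tree) \<Rightarrow> real utree measure \<Rightarrow> real \<Rightarrow> bool" where
  "self_similar E M \<zeta> \<longleftrightarrow>
    0 < \<zeta> \<and> prob_space M \<and> sets M = sets tree_space \<and> (AE t in M. t \<in> metric_trees) \<and>
    (\<exists>F. (\<forall>\<tau>. 0 < measure (shape_law M) {\<tau>} \<longrightarrow> cond_length_density E M \<tau> (F \<tau>)) \<and>
      coordinated E M F \<and> prune_invariant_shape M \<and> prune_scales_lengths E M F \<zeta>)"

definition scaling_exponent :: "(real utree \<Rightarrow> real tree) \<Rightarrow> real utree measure \<Rightarrow> real" where
  "scaling_exponent E M = (THE \<zeta>. self_similar E M \<zeta>)"

text \<open>
  Independently of the shape, the edge lengths are i.i.d. exponential.  A deterministic embedding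
  of a tree with symmetries has to look at the lengths to tell the edges apart, so the edge lengths
  listed in its order are not i.i.d.  The property is therefore one of the law on trees without
  embedding: given the shape, the tree is distributed like that shape, drawn in the plane in any
  way, with i.i.d. lengths written on its edges.
\<close>

fun with_lengths :: "unit tree \<Rightarrow> (nat \<Rightarrow> real) \<Rightarrow> real tree" where
  "with_lengths Leaf x = Leaf"
| "with_lengths (Node l u r) x =
    Node (with_lengths l (\<lambda>i. x (Suc i))) (x 0) (with_lengths r (\<lambda>i. x (Suc (size l + i))))"

definition exponential :: "real \<Rightarrow> real measure" where
  "exponential a = density lborel (\<lambda>x. ennreal (exponential_density a x))"

definition iid_exponential_edges :: "real utree measure \<Rightarrow> real \<Rightarrow> bool" where
  "iid_exponential_edges M a \<longleftrightarrow>
    (\<forall>s :: unit tree. 0 < measure (shape_law M) {forget_embedding s} \<longrightarrow>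
      given_shape M (forget_embedding s) =
      distr (PiM {..<size s} (\<lambda>_. exponential a)) tree_space
        (\<lambda>x. forget_embedding (with_lengths s x)))"


section \<open>Hierarchical branching process\<close>

text \<open>
  Sequences indexed by positive integers are functions on \<open>nat\<close> whose value at 0 is irrelevant.

  A branch of order \<open>j\<close> produces offspring of order \<open>i < j\<close> (event \<open>i\<close>) and terminates (event \<open>j\<close>)
  with the rates below.  Each event with positive rate has its own exponential clock; the first
  clock to ring decides what happens, and afterwards all branches run on fresh clocks.
  The sample point \<open>\<omega>\<close> provides independent exponential clocks of rate 1 for every
  edge, named by its path from the root (last step first), and event; dividing by the rate
  gives a clock with that rate.
\<close>

definition event_rate :: "(nat \<Rightarrow> real) \<Rightarrow> (nat \<Rightarrow> real) \<Rightarrow> nat \<Rightarrow> nat \<Rightarrow> real" where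
  "event_rate T lam j i = (if i = j then lam j else lam j * T (j - i))"

definition ring_time ::
  "(nat \<Rightarrow> real) \<Rightarrow> (nat \<Rightarrow> real) \<Rightarrow> (bool list \<times> nat \<Rightarrow> real) \<Rightarrow> bool list \<Rightarrow> nat \<Rightarrow> nat \<Rightarrow> real"
  where
  "ring_time T lam \<omega> u j i = \<omega> (u, i) / event_rate T lam j i"

definition rings_first ::
  "(nat \<Rightarrow> real) \<Rightarrow> (nat \<Rightarrow> real) \<Rightarrow> (bool list \<times> nat \<Rightarrow> real) \<Rightarrow> bool list \<Rightarrow> nat \<Rightarrow> nat \<Rightarrow> bool"
  where
  "rings_first T lam \<omega> u j i \<longleftrightarrow>
    i \<in> {1..j} \<and> 0 < event_rate T lam j i \<and>
    (\<forall>k\<in>{1..j} - {i}. 0 < event_rate T lam j k \<longrightarrow>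
      ring_time T lam \<omega> u j i < ring_time T lam \<omega> u j k)"

inductive branching_history ::
  "(nat \<Rightarrow> real) \<Rightarrow> (nat \<Rightarrow> real) \<Rightarrow> (bool list \<times> nat \<Rightarrow> real) \<Rightarrow> bool list \<Rightarrow> nat \<Rightarrow> real tree \<Rightarrow> bool"
  for T lam :: "nat \<Rightarrow> real" and \<omega> :: "bool list \<times> nat \<Rightarrow> real"
where
  stop: "rings_first T lam \<omega> u 1 1 \<Longrightarrow>
    branching_history T lam \<omega> u 1 (Node Leaf (ring_time T lam \<omega> u 1 1) Leaf)"
| split: "2 \<le> j \<Longrightarrow> rings_first T lam \<omega> u j j \<Longrightarrow>
    branching_history T lam \<omega> (False # u) (j - 1) l \<Longrightarrow>
    branching_history T lam \<omega> (True # u) (j - 1) r \<Longrightarrow>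
    branching_history T lam \<omega> u j (Node l (ring_time T lam \<omega> u j j) r)"
| offspring: "i < j \<Longrightarrow> rings_first T lam \<omega> u j i \<Longrightarrow>
    branching_history T lam \<omega> (False # u) j l \<Longrightarrow>
    branching_history T lam \<omega> (True # u) i r \<Longrightarrow>
    branching_history T lam \<omega> u j (Node l (ring_time T lam \<omega> u j i) r)"

text \<open>There is at most one (finite) history; the value without one is a dummy.\<close>

definition history_tree ::
  "(nat \<Rightarrow> real) \<Rightarrow> (nat \<Rightarrow> real) \<Rightarrow> nat \<times> (bool list \<times> nat \<Rightarrow> real) \<Rightarrow> real utree" where
  "history_tree T lam = (\<lambda>(K, \<omega>).
    if \<exists>t. branching_history T lam \<omega> [] K t
    then forget_embedding (THE t. branching_history T lam \<omega> [] K t) else empty_tree)"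

definition hbp_sample_space ::
  "(nat \<Rightarrow> real) \<Rightarrow> (nat \<times> (bool list \<times> nat \<Rightarrow> real)) measure" where
  "hbp_sample_space p =
    density (count_space {1..}) (\<lambda>K. ennreal (p K)) \<Otimes>\<^sub>M PiM UNIV (\<lambda>_. exponential 1)"

definition hbp_law ::
  "(nat \<Rightarrow> real) \<Rightarrow> (nat \<Rightarrow> real) \<Rightarrow> (nat \<Rightarrow> real) \<Rightarrow> real utree measure" where
  "hbp_law T lam p = distr (hbp_sample_space p) tree_space (history_tree T lam)"


section \<open>Criticality, time-invariance, and constants of the process\<close>

definition toeplitz_G :: "(nat \<Rightarrow> real) \<Rightarrow> nat \<Rightarrow> nat \<Rightarrow> real" where
  "toeplitz_G T i j =
    (if j < i then 0 else if j = i then - 1 else if j = Suc i then T 1 + 2 else T (j - i))"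

text \<open>For an upper triangular matrix the sums in the matrix product are finite.\<close>

primrec triangular_power :: "(nat \<Rightarrow> nat \<Rightarrow> real) \<Rightarrow> nat \<Rightarrow> nat \<Rightarrow> nat \<Rightarrow> real" where
  "triangular_power A 0 = (\<lambda>i j. if i = j then 1 else 0)"
| "triangular_power A (Suc n) = (\<lambda>i j. \<Sum>k\<in>{i..j}. A i k * triangular_power A n k j)"

definition triangular_exp :: "(nat \<Rightarrow> nat \<Rightarrow> real) \<Rightarrow> nat \<Rightarrow> nat \<Rightarrow> real" where
  "triangular_exp A i j = (\<Sum>n. triangular_power A n i j / fact n)"

text \<open>The entries of \<open>exp (G \<Lambda> s)\<close>, and the terms of the \<open>i\<close>-th entry of \<open>exp (G \<Lambda> s) \<pi>\<close>.\<close>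

definition transition :: "(nat \<Rightarrow> real) \<Rightarrow> (nat \<Rightarrow> real) \<Rightarrow> real \<Rightarrow> nat \<Rightarrow> nat \<Rightarrow> real" where
  "transition T lam s = triangular_exp (\<lambda>i j. toeplitz_G T i j * lam j * s)"

definition state_terms ::
  "(nat \<Rightarrow> real) \<Rightarrow> (nat \<Rightarrow> real) \<Rightarrow> (nat \<Rightarrow> real) \<Rightarrow> real \<Rightarrow> nat \<Rightarrow> nat \<Rightarrow> real" where
  "state_terms T lam p s i K = transition T lam s i K * p K"

definition width ::
  "(nat \<Rightarrow> real) \<Rightarrow> (nat \<Rightarrow> real) \<Rightarrow> (nat \<Rightarrow> real) \<Rightarrow> real \<Rightarrow> real" where
  "width T lam p s = (\<Sum>\<^sub>\<infinity>i\<in>{1..}. \<bar>\<Sum>\<^sub>\<infinity>K\<in>{1..}. state_terms T lam p s i K\<bar>)"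

definition critical :: "(nat \<Rightarrow> real) \<Rightarrow> (nat \<Rightarrow> real) \<Rightarrow> (nat \<Rightarrow> real) \<Rightarrow> bool" where
  "critical T lam p \<longleftrightarrow>
    (\<forall>s\<ge>0. (\<forall>i\<ge>1. state_terms T lam p s i summable_on {1..}) \<and> width T lam p s = 1)"

definition time_invariant :: "(nat \<Rightarrow> real) \<Rightarrow> (nat \<Rightarrow> real) \<Rightarrow> (nat \<Rightarrow> real) \<Rightarrow> bool" where
  "time_invariant T lam p \<longleftrightarrow>
    (\<forall>s\<ge>0. \<forall>i\<ge>1. (state_terms T lam p s i has_sum p i) {1..})"

definition growth_L :: "(nat \<Rightarrow> real) \<Rightarrow> ereal" where
  "growth_L T = limsup (\<lambda>k. ereal (root k (T k)))"

definition t_hat :: "(nat \<Rightarrow> real) \<Rightarrow> complex \<Rightarrow> complex" where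
  "t_hat T z = - 1 + 2 * z + (\<Sum>j. z ^ Suc j * of_real (T (Suc j)))"

definition in_domain :: "(nat \<Rightarrow> real) \<Rightarrow> complex \<Rightarrow> bool" where
  "in_domain T z \<longleftrightarrow> ereal (norm z) < 1 / growth_L T"

definition w0 :: "(nat \<Rightarrow> real) \<Rightarrow> real" where
  "w0 T = (THE w. 0 < w \<and> w \<le> 1 / 2 \<and> in_domain T (of_real w) \<and> t_hat T (of_real w) = 0)"

definition horton_R :: "(nat \<Rightarrow> real) \<Rightarrow> real" where
  "horton_R T = inverse (w0 T)"

definition p_c :: "real \<Rightarrow> real \<Rightarrow> real" where
  "p_c \<zeta> R = 1 - \<zeta> / R"


section \<open>The critical Tokunaga process\<close>

definition tok_lam :: "real \<Rightarrow> real \<Rightarrow> nat \<Rightarrow> real" where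
  "tok_lam c \<gamma> j = \<gamma> * c powi (2 - int j)"

definition tok_p :: "nat \<Rightarrow> real" where
  "tok_p K = 1 / 2 ^ K"

definition tok_T :: "real \<Rightarrow> nat \<Rightarrow> real" where
  "tok_T c k = (c - 1) * c ^ (k - 1)"

definition tok_law :: "real \<Rightarrow> real \<Rightarrow> real utree measure" where
  "tok_law c \<gamma> = hbp_law (tok_T c) (tok_lam c \<gamma>) tok_p"

text \<open>For \<open>c = 1\<close> there is no side branching, and the growth rate is 0 rather than \<open>c\<close>.\<close>

lemma growth_L_tok_1: "growth_L (tok_T 1) = 0"
  by (simp add: growth_L_def tok_T_def Limsup_const zero_ereal_def)


section \<open>Existence of a proper embedding\<close>

fun lex_le :: "real tree \<Rightarrow> real tree \<Rightarrow> bool" where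
  "lex_le Leaf b \<longleftrightarrow> True"
| "lex_le (Node l x r) Leaf \<longleftrightarrow> False"
| "lex_le (Node l x r) (Node l' x' r') \<longleftrightarrow>
    (if x \<noteq> x' then x < x' else if l \<noteq> l' then lex_le l l' else lex_le r r')"

lemma lex_le_total: "lex_le a b \<or> lex_le b a"
  by (induction a b rule: lex_le.induct) auto

lemma lex_le_antisym: "lex_le a b \<Longrightarrow> lex_le b a \<Longrightarrow> a = b"
proof (induction a b rule: lex_le.induct)
  case (1 b) then show ?case by (cases b) auto
next
  case (3 l x r l' x' r')
  then show ?case by (simp split: if_splits)
qed auto

lemma lex_le_eq_iff: "a = b \<longleftrightarrow> lex_le a b \<and> lex_le b a"
  using lex_le_antisym lex_le_total by blast

abbreviation (input) mult_tree :: "real \<Rightarrow> real tree \<Rightarrow> real tree" where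
  "mult_tree a \<equiv> map_tree (\<lambda>x. a * x)"

lemma mult_tree_eq_iff: "0 < a \<Longrightarrow> mult_tree a s = mult_tree a t \<longleftrightarrow> s = t"
  using inj_eq[OF tree.inj_map[of "\<lambda>x. a * x"]] by (simp add: inj_on_def)

lemma lex_le_mult: "0 < a \<Longrightarrow> lex_le (mult_tree a s) (mult_tree a t) \<longleftrightarrow> lex_le s t"
  by (induction s t rule: lex_le.induct) (auto simp: mult_tree_eq_iff)

abbreviation (input) prune_pl :: "real tree \<Rightarrow> real tree" where
  "prune_pl \<equiv> prune_planar (+)"

lemma size_cut_leaves: "t \<noteq> Leaf \<Longrightarrow> size (cut_leaves t) < size t"
proof (induction t)
  case (Node l x r)
  then show ?case by (cases "l = Leaf"; cases "r = Leaf") auto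
qed simp

lemma size_merge_edge: "size (merge_edge f l x r) \<le> Suc (size l + size r)"
  by (cases l; cases r) auto

lemma size_series_reduction: "size (series_reduction f t) \<le> size t"
proof (induction t)
  case (Node l x r)
  then show ?case
    using size_merge_edge[of f "series_reduction f l" x "series_reduction f r"] by simp
qed simp

lemma size_prune_planar: "t \<noteq> Leaf \<Longrightarrow> size (prune_planar f t) < size t"
  unfolding prune_planar_def
  using size_cut_leaves[of t] size_series_reduction[of f "cut_leaves t"] by simp

lemma prune_planar_Leaf [simp]: "prune_planar f Leaf = Leaf"
  by (simp add: prune_planar_def)

lemma prune_planar_Node:
  "prune_planar f (Node l x r) =
    (if l = Leaf \<and> r = Leaf then Leaf else merge_edge f (prune_planar f l) x (prune_planar f r))"
  by (simp add: prune_planar_def)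

text \<open>
  Siblings are ordered by comparing their deepest prunings first, so that pruning does not affect
  the decision; \<open>lex_le\<close> breaks ties.
\<close>

primrec before_upto :: "nat \<Rightarrow> real tree \<Rightarrow> real tree \<Rightarrow> bool" where
  "before_upto 0 s t \<longleftrightarrow> lex_le s t"
| "before_upto (Suc n) s t \<longleftrightarrow>
    (if prune_pl s = Leaf \<or> prune_pl t = Leaf \<or> prune_pl s = prune_pl t then lex_le s t else before_upto n (prune_pl s) (prune_pl t))"

definition sibling_before :: "real tree \<Rightarrow> real tree \<Rightarrow> bool" where
  "sibling_before s t = before_upto (size s) s t"

lemma before_upto_stable: "size s \<le> n \<Longrightarrow> before_upto n s t = before_upto (size s) s t"
proof (induction n arbitrary: s t rule: less_induct)
  case (less n)
  show ?case
  proof (cases "s = Leaf \<or> n = 0")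
    case True
    then show ?thesis using less.prems by (cases n) auto
  next
    case False
    then obtain k where k: "size s = Suc k" by (cases s) auto
    with less.prems obtain m where "n = Suc m" "k \<le> m" by (cases n) auto
    with k have mk: "n = Suc m" "size s = Suc k" "k \<le> m" by auto
    have sz: "size (prune_pl s) \<le> k" using size_prune_planar[of s "(+)"] False mk by simp
    have "before_upto m (prune_pl s) (prune_pl t) = before_upto k (prune_pl s) (prune_pl t)"
    proof (cases "k = m")
      case False
      have "before_upto m (prune_pl s) (prune_pl t) =
          before_upto (size (prune_pl s)) (prune_pl s) (prune_pl t)"
        using mk sz by (intro less.IH) auto
      moreover have "before_upto k (prune_pl s) (prune_pl t) =
          before_upto (size (prune_pl s)) (prune_pl s) (prune_pl t)"
        using mk sz by (intro less.IH) auto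
      ultimately show ?thesis by argo
    qed simp
    then show ?thesis by (simp add: mk)
  qed
qed

lemma before_prune:
  assumes "prune_pl s \<noteq> Leaf" "prune_pl t \<noteq> Leaf" "prune_pl s \<noteq> prune_pl t"
  shows "sibling_before s t \<longleftrightarrow> sibling_before (prune_pl s) (prune_pl t)"
proof -
  from assms have "s \<noteq> Leaf" by auto
  then obtain k where k: "size s = Suc k" by (cases s) auto
  with \<open>s \<noteq> Leaf\<close> have "size (prune_pl s) \<le> k" using size_prune_planar[of s "(+)"] by simp
  with assms k show ?thesis 
    using before_upto_stable[of "prune_pl s" k "prune_pl t"] by (simp add: sibling_before_def)
qed

lemma before_no_prune:
  assumes "prune_pl s = Leaf \<or> prune_pl t = Leaf \<or> prune_pl s = prune_pl t"
  shows "sibling_before s t \<longleftrightarrow> lex_le s t"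
  using assms by (cases "size s") (auto simp: sibling_before_def)

lemma before_total_antisym: "(sibling_before s t \<or> sibling_before t s) \<and> (sibling_before s t \<longrightarrow> sibling_before t s \<longrightarrow> s = t)"
proof (induction "size s" arbitrary: s t rule: less_induct)
  case less
  show ?case
  proof (cases "prune_pl s = Leaf \<or> prune_pl t = Leaf \<or> prune_pl s = prune_pl t")
    case True
    then have "sibling_before s t \<longleftrightarrow> lex_le s t" "sibling_before t s \<longleftrightarrow> lex_le t s"
      by (auto intro!: before_no_prune)
    then show ?thesis using lex_le_total[of s t] lex_le_antisym[of s t] by simp
  next
    case False
    then have "size (prune_pl s) < size s" by (intro size_prune_planar) auto
    note less.hyps[OF this, of "prune_pl t"]
    moreover have "sibling_before s t \<longleftrightarrow> sibling_before (prune_pl s) (prune_pl t)"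
      using False by (intro before_prune) auto
    moreover have "sibling_before t s \<longleftrightarrow> sibling_before (prune_pl t) (prune_pl s)"
      using False by (intro before_prune) auto
    ultimately show ?thesis using False by simp
  qed
qed

lemma merge_edge_mult:
  "merge_edge (+) (mult_tree a l) (a * x) (mult_tree a r) = mult_tree a (merge_edge (+) l x r)"
  by (cases l; cases r) (auto simp: algebra_simps)

lemma cut_leaves_mult: "cut_leaves (mult_tree a t) = mult_tree a (cut_leaves t)"
  by (induction t) auto

lemma series_reduction_mult:
  "series_reduction (+) (mult_tree a t) = mult_tree a (series_reduction (+) t)"
  by (induction t) (auto simp: merge_edge_mult)

lemma prune_planar_mult: "prune_pl (mult_tree a t) = mult_tree a (prune_pl t)"
  by (simp add: prune_planar_def cut_leaves_mult series_reduction_mult)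

lemma before_upto_mult:
  "0 < a \<Longrightarrow> before_upto n (mult_tree a s) (mult_tree a t) \<longleftrightarrow> before_upto n s t"
  by (induction n arbitrary: s t) (auto simp: lex_le_mult prune_planar_mult mult_tree_eq_iff)

lemma before_mult: "0 < a \<Longrightarrow> sibling_before (mult_tree a s) (mult_tree a t) \<longleftrightarrow> sibling_before s t"
  by (simp add: sibling_before_def before_upto_mult)

definition sorted_node :: "real tree \<Rightarrow> real \<Rightarrow> real tree \<Rightarrow> real tree" where
  "sorted_node l x r = (if sibling_before l r then Node l x r else Node r x l)"

primrec canon :: "real tree \<Rightarrow> real tree" where
  "canon Leaf = Leaf"
| "canon (Node l x r) = sorted_node (canon l) x (canon r)"

lemma sorted_node_commute: "sorted_node l x r = sorted_node r x l"
  using before_total_antisym[of l r] by (auto simp: sorted_node_def)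

lemma canon_swaps: "same_up_to_swaps s t \<Longrightarrow> canon s = canon t"
  by (induction rule: same_up_to_swaps.induct) (auto simp: sorted_node_commute)

lemma canon_same: "same_up_to_swaps (canon t) t"
  by (induction t) (auto simp: sorted_node_def intro: same_up_to_swaps.intros)

lemma canon_Leaf_iff [simp]: "canon t = Leaf \<longleftrightarrow> t = Leaf"
  using same_up_to_swaps_Leaf_iff[OF canon_same] .

lemma canon_mult: "0 < a \<Longrightarrow> canon (mult_tree a t) = mult_tree a (canon t)"
  by (induction t) (auto simp: sorted_node_def before_mult)

lemma canon_prune: "reduced t \<Longrightarrow> canon (prune_pl t) = prune_pl (canon t)"
proof (induction t)
  case (Node l x r)
  show ?case
  proof (cases "l = Leaf")
    case True
    with Node.prems show ?thesis by (simp add: prune_planar_Node sorted_node_def)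
  next
    case False
    with Node.prems have nl: "l \<noteq> Leaf" "r \<noteq> Leaf" by auto
    from Node have IH: "canon (prune_pl l) = prune_pl (canon l)" "canon (prune_pl r) = prune_pl (canon r)" by auto
    have *: "prune_pl (Node l x r) = merge_edge (+) (prune_pl l) x (prune_pl r)"
      using nl by (simp add: prune_planar_Node)
    have **: "prune_pl (canon (Node l x r)) =
      (if sibling_before (canon l) (canon r) then merge_edge (+) (prune_pl (canon l)) x (prune_pl (canon r))
       else merge_edge (+) (prune_pl (canon r)) x (prune_pl (canon l)))"
      using nl by (simp add: sorted_node_def prune_planar_Node)
    show ?thesis
    proof (cases "prune_pl l")
      case Leaf
      with IH have l: "prune_pl (canon l) = Leaf" by simp
      show ?thesis
      proof (cases "prune_pl r")
        case Leaf
        with IH have "prune_pl (canon r) = Leaf" by simp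
        with l \<open>prune_pl l = Leaf\<close> Leaf show ?thesis unfolding * ** by (simp add: sorted_node_def)
      next
        case (Node a y b)
        with IH have "prune_pl (canon r) = sorted_node (canon a) y (canon b)" by simp
        with l \<open>prune_pl l = Leaf\<close> Node show ?thesis unfolding * ** by (simp add: sorted_node_def)
      qed
    next
      case (Node a y b)
      note Nl = this
      show ?thesis
      proof (cases "prune_pl r")
        case Leaf
        with IH have r: "prune_pl (canon r) = Leaf" by simp
        from IH Nl have "prune_pl (canon l) = sorted_node (canon a) y (canon b)" by simp
        with r Nl Leaf show ?thesis unfolding * ** by (simp add: sorted_node_def)
      next
        case (Node a' y' b')
        have nL: "prune_pl (canon l) \<noteq> Leaf" "prune_pl (canon r) \<noteq> Leaf"
          using IH Nl Node canon_Leaf_iff by (metis tree.distinct(1))+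
        have m: "merge_edge (+) s x t = Node s x t" if "s \<noteq> Leaf" "t \<noteq> Leaf" for s t :: "real tree"
          using that by (cases s; cases t) auto
        have "canon (prune_pl (Node l x r)) = sorted_node (prune_pl (canon l)) x (prune_pl (canon r))"
          unfolding * using Nl Node IH m[of "prune_pl l" "prune_pl r"] by simp
        also have "\<dots> = prune_pl (canon (Node l x r))"
          unfolding ** using nL before_prune[OF nL]
          by (cases "prune_pl (canon l) = prune_pl (canon r)") (auto simp: m sorted_node_def)
        finally show ?thesis .
      qed
    qed
  qed
qed simp

abbreviation (input) "tree_sig \<equiv> tree_sigma (borel :: real measure)"

lemma measurable_is_Leaf [measurable (raw)]:
  assumes [measurable]: "f \<in> M \<rightarrow>\<^sub>M tree_sigma N"
  shows "Measurable.pred M (\<lambda>x. f x = Leaf)"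
proof -
  have "f -` {Leaf} \<inter> space M \<in> sets M" by measurable
  then show ?thesis by (simp add: pred_def vimage_def Int_def conj_commute)
qed

lemma measurable_left_right [measurable]:
  "Tree.left \<in> tree_sig \<rightarrow>\<^sub>M tree_sig" "Tree.right \<in> tree_sig \<rightarrow>\<^sub>M tree_sig"
  by (rule measurable_left measurable_right)+

primrec lex_le_upto :: "nat \<Rightarrow> real tree \<Rightarrow> real tree \<Rightarrow> bool" where
  "lex_le_upto 0 s t \<longleftrightarrow> False"
| "lex_le_upto (Suc n) s t \<longleftrightarrow> (case s of Leaf \<Rightarrow> True | Node l x r \<Rightarrow>
     (case t of Leaf \<Rightarrow> False | Node l' x' r' \<Rightarrow>
     x < x' \<or> (x = x' \<and> (if lex_le_upto n l l' \<and> lex_le_upto n l' l then lex_le_upto n r r' else lex_le_upto n l l'))))"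

lemma lex_le_upto: "size s < n \<Longrightarrow> size t < n \<Longrightarrow> lex_le_upto n s t \<longleftrightarrow> lex_le s t"
proof (induction n arbitrary: s t)
  case (Suc n)
  show ?case
  proof (cases s)
    case (Node l x r)
    note Ns = this
    show ?thesis
    proof (cases t)
      case (Node l' x' r')
      with Ns Suc show ?thesis using lex_le_eq_iff[of l l'] by auto
    qed (simp add: Ns)
  qed simp
qed simp

lemma measurable_lex_le_upto:
  "Measurable.pred (tree_sig \<Otimes>\<^sub>M tree_sig) (\<lambda>(s, t). lex_le_upto n s t)"
proof (induction n)
  case (Suc n)
  note [measurable] = Suc
  have [measurable]: "Measurable.pred M (\<lambda>x. lex_le_upto n (f x) (g x))"
    if "f \<in> M \<rightarrow>\<^sub>M tree_sig" "g \<in> M \<rightarrow>\<^sub>M tree_sig" for M f g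
    using measurable_compose[OF measurable_Pair[OF that] Suc] by simp
  show ?case unfolding lex_le_upto.simps split_def by measurable
qed simp

lemma measurable_size_tree: "size \<in> tree_sig \<rightarrow>\<^sub>M count_space UNIV"
proof -
  have "size = rec_tree 0 (\<lambda>l (x::real) r m n. m + n + 1 :: nat)"
    by (rule ext) (induct_tac x, auto)
  also have "\<dots> \<in> tree_sig \<rightarrow>\<^sub>M count_space UNIV"
    by (rule measurable_rec_tree) (measurable)
  finally show ?thesis .
qed


lemma measurable_lex_le [measurable (raw)]:
  assumes f [measurable]: "f \<in> M \<rightarrow>\<^sub>M tree_sigma borel"
    and g [measurable]: "g \<in> M \<rightarrow>\<^sub>M tree_sigma borel"
  shows "Measurable.pred M (\<lambda>x. lex_le (f x) (g x))"
proof -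
  note [measurable] = measurable_size_tree
  have [measurable]: "Measurable.pred M (\<lambda>x. lex_le_upto n (f x) (g x))" for n
    using measurable_compose[OF measurable_Pair[OF f g] measurable_lex_le_upto] by simp
  have "lex_le s t \<longleftrightarrow> (\<exists>n. size s < n \<and> size t < n \<and> lex_le_upto n s t)" for s t
    using lex_le_upto[of s _ t] lex_le_upto[of s "Suc (size s + size t)" t]
    by (auto simp del: lex_le_upto.simps intro!: exI[of _ "Suc (size s + size t)"])
  then show ?thesis by simp
qed

lemma measurable_tree_eq:
  assumes [measurable]: "f \<in> M \<rightarrow>\<^sub>M tree_sigma borel" "g \<in> M \<rightarrow>\<^sub>M tree_sigma borel"
  shows "Measurable.pred M (\<lambda>x. f x = (g x :: real tree))"
  unfolding lex_le_eq_iff by measurable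

lemma measurable_cut_leaves [measurable]: "cut_leaves \<in> tree_sig \<rightarrow>\<^sub>M tree_sig"
proof -
  have "cut_leaves = rec_tree Leaf (\<lambda>l (x::real) r l' r'. if l = Leaf \<and> r = Leaf then Leaf else Node l' x r')"
    by (rule ext) (induct_tac x, auto)
  also have "\<dots> \<in> tree_sig \<rightarrow>\<^sub>M tree_sig" by (rule measurable_rec_tree) measurable
  finally show ?thesis .
qed

lemma measurable_merge_edge [measurable (raw)]:
  assumes [measurable]: "f \<in> M \<rightarrow>\<^sub>M tree_sig" "g \<in> M \<rightarrow>\<^sub>M borel" "h \<in> M \<rightarrow>\<^sub>M tree_sig"
  shows "(\<lambda>x. merge_edge (+) (f x) (g x) (h x)) \<in> M \<rightarrow>\<^sub>M tree_sig"
proof -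
  have *: "merge_edge (+) l x r = (case l of Leaf \<Rightarrow> (case r of Leaf \<Rightarrow> Node Leaf x Leaf | Node a y b \<Rightarrow> Node a (x + y) b)
     | Node a y b \<Rightarrow> (if r = Leaf then Node a (x + y) b else Node l x r))" for l r and x :: real
    by (cases l; cases r) auto
  show ?thesis unfolding * by measurable
qed

lemma measurable_series_reduction [measurable]: "series_reduction (+) \<in> tree_sig \<rightarrow>\<^sub>M tree_sig"
proof -
  have "series_reduction (+) = rec_tree Leaf (\<lambda>l (x::real) r l' r'. merge_edge (+) l' x r')"
    by (rule ext) (induct_tac x, auto)
  also have "\<dots> \<in> tree_sig \<rightarrow>\<^sub>M tree_sig" by (rule measurable_rec_tree) measurable
  finally show ?thesis .
qed

lemma measurable_pr [measurable]: "prune_pl \<in> tree_sig \<rightarrow>\<^sub>M tree_sig"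
  unfolding prune_planar_def[abs_def] by measurable

lemma measurable_before_upto:
  "f \<in> M \<rightarrow>\<^sub>M tree_sig \<Longrightarrow> g \<in> M \<rightarrow>\<^sub>M tree_sig \<Longrightarrow> Measurable.pred M (\<lambda>x. before_upto n (f x) (g x))"
proof (induction n arbitrary: f g)
  case (Suc n)
  note [measurable] = Suc.prems measurable_tree_eq
  have [measurable]: "Measurable.pred M (\<lambda>x. before_upto n (prune_pl (f x)) (prune_pl (g x)))"
    by (rule Suc.IH) measurable
  show ?case unfolding before_upto.simps by measurable
qed simp

lemma measurable_before [measurable (raw)]:
  assumes [measurable]: "f \<in> M \<rightarrow>\<^sub>M tree_sig" "g \<in> M \<rightarrow>\<^sub>M tree_sig"
  shows "Measurable.pred M (\<lambda>x. sibling_before (f x) (g x))"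
proof -
  note [measurable] = measurable_size_tree measurable_before_upto
  have "sibling_before s t \<longleftrightarrow> (\<exists>n. size s = n \<and> before_upto n s t)" for s t
    by (auto simp: sibling_before_def)
  then show ?thesis by simp
qed

lemma measurable_canon: "canon \<in> tree_sig \<rightarrow>\<^sub>M tree_sig"
proof -
  have "canon = rec_tree Leaf (\<lambda>l (x::real) r l' r'. if sibling_before l' r' then Node l' x r' else Node r' x l')"
    by (rule ext) (induct_tac x, auto simp: sorted_node_def)
  also have "\<dots> \<in> tree_sig \<rightarrow>\<^sub>M tree_sig" by (rule measurable_rec_tree) measurable
  finally show ?thesis .
qed

lift_definition embed_canon :: "real utree \<Rightarrow> real tree" is canon
  by (rule canon_swaps)

lemma sets_tree_space: "sets tree_space = {A. forget_embedding -` A \<in> sets (tree_sigma borel)}"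
proof -
  have sp: "space tree_sig = UNIV" by (simp add: space_tree_sigma)
  interpret sigma_algebra UNIV "{A. forget_embedding -` A \<in> sets (tree_sigma (borel::real measure))}"
  proof (unfold sigma_algebra_iff2, safe)
    fix s assume "forget_embedding -` s \<in> sets tree_sig"
    from sets.compl_sets[OF this] show "forget_embedding -` (UNIV - s) \<in> sets tree_sig"
      by (simp add: sp vimage_Diff)
  next
    fix A :: "nat \<Rightarrow> real utree set"
    assume "range A \<subseteq> {A. forget_embedding -` A \<in> sets tree_sig}"
    then show "forget_embedding -` (\<Union>i. A i) \<in> sets tree_sig"
      by (auto simp: vimage_UN)
  qed auto
  show ?thesis unfolding tree_space_def by (simp add: sigma_sets_eq)
qed

lemma space_tree_space [simp]: "space tree_space = UNIV"
  by (simp add: tree_space_def space_measure_of_conv)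

theorem ex_proper_embedding: "\<exists>E. proper_embedding E"
proof
  show "proper_embedding embed_canon"
    unfolding proper_embedding_def
  proof (intro conjI ballI allI impI)
    show "embed_canon \<in> tree_space \<rightarrow>\<^sub>M tree_sigma borel"
    proof (rule measurableI)
      fix A assume A: "A \<in> sets tree_sig"
      have "forget_embedding -` (embed_canon -` A) = canon -` A"
        by (auto simp: embed_canon.abs_eq)
      also have "\<dots> \<in> sets tree_sig"
        using measurable_sets[OF measurable_canon A] by (simp add: space_tree_sigma)
      finally show "embed_canon -` A \<inter> space tree_space \<in> sets tree_space"
        by (simp add: sets_tree_space)
    qed (simp add: space_tree_sigma)
    fix t assume "t \<in> metric_trees"
    then obtain s where s: "t = forget_embedding s" "reduced s"
      by (auto simp: metric_trees_def)
    show "forget_embedding (embed_canon t) = t"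
      using canon_same by (simp add: s embed_canon.abs_eq utree.abs_eq_iff)
    show "embed_canon (prune_metric t) = prune_pl (embed_canon t)"
      using canon_prune s by (simp add: embed_canon.abs_eq prune.abs_eq)
    show "embed_canon (scale_tree a t) = mult_tree a (embed_canon t)" if "0 < a" for a
      using that by (simp add: s scale_tree_def embed_canon.abs_eq map_utree.abs_eq canon_mult)
  qed
qed

end

theory Submission
  imports Defs
begin

text \<open>
  A branch of order \<open>j\<close> produces offspring of order \<open>i < j\<close> at rate \<open>\<gamma> c\<^bsup>2-j\<^esup> (c - 1) c\<^bsup>j-i-1\<^esup>\<close> and terminates
  at rate \<open>\<gamma> c\<^bsup>2-j\<^esup>\<close>; summed over all these events the rate is \<open>\<gamma> c\<close>, whatever \<open>j\<close> is.  Hence the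
  waiting times do not depend on the type of the event: given the shape, the edges are
  independent exponential variables of rate \<open>\<gamma> c\<close>, and the planar shapes have explicit product weights.

  An edge of the pruned tree merges a geometric number of edges, whose total length is exponential of
  rate \<open>\<gamma>\<close>, and pruning turns the weights of order \<open>K + 1\<close> into those of order \<open>K\<close>, so the scaling exponent is
  \<open>c\<close>.  The complete subtrees of order \<open>K\<close> form a stopping line of the branching process: given
  their number they are independent copies of the process started from order \<open>K\<close>, and so is a uniformly
  chosen one.  Criticality and time invariance follow from \<open>\<G>\<Lambda>\<pi> = 0\<close>, where the series may be
  rearranged because the entrywise absolute value of \<open>\<G>\<Lambda>\<close> maps \<open>\<pi>\<close> to at most a multiple of \<open>\<pi>\<close>.
\<close>

text \<open>Cutting a planar tree at the lower end of its root edge need not lower the order: after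
  a side branching the left part has the order of the whole tree. The recursions for sums over
  shapes are therefore not well founded, and infinite values may solve them too. The way around is
  to truncate by the number of edges, where induction gives upper bounds only, and to use that all
  the laws have mass one; for pruning, a bound valid for \<open>f\<close> and for
  \<open>1 - f\<close> is an equality. Mass one also shows that the branching history is almost
  surely finite.

  The choice p_K = 2^-K enters through p_(K+1) = p_K / 2: off the empty tree, the pruned law is half
  of the original law with all lengths multiplied by \<open>c\<close>.

  A proper embedding may arrange siblings according to their lengths, so the enumerated lengths are
  not independent and no formula for the density of the total length is at hand. Only the existence
  of such a density and its behaviour under a change of unit are used. As the exponent is a definite
  description, its uniqueness has to be shown as well.\<close>

section \<open>Growth rate, generating function and Horton exponent of the Tokunaga sequence\<close>

lemma growth_L_tok:
  assumes "1 < c"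
  shows "growth_L (tok_T c) = ereal c"
proof -
  have "(\<lambda>k. root k (tok_T c k)) \<longlonglongrightarrow> c"
  proof -
    \<comment> \<open>The sequence is (c - 1) c^k / c for positive \<open>k\<close>; its root splits
      into three factors, and the roots of the two constants tend to 1.\<close>
    have "(\<lambda>k. root k (c - 1) * c / root k c) \<longlonglongrightarrow> 1 * c / 1"
      using assms by (intro tendsto_intros LIMSEQ_root_const) auto
    moreover have "eventually (\<lambda>k. root k (c - 1) * c / root k c = root k (tok_T c k)) sequentially"
    proof (rule eventually_sequentiallyI[of 1])
      fix k :: nat assume k: "1 \<le> k"
      have "tok_T c k = (c - 1) * (c ^ k / c)"
        using assms k by (cases k) (auto simp: tok_T_def)
      then show "root k (c - 1) * c / root k c = root k (tok_T c k)"
        using assms k by (simp add: real_root_mult real_root_divide real_root_power_cancel)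
    qed
    ultimately show ?thesis using assms by (simp add: tendsto_cong)
  qed
  then have "(\<lambda>k. ereal (root k (tok_T c k))) \<longlonglongrightarrow> ereal c" by simp
  then show ?thesis unfolding growth_L_def by (intro lim_imp_Limsup) auto
qed

text \<open>For \<open>c = 1\<close> the growth rate is 0, and 1 / 0 is infinite in
  \<open>ereal\<close>: the domain is then the whole plane, whence the disjunct.\<close>

lemma in_domain_tok_iff:
  assumes "1 \<le> c"
  shows "in_domain (tok_T c) z \<longleftrightarrow> c = 1 \<or> norm z < 1 / c"
proof (cases "c = 1")
  case True
  then show ?thesis by (simp add: in_domain_def growth_L_tok_1 divide_ereal_def)
next
  case False
  then show ?thesis using assms by (simp add: in_domain_def growth_L_tok one_ereal_def)
qed

text \<open>A geometric series of ratio \<open>c * z\<close>. For \<open>c = 1\<close> the domain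
  contains the point 1, where the quotient would divide by zero; the last hypothesis excludes
  it.\<close>

lemma t_hat_tok:
  fixes z :: complex
  assumes "1 \<le> c" and "in_domain (tok_T c) z" and "1 - c * z \<noteq> 0"
  shows "t_hat (tok_T c) z = (1 - 2 * c * z) * (z - 1) / (1 - c * z)"
proof -
  have "(\<lambda>j. z ^ Suc j * of_real (tok_T c (Suc j))) sums ((c - 1) * z / (1 - c * z))"
  proof (cases "c = 1")
    case True
    then show ?thesis by (simp add: tok_T_def)
  next
    case False
    then have "norm (c * z) < 1"
      using assms by (simp add: in_domain_tok_iff norm_mult field_simps)
    from sums_mult[OF geometric_sums[OF this], of "(c - 1) * z"]
    show ?thesis by (simp add: tok_T_def power_mult_distrib mult_ac)
  qed
  then have "t_hat (tok_T c) z = - 1 + 2 * z + (c - 1) * z / (1 - c * z)"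
    unfolding t_hat_def by (simp add: sums_iff)
  also have "\<dots> = ((- 1 + 2 * z) * (1 - c * z) + (c - 1) * z) / (1 - c * z)"
    using assms(3) by (simp add: add_divide_distrib)
  also have "\<dots> = (1 - 2 * c * z) * (z - 1) / (1 - c * z)"
    by (simp add: algebra_simps)
  finally show ?thesis by simp
qed

text \<open>On the interval up to 1/2 the factor w - 1 does not vanish, so the zero comes from 1 - 2
  c w. Since \<open>1 \<le> c\<close>, that zero lies in the interval and inside the disc of
  convergence.\<close>

lemma horton_R_tok:
  assumes "1 \<le> c"
  shows "horton_R (tok_T c) = 2 * c"
proof -
  have root: "t_hat (tok_T c) (of_real w) = 0 \<longleftrightarrow> w = 1 / (2 * c)"
    if w: "0 < w" "w \<le> 1/2" "in_domain (tok_T c) (of_real w)" for w :: real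
  proof -
    have "c * w < 1"
      using w assms by (auto simp: in_domain_tok_iff field_simps)
    then have "1 - c * w \<noteq> 0" by simp
    then have nz: "1 - complex_of_real c * of_real w \<noteq> 0"
      by (metis of_real_1 of_real_diff of_real_mult of_real_eq_0_iff)
    have "t_hat (tok_T c) (of_real w) = of_real ((1 - 2 * c * w) * (w - 1) / (1 - c * w))"
      using t_hat_tok[OF assms w(3) nz] by simp
    then have "t_hat (tok_T c) (of_real w) = 0 \<longleftrightarrow> (1 - 2 * c * w) * (w - 1) / (1 - c * w) = 0"
      by (metis of_real_eq_0_iff)
    also have "\<dots> \<longleftrightarrow> 1 - 2 * c * w = 0"
      using w \<open>1 - c * w \<noteq> 0\<close> by auto
    also have "\<dots> \<longleftrightarrow> w = 1 / (2 * c)"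
      using assms by (auto simp: field_simps)
    finally show ?thesis .
  qed
  have "w0 (tok_T c) = 1 / (2 * c)"
    unfolding w0_def
  proof (rule the_equality)
    have dom: "in_domain (tok_T c) (of_real (1 / (2 * c)))"
      using assms by (simp add: in_domain_tok_iff norm_divide norm_mult field_simps)
    then show "0 < 1 / (2 * c) \<and> 1 / (2 * c) \<le> 1 / 2 \<and> in_domain (tok_T c) (of_real (1 / (2 * c))) \<and>
        t_hat (tok_T c) (of_real (1 / (2 * c))) = 0"
      using assms root[OF _ _ dom] by (simp add: field_simps)
  qed (use root in blast)
  then show ?thesis by (simp add: horton_R_def)
qed

section \<open>Criticality\<close>

abbreviation tok_gen :: "real \<Rightarrow> real \<Rightarrow> real \<Rightarrow> nat \<Rightarrow> nat \<Rightarrow> real" where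
  "tok_gen c \<gamma> s \<equiv> (\<lambda>i j. toeplitz_G (tok_T c) i j * tok_lam c \<gamma> j * s)"

text \<open>In units of the diagonal term, the products with \<pi> are (c + 1) / (2 c) next to the
  diagonal and (c - 1) / c * 2^-k at distance k \<ge> 2. Together the off-diagonal ones give (c + 1)
  / (2 c) + (c - 1) / (2 c) = 1, so they cancel the diagonal and, in absolute value, double
  it.\<close>

lemma tok_gen_pi:
  assumes "0 < \<gamma>" "1 \<le> c" "1 \<le> i"
  shows "((\<lambda>j. tok_gen c \<gamma> s i j * tok_p j) has_sum 0) {i..}"
    and "((\<lambda>j. \<bar>tok_gen c \<gamma> s i j * tok_p j\<bar>) has_sum (2 * \<gamma> * c\<^sup>2 * \<bar>s\<bar> * (1 / c ^ i) * tok_p i)) {i..}"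
proof -
  let ?K = "\<gamma> * c\<^sup>2 * s * (1 / c ^ i) * tok_p i"
  have lam: "tok_lam c \<gamma> j = \<gamma> * c\<^sup>2 / c ^ j" for j
    using assms by (simp add: tok_lam_def power_int_diff)
  have entry: "tok_gen c \<gamma> s i (i + k) * tok_p (i + k) =
     ?K * (if k = 0 then -1 else if k = 1 then (c + 1) / (2 * c) else (c - 1) / c * (1 / 2) ^ k)" for k
    using assms by (cases k) (auto simp: toeplitz_G_def lam tok_p_def tok_T_def power_add field_simps)
  have reindex: "(f has_sum a) {i..} \<longleftrightarrow> ((\<lambda>k. f (i + k)) has_sum a) UNIV" for f :: "nat \<Rightarrow> real" and a
    using has_sum_reindex[of "\<lambda>k. i + k" UNIV f a]
    by (auto simp: o_def image_add_atLeast inj_on_def atLeast_0[symmetric] simp del: atLeast_0)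
  let ?g = "\<lambda>k::nat. if k = 0 then 1 else if k = 1 then (c + 1) / (2 * c) else (c - 1) / c * (1 / 2 :: real) ^ k"
  have nn: "0 \<le> ?g k" for k using assms by auto
  \<comment> \<open>The pure geometric series sums to 2 (c - 1) / c; exchanging its terms at 0 and 1
    for those of \<open>?g\<close> raises the sum to 2.\<close>
  have S: "?g sums 2"
  proof -
    have "(\<lambda>k. (c - 1) / c * (1 / 2) ^ k) sums ((c - 1) / c * (1 / (1 - 1 / 2)))"
      by (intro sums_mult geometric_sums) auto
    from sums_If_finite_set'[OF this, of "{0,1}" "2" ?g]
    have "(\<lambda>k. if k \<in> {0, 1} then ?g k else (c - 1) / c * (1 / 2) ^ k) sums 2"
      using assms by (simp add: field_simps)
    moreover have "(\<lambda>k. if k \<in> {0, 1} then ?g k else (c - 1) / c * (1 / 2) ^ k) = ?g"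
      by auto
    ultimately show ?thesis by (simp only:)
  qed
  have S': "(\<lambda>k. if k = 0 then - 1 else ?g k) sums 0"
  proof -
    from sums_If_finite_set'[OF S, of "{0}" "0" "\<lambda>k. - 1"] show ?thesis
      by (simp cong: if_cong)
  qed
  have hs: "(?g has_sum 2) UNIV"
    using S nn by (simp add: sums_nonneg_imp_has_sum)
  have hs': "((\<lambda>k. if k = 0 then - 1 else ?g k) has_sum 0) UNIV"
  proof (rule norm_summable_imp_has_sum[OF _ S'])
    show "summable (\<lambda>k. norm (if k = 0 then - 1 else ?g k))"
      by (rule summable_comparison_test'[OF sums_summable[OF S], of 0]) (use nn assms in auto)
  qed
  show "((\<lambda>j. tok_gen c \<gamma> s i j * tok_p j) has_sum 0) {i..}"
    using has_sum_cmult_right[OF hs', of ?K] unfolding reindex entry by (simp cong: if_cong)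
  have *: "\<bar>tok_gen c \<gamma> s i (i + k) * tok_p (i + k)\<bar> = (\<gamma> * c\<^sup>2 * \<bar>s\<bar> * (1 / c ^ i) * tok_p i) * ?g k" for k
    unfolding entry abs_mult using assms nn[of k] by (auto simp: abs_mult tok_p_def)
  show "((\<lambda>j. \<bar>tok_gen c \<gamma> s i j * tok_p j\<bar>) has_sum (2 * \<gamma> * c\<^sup>2 * \<bar>s\<bar> * (1 / c ^ i) * tok_p i)) {i..}"
    using has_sum_cmult_right[OF hs, of "\<gamma> * c\<^sup>2 * \<bar>s\<bar> * (1 / c ^ i) * tok_p i"]
    unfolding reindex * by (simp add: mult_ac)
qed

lemma image_Suc_UNIV: "range Suc = {Suc 0..}"
  by (auto simp: image_iff Suc_le_eq gr0_conv_Suc)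

text \<open>Fubini for double series. The last two conclusions return the kind of information that
  the hypotheses require, absolute summability with a bound, so that the estimate can be iterated
  over the powers of a matrix.\<close>

lemma abs_summable_swap:
  fixes f :: "'a \<Rightarrow> 'b \<Rightarrow> real"
  assumes row: "\<And>x. x \<in> A \<Longrightarrow> (\<lambda>y. \<bar>f x y\<bar>) summable_on B"
    and bound: "\<And>x. x \<in> A \<Longrightarrow> (\<Sum>\<^sub>\<infinity>y\<in>B. \<bar>f x y\<bar>) \<le> g x"
    and g: "g summable_on A"
  shows "((\<lambda>y. \<Sum>\<^sub>\<infinity>x\<in>A. f x y) has_sum (\<Sum>\<^sub>\<infinity>x\<in>A. \<Sum>\<^sub>\<infinity>y\<in>B. f x y)) B"
    and "(\<lambda>y. \<bar>\<Sum>\<^sub>\<infinity>x\<in>A. f x y\<bar>) summable_on B"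
    and "(\<Sum>\<^sub>\<infinity>y\<in>B. \<bar>\<Sum>\<^sub>\<infinity>x\<in>A. f x y\<bar>) \<le> (\<Sum>\<^sub>\<infinity>x\<in>A. g x)"
proof -
  have nn: "0 \<le> (\<Sum>\<^sub>\<infinity>y\<in>B. \<bar>f x y\<bar>)" for x by (intro infsum_nonneg) auto
  have rows: "(\<lambda>x. \<Sum>\<^sub>\<infinity>y\<in>B. \<bar>f x y\<bar>) summable_on A"
    by (rule summable_on_comparison_test[OF g]) (use nn bound in auto)
  have abs: "(\<lambda>(x, y). \<bar>f x y\<bar>) summable_on A \<times> B"
    using Infinite_Sum.abs_summable_on_Sigma_iff[where f = "\<lambda>(x, y). f x y" and A = A and B = "\<lambda>_. B"] row rows nn
    by (simp add: split_def)
  then have f: "(\<lambda>(x, y). f x y) summable_on A \<times> B"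
    using summable_on_iff_abs_summable_on_real[of "\<lambda>(x, y). f x y"] by (simp add: split_def)
  have swapped: "(\<lambda>(y, x). h x y) summable_on B \<times> A" if "(\<lambda>(x, y). h x y) summable_on A \<times> B"
    for h :: "'a \<Rightarrow> 'b \<Rightarrow> real"
    using that summable_on_reindex[of prod.swap "B \<times> A" "\<lambda>(x, y). h x y"]
    by (simp add: o_def split_def product_swap)
  have colsum: "(\<lambda>y. \<Sum>\<^sub>\<infinity>x\<in>A. h x y) summable_on B" if "(\<lambda>(x, y). h x y) summable_on A \<times> B"
    for h :: "'a \<Rightarrow> 'b \<Rightarrow> real"
    using summable_on_Sigma_banach[OF swapped[OF that]] by simp
  show "((\<lambda>y. \<Sum>\<^sub>\<infinity>x\<in>A. f x y) has_sum (\<Sum>\<^sub>\<infinity>x\<in>A. \<Sum>\<^sub>\<infinity>y\<in>B. f x y)) B"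
    using has_sum_infsum[OF colsum[OF f]] infsum_swap_banach[OF f] by simp
  then show F: "(\<lambda>y. \<bar>\<Sum>\<^sub>\<infinity>x\<in>A. f x y\<bar>) summable_on B"
    using summable_on_iff_abs_summable_on_real[of "\<lambda>y. \<Sum>\<^sub>\<infinity>x\<in>A. f x y" B] has_sum_imp_summable by auto
  have cols: "(\<lambda>x. \<bar>f x y\<bar>) summable_on A" if "y \<in> B" for y
    using Infinite_Sum.abs_summable_on_Sigma_iff[where f = "\<lambda>(y, x). f x y" and A = B and B = "\<lambda>_. A"] swapped[OF abs] that
    by (simp add: split_def)
  have "(\<Sum>\<^sub>\<infinity>y\<in>B. \<bar>\<Sum>\<^sub>\<infinity>x\<in>A. f x y\<bar>) \<le> (\<Sum>\<^sub>\<infinity>y\<in>B. \<Sum>\<^sub>\<infinity>x\<in>A. \<bar>f x y\<bar>)"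
    using norm_infsum_bound[of "\<lambda>x. f x y" A for y] cols
    by (intro infsum_mono F colsum[OF abs]) auto
  also have "\<dots> = (\<Sum>\<^sub>\<infinity>x\<in>A. \<Sum>\<^sub>\<infinity>y\<in>B. \<bar>f x y\<bar>)"
    using infsum_swap_banach[OF abs] by simp
  also have "\<dots> \<le> (\<Sum>\<^sub>\<infinity>x\<in>A. g x)"
    by (intro infsum_mono rows g bound)
  finally show "(\<Sum>\<^sub>\<infinity>y\<in>B. \<bar>\<Sum>\<^sub>\<infinity>x\<in>A. f x y\<bar>) \<le> (\<Sum>\<^sub>\<infinity>x\<in>A. g x)" .
qed

lemma triangular_power_lower: "j < i \<Longrightarrow> triangular_power A n i j = 0"
  by (cases n) auto

text \<open>Row \<open>i\<close> of the next power combines the rows k \<ge> i of the previous one,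
  so summing over \<open>j\<close> before \<open>k\<close> reduces the claim to the induction
  hypothesis, or to the vanishing of the generator on \<pi> for the step from 0 to 1. The bound, a
  factor 2 \<gamma> c \<bar>s\<bar> per step, both justifies the interchange and later makes the
  exponential series converge.\<close>

lemma triangular_power_pi:
  assumes "0 < \<gamma>" "1 \<le> c" "1 \<le> i"
  shows "((\<lambda>j. triangular_power (tok_gen c \<gamma> s) n i j * tok_p j) has_sum (if n = 0 then tok_p i else 0)) {1..}"
    and "(\<lambda>j. \<bar>triangular_power (tok_gen c \<gamma> s) n i j * tok_p j\<bar>) summable_on {1..}"
    and "(\<Sum>\<^sub>\<infinity>j\<in>{1..}. \<bar>triangular_power (tok_gen c \<gamma> s) n i j * tok_p j\<bar>) \<le> (2 * \<gamma> * c * \<bar>s\<bar>) ^ n * tok_p i"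
  using assms(3)
proof (induction n arbitrary: i)
  case 0
  {
    case 1
    have "((\<lambda>j. (if i = j then 1 else 0) * tok_p j) has_sum tok_p i) {1..}"
      using 1 by (intro has_sum_finite_neutralI[of "{i}"]) auto
    then show ?case by simp
  next
    case 2
    have "(\<lambda>j. \<bar>(if i = j then 1 else 0) * tok_p j\<bar>) summable_on {1..}"
      using 2 summable_on_cong_neutral[of "{i}" "{1..}" "\<lambda>j. \<bar>(if i = j then 1 else 0) * tok_p j\<bar>" "\<lambda>j. \<bar>(if i = j then 1 else 0) * tok_p j\<bar>"]
      by auto
    then show ?case by simp
  next
    case 3
    have "(\<Sum>\<^sub>\<infinity>j\<in>{1..}. \<bar>(if i = j then 1 else 0) * tok_p j\<bar>) = (\<Sum>\<^sub>\<infinity>j\<in>{i}. tok_p j)"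
      using 3 by (intro infsum_cong_neutral) (auto simp: tok_p_def)
    then show ?case by simp
  }
next
  case (Suc n)
  let ?A = "tok_gen c \<gamma> s" and ?P = "triangular_power (tok_gen c \<gamma> s)" and ?C = "2 * \<gamma> * c * \<bar>s\<bar>"
  {
    fix i :: nat assume i: "1 \<le> i"
    let ?f = "\<lambda>k j. ?A i k * (?P n k j * tok_p j)"
    let ?g = "\<lambda>k. ?C ^ n * \<bar>?A i k * tok_p k\<bar>"
    have 1: "(\<lambda>j. \<bar>?f k j\<bar>) summable_on {1..}" "(\<Sum>\<^sub>\<infinity>j\<in>{1..}. \<bar>?f k j\<bar>) \<le> ?g k" if "k \<in> {i..}" for k
    proof -
      from i that have k: "1 \<le> k" by simp
      show "(\<lambda>j. \<bar>?f k j\<bar>) summable_on {1..}"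
        unfolding abs_mult[of "?A i k"] by (intro summable_on_cmult_right Suc.IH k)
      have "(\<Sum>\<^sub>\<infinity>j\<in>{1..}. \<bar>?f k j\<bar>) = \<bar>?A i k\<bar> * (\<Sum>\<^sub>\<infinity>j\<in>{1..}. \<bar>?P n k j * tok_p j\<bar>)"
        unfolding abs_mult[of "?A i k"] by (intro infsum_cmult_right Suc.IH k)
      also have "\<dots> \<le> \<bar>?A i k\<bar> * (?C ^ n * tok_p k)"
        by (intro mult_left_mono Suc.IH k) auto
      finally show "(\<Sum>\<^sub>\<infinity>j\<in>{1..}. \<bar>?f k j\<bar>) \<le> ?g k"
        by (simp add: abs_mult tok_p_def mult_ac)
    qed
    have g: "(?g has_sum (?C ^ n * (2 * \<gamma> * c\<^sup>2 * \<bar>s\<bar> * (1 / c ^ i) * tok_p i))) {i..}"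
      by (intro has_sum_cmult_right tok_gen_pi assms i)
    have bound: "?C ^ n * (2 * \<gamma> * c\<^sup>2 * \<bar>s\<bar> * (1 / c ^ i) * tok_p i) \<le> ?C ^ Suc n * tok_p i"
    proof -
      \<comment> \<open>The rows start at 1, and this makes the growth factor independent of the
        row.\<close>
      have "c\<^sup>2 * (1 / c ^ i) \<le> c"
        using assms i self_le_power[of c i] by (simp add: power2_eq_square divide_simps mult_le_cancel_left)
      then have "?C ^ n * (2 * \<gamma> * \<bar>s\<bar> * tok_p i * (c\<^sup>2 * (1 / c ^ i))) \<le> ?C ^ n * (2 * \<gamma> * \<bar>s\<bar> * tok_p i * c)"
        using assms by (intro mult_left_mono) (auto simp: tok_p_def)
      then show ?thesis by (simp add: mult_ac)
    qed
    \<comment> \<open>Entries below the diagonal vanish, so only the finite sum from the definition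
      of the matrix power is left.\<close>
    have row: "(\<Sum>\<^sub>\<infinity>k\<in>{i..}. ?f k j) = ?P (Suc n) i j * tok_p j" for j
    proof -
      have "(\<Sum>\<^sub>\<infinity>k\<in>{i..}. ?f k j) = (\<Sum>\<^sub>\<infinity>k\<in>{i..j}. ?f k j)"
        by (intro infsum_cong_neutral) (auto simp: triangular_power_lower)
      also have "\<dots> = ?P (Suc n) i j * tok_p j"
        by (simp add: sum_distrib_right mult.assoc)
      finally show ?thesis .
    qed
    have "(\<Sum>\<^sub>\<infinity>k\<in>{i..}. \<Sum>\<^sub>\<infinity>j\<in>{1..}. ?f k j) = 0"
    proof -
      have "(\<Sum>\<^sub>\<infinity>j\<in>{1..}. ?f k j) = ?A i k * (if n = 0 then tok_p k else 0)" if "k \<in> {i..}" for k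
        using that i by (intro infsumI has_sum_cmult_right Suc.IH) auto
      then have "(\<Sum>\<^sub>\<infinity>k\<in>{i..}. \<Sum>\<^sub>\<infinity>j\<in>{1..}. ?f k j) = (\<Sum>\<^sub>\<infinity>k\<in>{i..}. ?A i k * (if n = 0 then tok_p k else 0))"
        by (intro infsum_cong) auto
      also have "\<dots> = 0"
        using infsumI[OF tok_gen_pi(1)[OF assms(1,2) i, of s]] by (cases "n = 0") auto
      finally show ?thesis .
    qed
    with abs_summable_swap[where f = ?f and g = ?g, OF 1 has_sum_imp_summable[OF g], unfolded row] infsumI[OF g] bound
    have "((\<lambda>j. ?P (Suc n) i j * tok_p j) has_sum 0) {1..} \<and>
      (\<lambda>j. \<bar>?P (Suc n) i j * tok_p j\<bar>) summable_on {1..} \<and>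
      (\<Sum>\<^sub>\<infinity>j\<in>{1..}. \<bar>?P (Suc n) i j * tok_p j\<bar>) \<le> ?C ^ Suc n * tok_p i"
      by (simp del: triangular_power.simps)
  }
  note * = this
  case 1 show ?case using *[OF 1] by (simp del: triangular_power.simps)
  case 2 show ?case using *[OF 2] by (simp del: triangular_power.simps)
  case 3 show ?case using *[OF 3] by (simp del: triangular_power.simps)
qed

text \<open>After the exponential series is interchanged with the sum over \<open>j\<close>, only
  its term for n = 0 survives, and that term is \<pi>. The interchange is dominated by the scalar
  series for exp (2 \<gamma> c \<bar>s\<bar>).\<close>

lemma state_terms_has_sum:
  assumes "0 < \<gamma>" "1 \<le> c" "1 \<le> i"
  shows "(state_terms (tok_T c) (tok_lam c \<gamma>) tok_p s i has_sum tok_p i) {1..}"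
proof -
  let ?P = "triangular_power (tok_gen c \<gamma> s)" and ?C = "2 * \<gamma> * c * \<bar>s\<bar>"
  let ?f = "\<lambda>n j. 1 / fact n * (?P n i j * tok_p j)"
  let ?g = "\<lambda>n. ?C ^ n / fact n * tok_p i"
  note pi = triangular_power_pi[OF assms, of s]
  have 1: "(\<lambda>j. \<bar>?f n j\<bar>) summable_on {1..}" for n
    unfolding abs_mult[of "1 / fact n"] by (intro summable_on_cmult_right pi)
  have 2: "(\<Sum>\<^sub>\<infinity>j\<in>{1..}. \<bar>?f n j\<bar>) \<le> ?g n" for n
  proof -
    have "(\<Sum>\<^sub>\<infinity>j\<in>{1..}. \<bar>?f n j\<bar>) = \<bar>1 / fact n\<bar> * (\<Sum>\<^sub>\<infinity>j\<in>{1..}. \<bar>?P n i j * tok_p j\<bar>)"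
      unfolding abs_mult[of "1 / fact n"] by (intro infsum_cmult_right pi)
    also have "\<dots> \<le> \<bar>1 / fact n\<bar> * (?C ^ n * tok_p i)"
      by (intro mult_left_mono pi) auto
    finally show ?thesis by simp
  qed
  have 3: "?g summable_on UNIV"
  proof (intro summable_nonneg_imp_summable_on)
    show "summable ?g"
      using summable_exp[of ?C] by (intro summable_mult2) (simp add: divide_inverse mult.commute)
    show "0 \<le> ?g n" for n using assms by (auto simp: tok_p_def)
  qed
  note swap = abs_summable_swap[where f = ?f and g = ?g and A = UNIV and B = "{1..}", OF 1 2 3]
  have row: "(\<Sum>\<^sub>\<infinity>j\<in>{1..}. ?f n j) = (if n = 0 then tok_p i else 0)" for n
    using infsumI[OF has_sum_cmult_right[OF pi(1), of "1 / fact n"]] by simp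
  have "(\<Sum>\<^sub>\<infinity>n\<in>UNIV. \<Sum>\<^sub>\<infinity>j\<in>{1..}. ?f n j) = (\<Sum>\<^sub>\<infinity>n::nat. if n = 0 then tok_p i else 0)"
    by (intro infsum_cong row)
  also have "\<dots> = (\<Sum>\<^sub>\<infinity>n\<in>{0::nat}. tok_p i)"
    by (intro infsum_cong_neutral) auto
  finally have "(\<Sum>\<^sub>\<infinity>n\<in>UNIV. \<Sum>\<^sub>\<infinity>j\<in>{1..}. ?f n j) = tok_p i" by simp
  then have sum: "((\<lambda>j. \<Sum>\<^sub>\<infinity>n. ?f n j) has_sum tok_p i) {1..}"
    using swap(1) by simp
  have "(\<Sum>\<^sub>\<infinity>n. ?f n j) = state_terms (tok_T c) (tok_lam c \<gamma>) tok_p s i j" if j: "j \<in> {1..}" for j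
  proof -
    have "(\<lambda>n. \<bar>?f n j\<bar>) summable_on UNIV"
    proof (rule summable_on_comparison_test[OF 3])
      fix n
      have "\<bar>?f n j\<bar> \<le> (\<Sum>\<^sub>\<infinity>j\<in>{1..}. \<bar>?f n j\<bar>)"
        using finite_sum_le_infsum[OF 1, of "{j}"] j by auto
      then show "\<bar>?f n j\<bar> \<le> ?g n"
        using 2[of n] by simp
    qed simp
    then have "(\<lambda>n. ?f n j) summable_on UNIV"
      using summable_on_iff_abs_summable_on_real[of "\<lambda>n. ?f n j"] by simp
    then have "(\<lambda>n. ?f n j) sums (\<Sum>\<^sub>\<infinity>n. ?f n j)"
      by (intro has_sum_imp_sums has_sum_infsum)
    then have "(\<Sum>\<^sub>\<infinity>n. ?f n j) = (\<Sum>n. ?P n i j / fact n * tok_p j)"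
      by (simp add: sums_iff)
    \<comment> \<open>The series without the factor \<open>tok_p j\<close> is obtained by dividing
      by this positive number.\<close>
    moreover have "summable (\<lambda>n. ?P n i j / fact n)"
      using sums_summable[OF \<open>(\<lambda>n. ?f n j) sums _\<close>] summable_mult2[of "\<lambda>n. ?f n j" "1 / tok_p j"]
      by (simp add: tok_p_def)
    ultimately show ?thesis
      by (simp add: state_terms_def transition_def triangular_exp_def suminf_mult2)
  qed
  with sum show ?thesis by (subst (asm) has_sum_cong)
qed

lemma time_invariant_tok:
  assumes "0 < \<gamma>" "1 \<le> c"
  shows "time_invariant (tok_T c) (tok_lam c \<gamma>) tok_p"
  using assms state_terms_has_sum unfolding time_invariant_def by blast

text \<open>The state at time \<open>s\<close> is \<pi> again, so the width is the mass of \<pi>, a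
  geometric series with sum 1.\<close>

lemma critical_tok:
  assumes "0 < \<gamma>" "1 \<le> c"
  shows "critical (tok_T c) (tok_lam c \<gamma>) tok_p"
  unfolding critical_def
proof (intro allI impI conjI)
  fix s :: real and i :: nat assume "0 \<le> s" "1 \<le> i"
  then show "state_terms (tok_T c) (tok_lam c \<gamma>) tok_p s i summable_on {1..}"
    using assms state_terms_has_sum has_sum_imp_summable by blast
next
  fix s :: real assume "0 \<le> s"
  have p: "tok_p sums 2" unfolding tok_p_def
    using geometric_sums[of "1/2 :: real"] by (simp add: power_divide)
  have "(\<lambda>n. tok_p (Suc n)) sums 1"
    using p sums_Suc_iff[of tok_p 1] by (simp add: tok_p_def)
  then have "((\<lambda>n. tok_p (Suc n)) has_sum 1) UNIV"
    by (intro sums_nonneg_imp_has_sum) (auto simp: tok_p_def)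
  then have "(tok_p has_sum 1) {1..}"
    using has_sum_reindex[of Suc UNIV tok_p "1::real"] by (simp add: o_def image_Suc_UNIV)
  then have "(\<Sum>\<^sub>\<infinity>i\<in>{1..}. tok_p i) = 1"
    by (rule infsumI)
  moreover have "\<bar>\<Sum>\<^sub>\<infinity>K\<in>{1..}. state_terms (tok_T c) (tok_lam c \<gamma>) tok_p s i K\<bar> = tok_p i" if "i \<in> {1..}" for i
    using infsumI[OF state_terms_has_sum[OF assms, of i s]] that by (simp add: tok_p_def)
  ultimately show "width (tok_T c) (tok_lam c \<gamma>) tok_p s = 1"
    unfolding width_def by (subst infsum_cong[of "{1..}" _ tok_p]) auto
qed


section \<open>Planar trees\<close>

text \<open>The unmarked planar trees are a point together with the pairs of such trees. All
  recursions over shapes start from this decomposition.\<close>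

lemma nn_integral_count_space_tree:
  fixes f :: "unit tree \<Rightarrow> ennreal"
  shows "(\<integral>\<^sup>+s. f s \<partial>count_space UNIV) =
    f Leaf + (\<integral>\<^sup>+l. \<integral>\<^sup>+r. f (Node l () r) \<partial>count_space UNIV \<partial>count_space UNIV)"
proof -
  let ?N = "\<lambda>(l, r). Node l () r :: unit tree"
  have "(\<integral>\<^sup>+s. f s \<partial>count_space UNIV) = (\<integral>\<^sup>+s. f s \<partial>count_space (insert Leaf (range ?N)))"
  proof -
    have "s \<in> insert Leaf (range ?N)" for s :: "unit tree" by (cases s) auto
    then have "insert Leaf (range ?N) = UNIV" by blast
    then show ?thesis by simp
  qed
  also have "\<dots> = (\<integral>\<^sup>+s. f s * indicator {Leaf} s + f s * indicator (range ?N) s \<partial>count_space UNIV)"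
    by (subst nn_integral_count_space_indicator) (auto intro!: nn_integral_cong split: split_indicator)
  also have "\<dots> = f Leaf + (\<integral>\<^sup>+s. f s \<partial>count_space (range ?N))"
    by (subst nn_integral_add) (auto simp: nn_integral_count_space_indicator one_ennreal_def[symmetric])
  also have "(\<integral>\<^sup>+s. f s \<partial>count_space (range ?N)) = (\<integral>\<^sup>+p. f (?N p) \<partial>count_space UNIV)"
    by (intro nn_integral_bij_count_space[symmetric] bij_betw_imageI) (auto simp: inj_on_def)
  also have "\<dots> = (\<integral>\<^sup>+l. \<integral>\<^sup>+r. f (Node l () r) \<partial>count_space UNIV \<partial>count_space UNIV)"
    using nn_integral_fst_count_space[of "\<lambda>p. f (?N p)"] by simp
  finally show ?thesis .
qed

text \<open>Computed upwards from the leaves, whereas \<open>order\<close> counts prunings; on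
  reduced trees the two agree. This version also makes sense for shapes and suits structural
  induction.\<close>

primrec strahler :: "'a tree \<Rightarrow> nat" where
  "strahler Leaf = 0"
| "strahler (Node l x r) =
    (if strahler l = strahler r then Suc (strahler l) else max (strahler l) (strahler r))"

lemma strahler_eq_0_iff [simp]: "strahler t = 0 \<longleftrightarrow> t = Leaf" "0 = strahler t \<longleftrightarrow> t = Leaf"
  by (cases t; auto)+

lemma strahler_map [simp]: "strahler (map_tree f t) = strahler t"
  by (induction t) auto

lemma merge_edge_eq_Leaf_iff [simp]: "merge_edge f l x r \<noteq> Leaf" 
  by (cases l; cases r) auto

lemma strahler_merge_edge:
  "strahler (merge_edge f l x r) =
    (if l = Leaf \<and> r = Leaf then 1 else if l = Leaf then strahler r else if r = Leaf then strahler l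
     else strahler (Node l x r))"
  by (cases l; cases r) auto

text \<open>In a reduced tree an inner vertex has two nonempty sides. A side of number 1 is pruned
  away and the edge merges with the other side, which alone determines the number; if both sides
  have number 1, a single edge remains.\<close>

lemma strahler_prune_planar: "reduced t \<Longrightarrow> strahler (prune_planar f t) = strahler t - 1"
proof (induction t)
  case (Node l x r)
  show ?case
  proof (cases "l = Leaf")
    case True
    with Node.prems show ?thesis by (simp add: prune_planar_Node)
  next
    case False
    with Node have IH: "strahler (prune_planar f l) = strahler l - 1" "strahler (prune_planar f r) = strahler r - 1"
      and nz: "0 < strahler l" "0 < strahler r"
      by (auto simp del: neq0_conv simp: neq0_conv[symmetric])
    have lf: "prune_planar f t = Leaf \<longleftrightarrow> strahler (prune_planar f t) = 0" for t
      by simp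
    show ?thesis
    proof -
      have "strahler (prune_planar f (Node l x r)) =
          strahler (merge_edge f (prune_planar f l) x (prune_planar f r))"
        using False by (simp add: prune_planar_Node)
      also have "\<dots> = strahler (Node l x r) - 1"
        using nz unfolding strahler_merge_edge lf strahler.simps IH by auto
      finally show ?thesis .
    qed
  qed
qed simp

lemma reduced_merge_edge: "reduced l \<Longrightarrow> reduced r \<Longrightarrow> reduced (merge_edge f l x r)"
  by (cases l; cases r) auto

lemma reduced_prune_planar: "reduced t \<Longrightarrow> reduced (prune_planar f t)"
  by (induction t) (auto simp: prune_planar_Node reduced_merge_edge)

lemma reduced_swaps: "same_up_to_swaps s t \<Longrightarrow> reduced s \<longleftrightarrow> reduced t"
  by (induction rule: same_up_to_swaps.induct) (auto dest: same_up_to_swaps_Leaf_iff)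

lemma order_forget:
  assumes "reduced t"
  shows "order (forget_embedding t) = strahler t"
proof -
  have pow: "(prune_metric ^^ k) (forget_embedding t) = forget_embedding ((prune_planar (+) ^^ k) t)" for k
    by (induction k) (auto simp: prune.abs_eq)
  have red: "reduced ((prune_planar (+) ^^ k) t)" for k
    using assms by (induction k) (auto simp: reduced_prune_planar)
  have str: "strahler ((prune_planar (+) ^^ k) t) = strahler t - k" for k
    by (induction k) (auto simp: strahler_prune_planar red)
  have empty: "forget_embedding s = empty_tree \<longleftrightarrow> s = Leaf" for s :: "real tree"
    using same_up_to_swaps_Leaf_iff[of s Leaf]
    by (auto simp: empty_tree.abs_eq utree.abs_eq_iff intro: same_up_to_swaps.intros)
  have "(prune_metric ^^ k) (forget_embedding t) = empty_tree \<longleftrightarrow> strahler t \<le> k" for k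
    unfolding pow empty strahler_eq_0_iff[symmetric] str by simp
  then show ?thesis
    unfolding order_def by (simp add: Least_equality)
qed

lemma map_tree_merge_edge:
  assumes "\<And>x y. h (f x y) = g (h x) (h y)"
  shows "map_tree h (merge_edge f l x r) = merge_edge g (map_tree h l) (h x) (map_tree h r)"
  using assms by (cases l; cases r) auto

lemma map_tree_prune_planar:
  assumes "\<And>x y. h (f x y) = g (h x) (h y)"
  shows "map_tree h (prune_planar f t) = prune_planar g (map_tree h t)"
  by (induction t) (auto simp: prune_planar_Node map_tree_merge_edge[of h f g, OF assms])

lemma shape_prune: "shape (prune_metric t) = prune_shape (shape t)"
  by (induction t rule: utree.abs_induct) (simp add: shape_def prune.abs_eq map_utree.abs_eq map_tree_prune_planar)

lemma shape_forget: "shape (forget_embedding t) = forget_embedding (map_tree (\<lambda>_. ()) t)"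
  by (simp add: shape_def map_utree.abs_eq)


section \<open>Exponential edge lengths\<close>

lemma prob_space_exponential: "0 < b \<Longrightarrow> prob_space (exponential b)"
  unfolding exponential_def by (rule prob_space_exponential_density)

lemma sets_exponential [measurable_cong, simp]: "sets (exponential b) = sets borel"
  by (simp add: exponential_def)

lemma space_exponential [simp]: "space (exponential b) = UNIV"
  by (simp add: exponential_def)

lemma nn_integral_exponential:
  assumes "f \<in> borel_measurable borel"
  shows "(\<integral>\<^sup>+x. f x \<partial>exponential b) = (\<integral>\<^sup>+x. ennreal (exponential_density b x) * f x \<partial>lborel)"
  unfolding exponential_def using assms by (subst nn_integral_density) auto

lemma nn_integral_exponential_scale:
  assumes "0 < a" "0 < b" and [measurable]: "f \<in> borel_measurable borel"
  shows "(\<integral>\<^sup>+x. f (a * x) \<partial>exponential b) = (\<integral>\<^sup>+x. f x \<partial>exponential (b / a))"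
proof -
  have "(\<integral>\<^sup>+x. f x \<partial>exponential (b / a)) = ennreal \<bar>a\<bar> * (\<integral>\<^sup>+x. ennreal (exponential_density (b / a) (0 + a * x)) * f (0 + a * x) \<partial>lborel)"
    using assms(1) nn_integral_real_affine[of "\<lambda>x. ennreal (exponential_density (b / a) x) * f x" a 0]
    by (simp add: nn_integral_exponential)
  also have "\<dots> = (\<integral>\<^sup>+x. ennreal a * ennreal (exponential_density (b / a) (a * x)) * f (a * x) \<partial>lborel)"
    using assms(1) by (subst nn_integral_cmult[symmetric]) (auto simp: mult.assoc)
  also have "\<dots> = (\<integral>\<^sup>+x. ennreal (exponential_density b x) * f (a * x) \<partial>lborel)"
  proof (intro nn_integral_cong)
    fix x
    have "a * exponential_density (b / a) (a * x) = exponential_density b x"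
      using assms by (simp add: exponential_density_def mult_less_0_iff)
    then show "ennreal a * ennreal (exponential_density (b / a) (a * x)) * f (a * x) = ennreal (exponential_density b x) * f (a * x)"
      using assms by (subst ennreal_mult[symmetric]) (auto simp: exponential_density_def)
  qed
  finally show ?thesis by (subst nn_integral_exponential) auto
qed

text \<open>Densities of exponential laws are positive on the same half-line, whatever the rate
  is.\<close>

lemma nn_integral_exponential_eq_0_iff:
  assumes "0 < a" "0 < b" and [measurable]: "f \<in> borel_measurable borel"
  shows "(\<integral>\<^sup>+x. f x \<partial>exponential a) = 0 \<longleftrightarrow> (\<integral>\<^sup>+x. f x \<partial>exponential b) = 0"
proof -
  have *: "exponential_density r x = 0 \<longleftrightarrow> x < 0" if "0 < r" for r x
    using that by (simp add: exponential_density_def)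
  show ?thesis
    using assms by (simp add: nn_integral_exponential nn_integral_0_iff_AE * exponential_density_nonneg)
qed

lemma AE_exponential_pos: "0 < b \<Longrightarrow> AE x in exponential b. 0 < x"
proof -
  assume b: "0 < b"
  have "AE x in lborel. x \<noteq> (0::real)" by (rule AE_lborel_singleton)
  then show ?thesis unfolding exponential_def
    by (subst AE_density) (auto simp: exponential_density_def elim!: eventually_mono split: if_splits)
qed

lemma emeasure_exponential_gt:
  assumes "0 < b" "0 \<le> x"
  shows "emeasure (exponential b) {x<..} = ennreal (exp (- b * x))"
proof -
  interpret prob_space "exponential b" by (rule prob_space_exponential) fact
  have "distributed (exponential b) lborel (\<lambda>x. x) (\<lambda>x. ennreal (exponential_density b x))"
    by (simp add: distributed_def exponential_def distr_id2)
  then have "prob {y \<in> space (exponential b). x < y} = exp (- x * b)"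
    using exponential_distributedD_gt[of "\<lambda>x. x" b x] assms by simp
  then show ?thesis by (simp add: emeasure_eq_measure greaterThan_def mult.commute)
qed

text \<open>The renewal equation of a geometric sum: summands of rate \<open>b\<close>, with
  probability \<open>1 / c\<close> of stopping after each, add up to an exponential variable of rate
  \<open>b / c\<close>. The one-step form is the one that the recursion at a root edge
  produces.\<close>

lemma exponential_geometric_sum:
  assumes b: "0 < b" and c: "1 \<le> c" and [measurable]: "f \<in> borel_measurable borel"
  shows "(\<integral>\<^sup>+x. f x \<partial>exponential (b / c)) =
    ennreal (1 / c) * (\<integral>\<^sup>+x. f x \<partial>exponential b) +
    ennreal (1 - 1 / c) * (\<integral>\<^sup>+x. \<integral>\<^sup>+y. f (x + y) \<partial>exponential (b / c) \<partial>exponential b)"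
proof -
  let ?D = "\<lambda>r x. ennreal (exponential_density r x)"
  define q where "q = 1 - 1 / c"
  have q: "0 \<le> q" "b / c = b - b * q" using c by (auto simp: q_def right_diff_distrib)
  \<comment> \<open>The rates differ by \<open>b * q\<close>, so the convolution carries a
    denominator \<open>q\<close>. The factor \<open>q\<close> in front cancels it and keeps
    \<open>c = 1\<close> within the same computation.\<close>
  have conv: "ennreal q * (\<integral>\<^sup>+x. ?D b x * ?D (b / c) (z - x) \<partial>lborel) =
    ennreal (exponential_density (b / c) z - 1 / c * exponential_density b z)" for z
  proof (cases "z < 0")
    case True
    then have "(\<integral>\<^sup>+x. ?D b x * ?D (b / c) (z - x) \<partial>lborel) = 0"
      by (intro nn_integral_zero') (auto simp: exponential_density_def)
    then show ?thesis using True by (simp add: exponential_density_def)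
  next
    case False
    let ?F = "\<lambda>x. - (b / c) * exp (- (z * (b / c))) * exp (- (b * q) * x)"
    let ?g = "\<lambda>x. q * (b * exp (- x * b) * (b / c * exp (- (z - x) * (b / c))))"
    have "ennreal q * (\<integral>\<^sup>+x. ?D b x * ?D (b / c) (z - x) \<partial>lborel) = (\<integral>\<^sup>+x. ennreal (?g x) * indicator {0..z} x \<partial>lborel)"
    proof (subst nn_integral_cmult[symmetric], measurable, intro nn_integral_cong)
      fix x
      have "ennreal q * (ennreal (b * exp (- x * b)) * ennreal (b / c * exp (- (z - x) * (b / c)))) = ennreal (?g x)"
        using b c q(1) by (subst ennreal_mult[symmetric], simp, simp)+ simp
      then show "ennreal q * (?D b x * ?D (b / c) (z - x)) = ennreal (?g x) * indicator {0..z} x"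
        by (auto simp: exponential_density_def split: split_indicator)
    qed
    also have "\<dots> = ennreal (?F z - ?F 0)"
    proof (rule nn_integral_FTC_Icc)
      fix x
      show "DERIV ?F x :> ?g x"
      proof -
        have "- x * b + - (z - x) * (b / c) = - (z * (b / c)) + - (b * q) * x"
          unfolding q(2) by (simp add: algebra_simps)
        then have e: "exp (- x * b) * exp (- (z - x) * (b / c)) = exp (- (z * (b / c))) * exp (- (b * q) * x)"
          unfolding exp_add[symmetric] by simp
        have "(?F has_real_derivative (b / c) * b * q * (exp (- (z * (b / c))) * exp (- (b * q) * x))) (at x)"
          using c by (auto intro!: derivative_eq_intros)
        moreover have "(b / c) * b * q * (exp (- (z * (b / c))) * exp (- (b * q) * x)) = ?g x"
          unfolding e[symmetric] by (simp add: mult_ac)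
        ultimately show ?thesis by (simp only:)
      qed
      show "0 \<le> ?g x" using b c q(1) by simp
    qed (use False in auto)
    also have "?F z - ?F 0 = exponential_density (b / c) z - 1 / c * exponential_density b z"
    proof -
      have "- (z * (b / c)) + - (b * q) * z = - z * b"
        unfolding q(2) by (simp add: algebra_simps)
      then have "exp (- (z * (b / c))) * exp (- (b * q) * z) = exp (- z * b)"
        unfolding exp_add[symmetric] by simp
      then show ?thesis
        using False by (simp add: exponential_density_def mult.assoc)
    qed
    finally show ?thesis .
  qed
  have pos: "0 \<le> exponential_density (b / c) z - 1 / c * exponential_density b z" for z
  proof (cases "z < 0")
    case False
    then have "z * (b / c) \<le> z * b"
      using b c by (intro mult_left_mono) (auto simp: divide_simps)
    then have "b / c * exp (- z * b) \<le> b / c * exp (- z * (b / c))"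
      using b c by (intro mult_left_mono) auto
    then show ?thesis using False by (simp add: exponential_density_def)
  qed (simp add: exponential_density_def)
  have "ennreal q * (\<integral>\<^sup>+x. \<integral>\<^sup>+y. f (x + y) \<partial>exponential (b / c) \<partial>exponential b) =
      ennreal q * (\<integral>\<^sup>+x. \<integral>\<^sup>+z. ?D b x * (?D (b / c) (z - x) * f z) \<partial>lborel \<partial>lborel)"
  proof -
    have "(\<integral>\<^sup>+y. f (x + y) \<partial>exponential (b / c)) = (\<integral>\<^sup>+z. ?D (b / c) (z - x) * f z \<partial>lborel)" for x
      by (subst nn_integral_real_affine[where c = 1 and t = x and f = "\<lambda>z. ?D (b / c) (z - x) * f z"])
        (auto simp: nn_integral_exponential)
    then show ?thesis by (simp add: nn_integral_exponential nn_integral_cmult)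
  qed
  also have "\<dots> = ennreal q * (\<integral>\<^sup>+z. \<integral>\<^sup>+x. ?D b x * (?D (b / c) (z - x) * f z) \<partial>lborel \<partial>lborel)"
    by (subst lborel_pair.Fubini') auto
  also have "\<dots> = (\<integral>\<^sup>+z. (ennreal q * (\<integral>\<^sup>+x. ?D b x * ?D (b / c) (z - x) \<partial>lborel)) * f z \<partial>lborel)"
    by (subst nn_integral_cmult[symmetric]) (auto simp: nn_integral_multc mult.assoc[symmetric])
  also have "\<dots> = (\<integral>\<^sup>+z. ennreal (exponential_density (b / c) z - 1 / c * exponential_density b z) * f z \<partial>lborel)"
    unfolding conv ..
  finally have "ennreal (1 / c) * (\<integral>\<^sup>+x. f x \<partial>exponential b) + ennreal q * (\<integral>\<^sup>+x. \<integral>\<^sup>+y. f (x + y) \<partial>exponential (b / c) \<partial>exponential b) =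
     (\<integral>\<^sup>+z. ennreal (1 / c) * (?D b z * f z) \<partial>lborel) + (\<integral>\<^sup>+z. ennreal (exponential_density (b / c) z - 1 / c * exponential_density b z) * f z \<partial>lborel)"
    by (simp add: nn_integral_exponential nn_integral_cmult)
  also have "\<dots> = (\<integral>\<^sup>+z. ?D (b / c) z * f z \<partial>lborel)"
  proof (subst nn_integral_add[symmetric], goal_cases)
    case 3
    have "ennreal (1 / c) * (?D b z * f z) + ennreal (exponential_density (b / c) z - 1 / c * exponential_density b z) * f z = ?D (b / c) z * f z" for z
    proof -
      have e: "ennreal (1 / c) * ?D b z + ennreal (exponential_density (b / c) z - 1 / c * exponential_density b z) = ?D (b / c) z"
      proof -
        have D: "0 \<le> exponential_density b z" using b by (rule exponential_density_nonneg)
        then have "ennreal (1 / c) * ?D b z = ennreal (1 / c * exponential_density b z)"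
          using c by (intro ennreal_mult[symmetric]) auto
        also have "\<dots> + ennreal (exponential_density (b / c) z - 1 / c * exponential_density b z) = ?D (b / c) z"
          using c D pos[of z] by (subst ennreal_plus[symmetric]) auto
        finally show ?thesis .
      qed
      show ?thesis unfolding e[symmetric] by (simp only: distrib_right mult.assoc)
    qed
    then show ?case by simp
  qed auto
  finally show ?thesis by (simp add: nn_integral_exponential q_def)
qed

section \<open>Independent exponential lengths on the edges of a planar shape\<close>

primrec edge_law :: "real \<Rightarrow> unit tree \<Rightarrow> real tree measure" where
  "edge_law b Leaf = return (tree_sigma borel) Leaf"
| "edge_law b (Node l u r) =
    distr (exponential b \<Otimes>\<^sub>M (edge_law b l \<Otimes>\<^sub>M edge_law b r)) (tree_sigma borel) (\<lambda>(x, L, R). Node L x R)"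

declare edge_law.simps [simp del]

lemma sets_edge_law [measurable_cong, simp]: "sets (edge_law b s) = sets (tree_sigma borel)"
  by (cases s) (auto simp: edge_law.simps)

lemma space_tree_sigma_borel [simp]: "space (tree_sigma borel) = (UNIV :: real tree set)"
  by (simp add: space_tree_sigma)

lemma space_edge_law [simp]: "space (edge_law b s) = UNIV"
  using sets_eq_imp_space_eq[OF sets_edge_law] by simp

lemma prob_space_edge_law: "0 < b \<Longrightarrow> prob_space (edge_law b s)"
proof (induction s)
  case (Node l u r)
  then interpret exp: prob_space "exponential b" by (simp add: prob_space_exponential)
  interpret l: prob_space "edge_law b l" by (rule Node)+
  interpret r: prob_space "edge_law b r" by (rule Node)+
  interpret lr: pair_prob_space "edge_law b l" "edge_law b r" ..
  interpret elr: pair_prob_space "exponential b" "edge_law b l \<Otimes>\<^sub>M edge_law b r" ..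
  show ?case unfolding edge_law.simps by (rule elr.prob_space_distr) measurable
qed (auto simp: edge_law.simps intro!: prob_space_return)

lemma nn_integral_edge_law_Leaf [simp]:
  "f \<in> borel_measurable (tree_sigma borel) \<Longrightarrow> (\<integral>\<^sup>+t. f t \<partial>edge_law b Leaf) = f Leaf"
  by (simp add: edge_law.simps nn_integral_return)

lemma nn_integral_edge_law_Node:
  assumes "0 < b" and [measurable]: "f \<in> borel_measurable (tree_sigma borel)"
  shows "(\<integral>\<^sup>+t. f t \<partial>edge_law b (Node l u r)) =
    (\<integral>\<^sup>+x. \<integral>\<^sup>+L. \<integral>\<^sup>+R. f (Node L x R) \<partial>edge_law b r \<partial>edge_law b l \<partial>exponential b)"
proof -
  interpret l: prob_space "edge_law b l" by (rule prob_space_edge_law) fact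
  interpret r: prob_space "edge_law b r" by (rule prob_space_edge_law) fact
  interpret lr: pair_prob_space "edge_law b l" "edge_law b r" ..
  show ?thesis unfolding edge_law.simps
    by (subst nn_integral_distr, measurable)
      (simp add: lr.nn_integral_fst[symmetric] r.nn_integral_fst[symmetric] split_def)
qed


lemma nn_integral_edge_law_swap:
  assumes "0 < b" and f [measurable]: "(\<lambda>(L, R). f L R) \<in> borel_measurable (tree_sigma borel \<Otimes>\<^sub>M tree_sigma borel)"
  shows "(\<integral>\<^sup>+L. \<integral>\<^sup>+R. f L R \<partial>edge_law b r \<partial>edge_law b l) = (\<integral>\<^sup>+R. \<integral>\<^sup>+L. f L R \<partial>edge_law b l \<partial>edge_law b r)"
proof -
  interpret l: prob_space "edge_law b l" by (rule prob_space_edge_law) fact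
  interpret r: prob_space "edge_law b r" by (rule prob_space_edge_law) fact
  interpret lr: pair_prob_space "edge_law b l" "edge_law b r" ..
  have "(\<lambda>(L, R). f L R) \<in> borel_measurable (edge_law b l \<Otimes>\<^sub>M edge_law b r)"
    using f by (simp cong: measurable_cong_sets)
  from lr.Fubini'[OF this] show ?thesis ..
qed

lemma sigma_finite_edge_law: "0 < b \<Longrightarrow> sigma_finite_measure (edge_law b s)"
  by (intro prob_space_imp_sigma_finite prob_space_edge_law)

lemma borel_measurable_edge_law_integral [measurable (raw)]:
  assumes "0 < b" and "(\<lambda>(x, t). f x t) \<in> borel_measurable (M \<Otimes>\<^sub>M tree_sigma borel)"
  shows "(\<lambda>x. \<integral>\<^sup>+t. f x t \<partial>edge_law b s) \<in> borel_measurable M"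
proof -
  interpret sigma_finite_measure "edge_law b s" by (rule sigma_finite_edge_law) fact
  have "(\<lambda>(x, t). f x t) \<in> borel_measurable (M \<Otimes>\<^sub>M edge_law b s)"
    using assms(2) by (simp cong: measurable_cong_sets)
  from borel_measurable_nn_integral[OF this] show ?thesis .
qed

lemma same_up_to_swaps_Node:
  "same_up_to_swaps L L' \<Longrightarrow> same_up_to_swaps (Node L x R) (Node L' x R)"
  "same_up_to_swaps R R' \<Longrightarrow> same_up_to_swaps (Node L x R) (Node L x R')"
  "same_up_to_swaps (Node L x R) (Node R x L)"
  by (auto intro: same_up_to_swaps.intros same_up_to_swaps_refl)

text \<open>The marks are independent with one common law, so exchanging siblings in the shape
  merely exchanges them in the random tree. This makes the law given an unembedded shape independent
  of the planar representative.\<close>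

lemma nn_integral_edge_law_cong_swaps:
  assumes "same_up_to_swaps s s'" "0 < b" "f \<in> borel_measurable (tree_sigma borel)"
    and "\<And>t t'. same_up_to_swaps t t' \<Longrightarrow> f t = f t'"
  shows "(\<integral>\<^sup>+t. f t \<partial>edge_law b s) = (\<integral>\<^sup>+t. f t \<partial>edge_law b s')"
  using assms(1,3,4)
proof (induction arbitrary: f rule: same_up_to_swaps.induct)
  case (straight l l' r r' u)
  note [measurable] = straight.prems(1) and [measurable del] = borel_measurable_edge_law_integral
  note [measurable (raw)] = borel_measurable_edge_law_integral[OF assms(2)]
  have "(\<integral>\<^sup>+L. \<integral>\<^sup>+R. f (Node L x R) \<partial>edge_law b r \<partial>edge_law b l) =
    (\<integral>\<^sup>+L. \<integral>\<^sup>+R. f (Node L x R) \<partial>edge_law b r' \<partial>edge_law b l')" for x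
  proof -
    have "(\<integral>\<^sup>+R. f (Node L x R) \<partial>edge_law b r) = (\<integral>\<^sup>+R. f (Node L x R) \<partial>edge_law b r')" for L
      by (rule straight.IH(2), measurable)
        (rule straight.prems(2), rule same_up_to_swaps_Node)
    moreover have "(\<integral>\<^sup>+L. \<integral>\<^sup>+R. f (Node L x R) \<partial>edge_law b r' \<partial>edge_law b l) =
        (\<integral>\<^sup>+L. \<integral>\<^sup>+R. f (Node L x R) \<partial>edge_law b r' \<partial>edge_law b l')"
      by (rule straight.IH(1), measurable)
        (intro nn_integral_cong straight.prems(2) same_up_to_swaps_Node)
    ultimately show ?thesis by simp
  qed
  then show ?case using assms(2) straight.prems(1) by (simp add: nn_integral_edge_law_Node)
next
  case (crossed l r' r l' u)
  note [measurable] = crossed.prems(1)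
  note [measurable (raw)] = borel_measurable_edge_law_integral[OF assms(2)]
  have "(\<integral>\<^sup>+L. \<integral>\<^sup>+R. f (Node L x R) \<partial>edge_law b r \<partial>edge_law b l) =
    (\<integral>\<^sup>+R. \<integral>\<^sup>+L. f (Node R x L) \<partial>edge_law b r' \<partial>edge_law b l')" for x
  proof -
    have "(\<integral>\<^sup>+R. f (Node L x R) \<partial>edge_law b r) = (\<integral>\<^sup>+R. f (Node L x R) \<partial>edge_law b l')" for L
      by (rule crossed.IH(2), measurable)
        (rule crossed.prems(2), rule same_up_to_swaps_Node)
    moreover have "(\<integral>\<^sup>+L. \<integral>\<^sup>+R. f (Node L x R) \<partial>edge_law b l' \<partial>edge_law b l) =
        (\<integral>\<^sup>+L. \<integral>\<^sup>+R. f (Node L x R) \<partial>edge_law b l' \<partial>edge_law b r')"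
      by (rule crossed.IH(1), measurable)
        (intro nn_integral_cong crossed.prems(2) same_up_to_swaps_Node)
    moreover have "\<dots> = (\<integral>\<^sup>+R. \<integral>\<^sup>+L. f (Node L x R) \<partial>edge_law b r' \<partial>edge_law b l')"
      by (rule nn_integral_edge_law_swap[OF assms(2)]) measurable
    moreover have "f (Node L x R) = f (Node R x L)" for L R
      by (intro crossed.prems(2) same_up_to_swaps_Node)
    ultimately show ?thesis by simp
  qed
  then show ?case using assms(2) crossed.prems(1) by (simp add: nn_integral_edge_law_Node)
qed simp

text \<open>The equivalence of exponential laws with different rates, carried through the iterated
  integral one edge at a time.\<close>

lemma nn_integral_edge_law_eq_0_iff:
  assumes "0 < a" "0 < b" "f \<in> borel_measurable (tree_sigma borel)"
  shows "(\<integral>\<^sup>+t. f t \<partial>edge_law a s) = 0 \<longleftrightarrow> (\<integral>\<^sup>+t. f t \<partial>edge_law b s) = 0"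
  using assms(3)
proof (induction s arbitrary: f)
  case (Node l u r)
  note [measurable] = Node.prems
  note [measurable (raw)] = borel_measurable_edge_law_integral[OF assms(1)] borel_measurable_edge_law_integral[OF assms(2)]
  have r: "(\<integral>\<^sup>+R. f (Node L x R) \<partial>edge_law a r) = 0 \<longleftrightarrow> (\<integral>\<^sup>+R. f (Node L x R) \<partial>edge_law b r) = 0" for L x
    by (rule Node.IH) measurable
  have l: "(\<integral>\<^sup>+L. \<integral>\<^sup>+R. f (Node L x R) \<partial>edge_law a r \<partial>edge_law a l) = 0 \<longleftrightarrow>
     (\<integral>\<^sup>+L. \<integral>\<^sup>+R. f (Node L x R) \<partial>edge_law b r \<partial>edge_law b l) = 0" for x
  proof -
    have "(\<integral>\<^sup>+L. \<integral>\<^sup>+R. f (Node L x R) \<partial>edge_law a r \<partial>edge_law a l) = 0 \<longleftrightarrow>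
        (\<integral>\<^sup>+L. \<integral>\<^sup>+R. f (Node L x R) \<partial>edge_law b r \<partial>edge_law a l) = 0"
      by (simp add: nn_integral_0_iff_AE r)
    also have "\<dots> \<longleftrightarrow> (\<integral>\<^sup>+L. \<integral>\<^sup>+R. f (Node L x R) \<partial>edge_law b r \<partial>edge_law b l) = 0"
      by (rule Node.IH) measurable
    finally show ?thesis .
  qed
  have "(\<integral>\<^sup>+x. \<integral>\<^sup>+L. \<integral>\<^sup>+R. f (Node L x R) \<partial>edge_law a r \<partial>edge_law a l \<partial>exponential a) = 0 \<longleftrightarrow>
      (\<integral>\<^sup>+x. \<integral>\<^sup>+L. \<integral>\<^sup>+R. f (Node L x R) \<partial>edge_law b r \<partial>edge_law b l \<partial>exponential a) = 0"
    by (simp add: nn_integral_0_iff_AE l)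
  also have "\<dots> \<longleftrightarrow> (\<integral>\<^sup>+x. \<integral>\<^sup>+L. \<integral>\<^sup>+R. f (Node L x R) \<partial>edge_law b r \<partial>edge_law b l \<partial>exponential b) = 0"
    by (rule nn_integral_exponential_eq_0_iff[OF assms(1,2)]) measurable
  finally show ?case using assms Node.prems by (simp add: nn_integral_edge_law_Node)
qed simp

lemma measurable_map_tree [measurable]:
  fixes h :: "real \<Rightarrow> real"
  assumes [measurable]: "h \<in> borel \<rightarrow>\<^sub>M borel"
  shows "map_tree h \<in> tree_sigma borel \<rightarrow>\<^sub>M (tree_sigma borel :: real tree measure)"
proof -
  have "map_tree h = rec_tree Leaf (\<lambda>l (x::real) r l' r'. Node l' (h x) r')"
    by (rule ext) (induct_tac x, auto)
  also have "\<dots> \<in> tree_sigma borel \<rightarrow>\<^sub>M tree_sigma borel"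
    by (rule measurable_rec_tree) measurable
  finally show ?thesis .
qed

lemma nn_integral_edge_law_scale:
  assumes "0 < a" "0 < b" "f \<in> borel_measurable (tree_sigma borel)"
  shows "(\<integral>\<^sup>+t. f (map_tree (\<lambda>x. a * x) t) \<partial>edge_law b s) = (\<integral>\<^sup>+t. f t \<partial>edge_law (b / a) s)"
  using assms(3)
proof (induction s arbitrary: f)
  case (Node l u r)
  note [measurable] = Node.prems
  have ba: "0 < b / a" using assms by simp
  note [measurable (raw)] = borel_measurable_edge_law_integral[OF assms(2)] borel_measurable_edge_law_integral[OF ba]
  let ?m = "map_tree (\<lambda>x. a * x)"
  have "(\<integral>\<^sup>+t. f (?m t) \<partial>edge_law b (Node l u r)) =
     (\<integral>\<^sup>+x. \<integral>\<^sup>+L. \<integral>\<^sup>+R. f (Node (?m L) (a * x) (?m R)) \<partial>edge_law b r \<partial>edge_law b l \<partial>exponential b)"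
    using assms by (subst nn_integral_edge_law_Node) simp_all
  also have "\<dots> = (\<integral>\<^sup>+x. \<integral>\<^sup>+L. \<integral>\<^sup>+R. f (Node (?m L) (a * x) R) \<partial>edge_law (b / a) r \<partial>edge_law b l \<partial>exponential b)"
    by (intro nn_integral_cong Node.IH) measurable
  also have "\<dots> = (\<integral>\<^sup>+x. \<integral>\<^sup>+L. \<integral>\<^sup>+R. f (Node L (a * x) R) \<partial>edge_law (b / a) r \<partial>edge_law (b / a) l \<partial>exponential b)"
    by (intro nn_integral_cong Node.IH) measurable
  also have "\<dots> = (\<integral>\<^sup>+x. \<integral>\<^sup>+L. \<integral>\<^sup>+R. f (Node L x R) \<partial>edge_law (b / a) r \<partial>edge_law (b / a) l \<partial>exponential (b / a))"
    using assms by (intro nn_integral_exponential_scale) measurable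
  also have "\<dots> = (\<integral>\<^sup>+t. f t \<partial>edge_law (b / a) (Node l u r))"
    using ba by (subst nn_integral_edge_law_Node) simp_all
  finally show ?case .
qed simp

abbreviation skeleton :: "'a tree \<Rightarrow> unit tree" where
  "skeleton \<equiv> map_tree (\<lambda>_. ())"

lemma measurable_skeleton [measurable]: "skeleton \<in> (tree_sigma borel :: real tree measure) \<rightarrow>\<^sub>M count_space UNIV"
proof -
  have "skeleton = rec_tree Leaf (\<lambda>l (x::real) r l' r'. Node l' () r')"
    by (rule ext) (induct_tac x, auto)
  also have "\<dots> \<in> tree_sigma borel \<rightarrow>\<^sub>M count_space UNIV"
  proof (rule measurable_rec_tree)
    let ?M = "tree_sigma borel \<Otimes>\<^sub>M tree_sigma borel \<Otimes>\<^sub>M (borel :: real measure) \<Otimes>\<^sub>M tree_sigma borel \<Otimes>\<^sub>M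
      (count_space UNIV :: unit tree measure) \<Otimes>\<^sub>M (count_space UNIV :: unit tree measure)"
    have "(\<lambda>p. case snd (snd (snd (snd p))) of (al, ar) \<Rightarrow> Node al () ar) \<in> ?M \<rightarrow>\<^sub>M (count_space UNIV :: unit tree measure)"
      by (rule measurable_compose[where N = "count_space UNIV"]) (simp_all add: pair_measure_countable[symmetric])
    then show "(\<lambda>(x, l, v, r, al, ar). Node al () ar) \<in> ?M \<rightarrow>\<^sub>M (count_space UNIV :: unit tree measure)"
      by (simp add: split_def)
  qed simp_all
  finally show ?thesis .
qed

definition positive_tree :: "real tree \<Rightarrow> bool" where
  "positive_tree t \<longleftrightarrow> (\<forall>x\<in>set_tree t. 0 < x)"

lemma positive_tree_simps [simp]:
  "positive_tree Leaf" "positive_tree (Node l x r) \<longleftrightarrow> 0 < x \<and> positive_tree l \<and> positive_tree r"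
  by (auto simp: positive_tree_def)

lemma measurable_positive_tree [measurable]: "Measurable.pred (tree_sigma borel) positive_tree"
proof -
  have "positive_tree = rec_tree True (\<lambda>l (x::real) r l' r'. 0 < x \<and> l' \<and> r')"
    by (rule ext) (induct_tac x, auto)
  also have "Measurable.pred (tree_sigma borel) \<dots>"
    by (rule measurable_rec_tree) measurable
  finally show ?thesis .
qed

lemma AE_edge_law: 
  assumes "0 < b"
  shows "AE t in edge_law b s. skeleton t = s \<and> positive_tree t"
proof (induction s)
  case (Node l u r)
  have "(\<integral>\<^sup>+t. indicator {t. \<not> (skeleton t = Node l u r \<and> positive_tree t)} t \<partial>edge_law b (Node l u r)) =
     (\<integral>\<^sup>+x. \<integral>\<^sup>+L. \<integral>\<^sup>+R. indicator {t. \<not> (skeleton t = Node l u r \<and> positive_tree t)} (Node L x R) \<partial>edge_law b r \<partial>edge_law b l \<partial>exponential b)"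
    using assms by (intro nn_integral_edge_law_Node) auto
  also have "\<dots> = (\<integral>\<^sup>+x. 0 \<partial>exponential b)"
  proof (rule nn_integral_cong_AE, use AE_exponential_pos[OF assms] in eventually_elim)
    fix x :: real assume x: "0 < x"
    have "(\<integral>\<^sup>+L. \<integral>\<^sup>+R. indicator {t. \<not> (skeleton t = Node l u r \<and> positive_tree t)} (Node L x R) \<partial>edge_law b r \<partial>edge_law b l) = (\<integral>\<^sup>+L. 0 \<partial>edge_law b l)"
    proof (rule nn_integral_cong_AE, use Node(1) in eventually_elim)
      fix L :: "real tree" assume L: "skeleton L = l \<and> positive_tree L"
      have "(\<integral>\<^sup>+R. indicator {t. \<not> (skeleton t = Node l u r \<and> positive_tree t)} (Node L x R) \<partial>edge_law b r) = (\<integral>\<^sup>+R. 0 \<partial>edge_law b r)"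
        by (rule nn_integral_cong_AE, use Node(2) in eventually_elim) (use x L in auto)
      then show "(\<integral>\<^sup>+R. indicator {t. \<not> (skeleton t = Node l u r \<and> positive_tree t)} (Node L x R) \<partial>edge_law b r) = 0" by simp
    qed
    then show "(\<integral>\<^sup>+L. \<integral>\<^sup>+R. indicator {t. \<not> (skeleton t = Node l u r \<and> positive_tree t)} (Node L x R) \<partial>edge_law b r \<partial>edge_law b l) = 0"
      by simp
  qed
  finally have "(\<integral>\<^sup>+t. indicator {t. \<not> (skeleton t = Node l u r \<and> positive_tree t)} t \<partial>edge_law b (Node l u r)) = 0"
    by simp
  moreover have "indicator {t. \<not> (skeleton t = Node l u r \<and> positive_tree t)} \<in> borel_measurable (edge_law b (Node l u r))"
    by measurable
  ultimately have "AE t in edge_law b (Node l u r). indicator {t. \<not> (skeleton t = Node l u r \<and> positive_tree t)} t = (0 :: ennreal)"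
    using nn_integral_0_iff_AE by blast
  then show ?case by (rule eventually_mono) (auto simp: indicator_def split: if_splits)
next
  case Leaf
  have "Measurable.pred (tree_sigma borel) (\<lambda>t::real tree. skeleton t = Leaf \<and> positive_tree t)"
    by measurable
  then show ?case unfolding edge_law.simps by (subst AE_return) auto
qed

section \<open>Weights of planar shapes\<close>

text \<open>The probability that an edge ends with subtrees of orders \<open>a\<close> on the left
  and \<open>b\<close> on the right. Equal orders mean that a branch of order \<open>a + 1\<close>
  terminates, otherwise a branch of order \<open>a\<close> has produced one of order
  \<open>b\<close>. Offspring always hang on the right, so b > a gets weight 0; so does b = 0 < a,
  which leaves only reduced trees.\<close>

definition split_weight :: "real \<Rightarrow> nat \<Rightarrow> nat \<Rightarrow> real" where
  "split_weight c a b = (if a = b then 1 / c ^ a else if 1 \<le> b \<and> b < a then (c - 1) / c ^ b else 0)"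

primrec tree_weight :: "real \<Rightarrow> unit tree \<Rightarrow> ennreal" where
  "tree_weight c Leaf = 1"
| "tree_weight c (Node l u r) = ennreal (split_weight c (strahler l) (strahler r)) * (tree_weight c l * tree_weight c r)"

lemma tree_weight_reduced: "tree_weight c s \<noteq> 0 \<Longrightarrow> reduced s"
  by (induction s) (auto simp: split_weight_def split: if_splits)

text \<open>The expectation of \<open>f\<close> at the planar shape of a tree grown from a branch of
  order \<open>K\<close>, written as a sum so that it makes sense before the weights are known to
  add up to 1.\<close>

definition order_sum :: "real \<Rightarrow> nat \<Rightarrow> (unit tree \<Rightarrow> ennreal) \<Rightarrow> ennreal" where
  "order_sum c K f = (\<integral>\<^sup>+s. (if strahler s = K then tree_weight c s * f s else 0) \<partial>count_space UNIV)"

lemma order_sum_mono: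
  "(\<And>s. strahler s = K \<Longrightarrow> tree_weight c s \<noteq> 0 \<Longrightarrow> f s \<le> g s) \<Longrightarrow> order_sum c K f \<le> order_sum c K g"
  unfolding order_sum_def
  by (intro nn_integral_mono) (metis (full_types) eq_refl mult_left_mono mult_zero_left zero_le)

lemma order_sum_cong:
  "(\<And>s. strahler s = K \<Longrightarrow> tree_weight c s \<noteq> 0 \<Longrightarrow> f s = g s) \<Longrightarrow> order_sum c K f = order_sum c K g"
  by (intro antisym order_sum_mono) auto

lemma order_sum_cmult: "order_sum c K (\<lambda>s. a * f s) = a * order_sum c K f"
  unfolding order_sum_def by (subst nn_integral_cmult[symmetric]) (auto intro!: nn_integral_cong simp: mult_ac)

lemma order_sum_multc: "order_sum c K (\<lambda>s. f s * a) = order_sum c K f * a"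
  using order_sum_cmult[of c K a f] by (simp add: mult.commute)

lemma order_sum_add: "order_sum c K (\<lambda>s. f s + g s) = order_sum c K f + order_sum c K g"
  unfolding order_sum_def by (subst nn_integral_add[symmetric]) (auto intro!: nn_integral_cong simp: distrib_left)

lemma order_sum_0: "order_sum c 0 f = f Leaf"
proof -
  have "order_sum c 0 f = (\<integral>\<^sup>+s. f s * indicator {Leaf} s \<partial>count_space UNIV)"
    unfolding order_sum_def by (intro nn_integral_cong) auto
  then show ?thesis by (simp add: one_ennreal_def[symmetric])
qed

lemma nn_integral_tree_swap:
  assumes "sigma_finite_measure M" "\<And>s. f s \<in> borel_measurable M"
  shows "(\<integral>\<^sup>+s. \<integral>\<^sup>+x. f s x \<partial>M \<partial>count_space (UNIV :: 'a :: countable set)) = (\<integral>\<^sup>+x. \<integral>\<^sup>+s. f s x \<partial>count_space UNIV \<partial>M)"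
proof -
  interpret M: sigma_finite_measure M by fact
  interpret N: sigma_finite_measure "count_space (UNIV :: 'a set)"
    by (rule sigma_finite_measure_count_space_countable) simp
  interpret pair_sigma_finite "count_space (UNIV :: 'a set)" M ..
  have "(\<lambda>(s, x). f s x) \<in> borel_measurable (count_space UNIV \<Otimes>\<^sub>M M)"
    by (rule measurable_pair_measure_countable1) (use assms(2) in auto)
  from Fubini'[OF this] show ?thesis by simp
qed

lemma order_sum_nn_integral:
  assumes "sigma_finite_measure M" "\<And>s. f s \<in> borel_measurable M"
  shows "order_sum c K (\<lambda>s. \<integral>\<^sup>+x. f s x \<partial>M) = (\<integral>\<^sup>+x. order_sum c K (\<lambda>s. f s x) \<partial>M)"
proof -
  have "order_sum c K (\<lambda>s. \<integral>\<^sup>+x. f s x \<partial>M) = (\<integral>\<^sup>+s. \<integral>\<^sup>+x. (if strahler s = K then tree_weight c s * f s x else 0) \<partial>M \<partial>count_space UNIV)"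
    unfolding order_sum_def using assms(2) by (intro nn_integral_cong) (auto simp: nn_integral_cmult)
  also have "\<dots> = (\<integral>\<^sup>+x. order_sum c K (\<lambda>s. f s x) \<partial>M)"
    unfolding order_sum_def by (intro nn_integral_tree_swap assms(1)) (use assms(2) in auto)
  finally show ?thesis .
qed

text \<open>Monotone convergence. The number of edges decreases from a tree to its subtrees, which
  the order need not do, so bounds are proved by induction on this truncation.\<close>

lemma order_sum_le_by_size:
  assumes "\<And>n. order_sum c K (\<lambda>s. if size s < n then f s else 0) \<le> C"
  shows "order_sum c K f \<le> C"
proof -
  let ?g = "\<lambda>n s. if strahler s = K then tree_weight c s * (if size s < n then f s else 0) else 0"
  have "order_sum c K f = (\<integral>\<^sup>+s. (SUP n. ?g n s) \<partial>count_space UNIV)"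
    unfolding order_sum_def
  proof (intro nn_integral_cong antisym)
    fix s :: "unit tree"
    show "(if strahler s = K then tree_weight c s * f s else 0) \<le> (SUP n. ?g n s)"
      by (rule SUP_upper2[of "Suc (size s)"]) auto
  qed (auto intro!: SUP_least)
  also have "\<dots> = (SUP n. \<integral>\<^sup>+s. ?g n s \<partial>count_space UNIV)"
    by (intro nn_integral_monotone_convergence_SUP) (auto simp: incseq_def le_fun_def)
  also have "\<dots> \<le> C"
    using assms unfolding order_sum_def by (intro SUP_least)
  finally show ?thesis .
qed


text \<open>The two summands are termination and side branching at the end of the root edge. After a
  side branching \<open>K\<close> occurs again on the right-hand side, so this is an equation and
  not a definition by recursion.\<close>

lemma order_sum_rec:
  assumes "1 \<le> K"
  shows "order_sum c K f =
    ennreal (1 / c ^ (K - 1)) * order_sum c (K - 1) (\<lambda>l. order_sum c (K - 1) (\<lambda>r. f (Node l () r))) +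
    (\<Sum>i\<in>{1..<K}. ennreal ((c - 1) / c ^ i) * order_sum c K (\<lambda>l. order_sum c i (\<lambda>r. f (Node l () r))))"
proof -
  let ?w = "tree_weight c"
  define g where "g i l = order_sum c i (\<lambda>r. f (Node l () r))" for i l
  let ?t = "\<lambda>j i l r. if strahler l = j then ?w l * (if strahler r = i then ?w r * f (Node l () r) else 0) else 0"
  have pt: "(if strahler (Node l () r) = K then ?w (Node l () r) * f (Node l () r) else 0) =
      ennreal (1 / c ^ (K - 1)) * ?t (K - 1) (K - 1) l r +
      (\<Sum>i\<in>{1..<K}. ennreal ((c - 1) / c ^ i) * ?t K i l r)" for l r
  proof -
    let ?a = "strahler l" and ?b = "strahler r"
    let ?x = "?w l * (?w r * f (Node l () r))"
    have "(\<Sum>i\<in>{1..<K}. ennreal ((c - 1) / c ^ i) * ?t K i l r) =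
        (\<Sum>i\<in>{1..<K}. if i = ?b then (if ?a = K then ennreal ((c - 1) / c ^ i) * ?x else 0) else 0)"
      by (intro sum.cong) auto
    also have "\<dots> = (if ?b \<in> {1..<K} \<and> ?a = K then ennreal ((c - 1) / c ^ ?b) * ?x else 0)"
      by (simp add: sum.delta')
    finally show ?thesis
      using assms by (auto simp: split_weight_def mult_ac max_def)
  qed
  have t: "(\<integral>\<^sup>+l. \<integral>\<^sup>+r. ?t j i l r \<partial>count_space UNIV \<partial>count_space UNIV) = order_sum c j (g i)" for j i
  proof -
    have "(\<integral>\<^sup>+r. ?t j i l r \<partial>count_space UNIV) = (if strahler l = j then ?w l * g i l else 0)" for l
      by (simp add: g_def order_sum_def nn_integral_cmult)
    then show ?thesis by (simp add: order_sum_def)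
  qed
  have "order_sum c K f = (\<integral>\<^sup>+l. \<integral>\<^sup>+r. ennreal (1 / c ^ (K - 1)) * ?t (K - 1) (K - 1) l r +
      (\<Sum>i\<in>{1..<K}. ennreal ((c - 1) / c ^ i) * ?t K i l r) \<partial>count_space UNIV \<partial>count_space UNIV)"
    unfolding order_sum_def pt[symmetric] using assms by (subst nn_integral_count_space_tree) simp
  also have "\<dots> = ennreal (1 / c ^ (K - 1)) * order_sum c (K - 1) (g (K - 1)) +
      (\<Sum>i\<in>{1..<K}. ennreal ((c - 1) / c ^ i) * order_sum c K (g i))"
    by (simp only: nn_integral_add nn_integral_cmult nn_integral_sum t borel_measurable_count_space)
  finally show ?thesis unfolding g_def .
qed

text \<open>Telescoping, as (c - 1) / c^i = 1 / c^(i-1) - 1 / c^i. The summands are the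
  probabilities of all events that can end an edge of order \<open>K\<close>.\<close>

lemma split_weights_sum_real:
  assumes "1 \<le> (c :: real)" "1 \<le> K"
  shows "1 / c ^ (K - 1) + (\<Sum>i\<in>{1..<K}. (c - 1) / c ^ i) = 1"
  using assms(2)
proof (induction K rule: dec_induct)
  case (step K)
  then show ?case using assms(1) by (cases K) (auto simp: field_simps)
qed simp

lemma split_weights_sum:
  assumes "1 \<le> c" "1 \<le> K"
  shows "ennreal (1 / c ^ (K - 1)) + (\<Sum>i\<in>{1..<K}. ennreal ((c - 1) / c ^ i)) = 1"
  using split_weights_sum_real[OF assms] assms(1) by (simp add: sum_nonneg flip: ennreal_plus)

text \<open>Both subtrees of a tree with at most \<open>n\<close> edges have fewer than
  \<open>n\<close>, so the truncated mass is at most a convex combination of products of truncated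
  masses for the preceding size.\<close>

lemma order_sum_le_1:
  assumes c: "1 \<le> c"
  shows "order_sum c K (\<lambda>_. 1) \<le> 1"
proof (rule order_sum_le_by_size)
  fix n
  show "order_sum c K (\<lambda>s. if size s < n then 1 else 0) \<le> 1"
  proof (induction n arbitrary: K)
    case 0
    show ?case by (simp add: order_sum_def cong: if_cong)
  next
    case (Suc n)
    let ?h = "\<lambda>s::unit tree. if size s < n then 1 else 0 :: ennreal"
    have *: "order_sum c j (\<lambda>l. order_sum c i (\<lambda>r. if size (Node l () r) < Suc n then 1 else 0)) \<le> 1" for j i
    proof -
      have "order_sum c j (\<lambda>l. order_sum c i (\<lambda>r. if size (Node l () r) < Suc n then 1 else 0)) \<le>
          order_sum c j (\<lambda>l. order_sum c i (\<lambda>r. ?h l * ?h r))"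
        by (intro order_sum_mono) auto
      also have "\<dots> = order_sum c j ?h * order_sum c i ?h"
        by (simp add: order_sum_cmult order_sum_multc)
      also have "\<dots> \<le> 1 * 1" by (intro mult_mono Suc.IH) auto
      finally show ?thesis by simp
    qed
    show ?case
    proof (cases "K = 0")
      case False
      then have K: "1 \<le> K" by simp
      have "order_sum c K (\<lambda>s. if size s < Suc n then 1 else 0) \<le>
        ennreal (1 / c ^ (K - 1)) * 1 + (\<Sum>i\<in>{1..<K}. ennreal ((c - 1) / c ^ i) * 1)"
        by (subst order_sum_rec[OF K]) (intro add_mono sum_mono mult_left_mono *, auto)
      then show ?thesis using split_weights_sum[OF c K] by simp
    qed (simp add: order_sum_0)
  qed
qed

text \<open>The mass a satisfies a = q + (1 - q) a with q > 0. The upper bound rules out the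
  solution a = \<infinity>, so a = 1.\<close>

lemma order_sum_1:
  assumes c: "1 \<le> c"
  shows "order_sum c K (\<lambda>_. 1) = 1"
proof (induction K rule: less_induct)
  case (less K)
  show ?case
  proof (cases "K = 0")
    case False
    then have K: "1 \<le> K" by simp
    let ?a = "order_sum c K (\<lambda>_. 1)"
    define q p where "q = ennreal (1 / c ^ (K - 1))" and "p = (\<Sum>i\<in>{1..<K}. ennreal ((c - 1) / c ^ i))"
    have "?a = q * order_sum c (K - 1) (\<lambda>_. order_sum c (K - 1) (\<lambda>_. 1)) +
      (\<Sum>i\<in>{1..<K}. ennreal ((c - 1) / c ^ i) * order_sum c K (\<lambda>_. order_sum c i (\<lambda>_. 1)))"
      unfolding q_def by (rule order_sum_rec[OF K])
    also have "\<dots> = q + (\<Sum>i\<in>{1..<K}. ennreal ((c - 1) / c ^ i) * ?a)"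
      using less[of "K - 1"] K by (simp add: less)
    also have "\<dots> = q + p * ?a" by (simp add: p_def sum_distrib_right)
    finally have eq: "?a = q + p * ?a" .
    have qp: "q + p = 1" unfolding q_def p_def by (rule split_weights_sum[OF c K])
    have "p \<le> 1" using add_increasing[of q p p] qp by simp
    then obtain p' where p': "p = ennreal p'" "0 \<le> p'" by (cases p) (auto simp: top_unique)
    obtain a' where a': "?a = ennreal a'" "0 \<le> a'"
      using order_sum_le_1[OF c, of K] by (cases ?a) (auto simp: top_unique)
    obtain q' where q': "q = ennreal q'" "0 < q'" using c by (simp add: q_def)
    from eq qp have "ennreal a' = ennreal (q' + p' * a')" "ennreal (q' + p') = ennreal 1"
      using p' a' q' by (simp_all add: ennreal_mult)
    moreover have "0 \<le> q' + p' * a'" "0 \<le> q' + p'" using p' a' q' by auto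
    ultimately have "a' = q' + p' * a'" "q' + p' = 1"
      using a'(2) ennreal_inj by (metis zero_le_one)+
    then have "a' = q' + p' * a'" "p' = 1 - q'" by simp_all
    then have "q' * a' = q'" by (simp add: left_diff_distrib)
    then have "a' = 1" using q'(2) by simp
    then show ?thesis using a'(1) by simp
  qed (simp add: order_sum_0)
qed

lemma borel_measurable_order_sum:
  assumes "\<And>s. f s \<in> borel_measurable M"
  shows "(\<lambda>x. order_sum c K (\<lambda>s. f s x)) \<in> borel_measurable M"
proof -
  interpret N: sigma_finite_measure "count_space (UNIV :: unit tree set)"
    by (rule sigma_finite_measure_count_space_countable) simp
  have [measurable]: "(\<lambda>(s, x). f s x) \<in> borel_measurable (count_space UNIV \<Otimes>\<^sub>M M)"
    by (rule measurable_pair_measure_countable1) (use assms in auto)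
  have "(\<lambda>(x, s). if strahler s = K then tree_weight c s * f s x else 0) \<in> borel_measurable (M \<Otimes>\<^sub>M count_space UNIV)"
    by measurable
  from N.borel_measurable_nn_integral[OF this] show ?thesis unfolding order_sum_def .
qed

text \<open>The law of the metric planar tree grown from order \<open>K\<close>, kept as a
  functional on nonnegative functions: mixing the edge laws over the shapes is then just a
  sum.\<close>

definition order_law :: "real \<Rightarrow> real \<Rightarrow> nat \<Rightarrow> (real tree \<Rightarrow> ennreal) \<Rightarrow> ennreal" where
  "order_law c b K f = order_sum c K (\<lambda>s. \<integral>\<^sup>+t. f t \<partial>edge_law b s)"

lemma borel_measurable_order_law:
  assumes "0 < b" "(\<lambda>(x, t). f x t) \<in> borel_measurable (M \<Otimes>\<^sub>M tree_sigma borel)"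
  shows "(\<lambda>x. order_law c b K (f x)) \<in> borel_measurable M"
  unfolding order_law_def
  by (intro borel_measurable_order_sum borel_measurable_edge_law_integral assms)

text \<open>Almost surely a marked tree has the skeleton from which it was made, and skeletons of
  positive weight are reduced; hence only reduced trees of number \<open>K\<close> have to be
  compared.\<close>

lemma order_law_mono:
  assumes "0 < b" "\<And>t. strahler t = K \<Longrightarrow> reduced t \<Longrightarrow> f t \<le> g t"
  shows "order_law c b K f \<le> order_law c b K g"
  unfolding order_law_def
proof (intro order_sum_mono nn_integral_mono_AE)
  fix s :: "unit tree" assume s: "strahler s = K" "tree_weight c s \<noteq> 0"
  show "AE t in edge_law b s. f t \<le> g t"
    using AE_edge_law[OF assms(1), of s]
  proof eventually_elim
    case (elim t)
    then have "strahler t = K" using s(1) by auto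
    moreover have "reduced (map_tree h t) \<Longrightarrow> reduced t" for h :: "real \<Rightarrow> unit"
      by (induction t) auto
    ultimately show ?case using elim tree_weight_reduced[OF s(2)] assms(2) by blast
  qed
qed

lemma order_law_cong:
  assumes "0 < b" "\<And>t. strahler t = K \<Longrightarrow> reduced t \<Longrightarrow> f t = g t"
  shows "order_law c b K f = order_law c b K g"
  using assms by (intro antisym order_law_mono) auto

lemma order_law_1:
  assumes "1 \<le> c" "0 < b"
  shows "order_law c b K (\<lambda>_. 1) = 1"
  unfolding order_law_def using prob_space.emeasure_space_1[OF prob_space_edge_law[OF assms(2)]]
  by (simp add: order_sum_1[OF assms(1)])

lemma order_law_0: "f \<in> borel_measurable (tree_sigma borel) \<Longrightarrow> order_law c b 0 f = f Leaf"
  by (simp add: order_law_def order_sum_0)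

lemma order_law_add:
  "f \<in> borel_measurable (tree_sigma borel) \<Longrightarrow> g \<in> borel_measurable (tree_sigma borel) \<Longrightarrow>
    order_law c b K (\<lambda>t. f t + g t) = order_law c b K f + order_law c b K g"
  by (simp add: order_law_def nn_integral_add order_sum_add)

lemma order_sum_edge_law_Node:
  assumes b: "0 < b" and [measurable]: "f \<in> borel_measurable (tree_sigma borel)"
  shows "order_sum c j (\<lambda>l. order_sum c i (\<lambda>r. \<integral>\<^sup>+t. f t \<partial>edge_law b (Node l () r))) =
    (\<integral>\<^sup>+x. order_law c b j (\<lambda>L. order_law c b i (\<lambda>R. f (Node L x R))) \<partial>exponential b)"
proof -
  note [measurable (raw)] = borel_measurable_edge_law_integral[OF b]
  have sf: "sigma_finite_measure (exponential b)" "sigma_finite_measure (edge_law b l)" for l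
    using b by (auto intro: prob_space_imp_sigma_finite prob_space_exponential prob_space_edge_law)
  have "order_sum c i (\<lambda>r. \<integral>\<^sup>+t. f t \<partial>edge_law b (Node l () r)) =
    (\<integral>\<^sup>+x. \<integral>\<^sup>+L. order_law c b i (\<lambda>R. f (Node L x R)) \<partial>edge_law b l \<partial>exponential b)" for l
  proof -
    have "order_sum c i (\<lambda>r. \<integral>\<^sup>+t. f t \<partial>edge_law b (Node l () r)) =
      order_sum c i (\<lambda>r. \<integral>\<^sup>+x. \<integral>\<^sup>+L. \<integral>\<^sup>+R. f (Node L x R) \<partial>edge_law b r \<partial>edge_law b l \<partial>exponential b)"
      using b by (simp add: nn_integral_edge_law_Node)
    also have "\<dots> = (\<integral>\<^sup>+x. order_sum c i (\<lambda>r. \<integral>\<^sup>+L. \<integral>\<^sup>+R. f (Node L x R) \<partial>edge_law b r \<partial>edge_law b l) \<partial>exponential b)"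
      by (intro order_sum_nn_integral sf) measurable
    also have "\<dots> = (\<integral>\<^sup>+x. \<integral>\<^sup>+L. order_law c b i (\<lambda>R. f (Node L x R)) \<partial>edge_law b l \<partial>exponential b)"
      unfolding order_law_def by (intro nn_integral_cong order_sum_nn_integral sf) measurable
    finally show ?thesis .
  qed
  then have "order_sum c j (\<lambda>l. order_sum c i (\<lambda>r. \<integral>\<^sup>+t. f t \<partial>edge_law b (Node l () r))) =
    order_sum c j (\<lambda>l. \<integral>\<^sup>+x. \<integral>\<^sup>+L. order_law c b i (\<lambda>R. f (Node L x R)) \<partial>edge_law b l \<partial>exponential b)"
    by simp
  also have "\<dots> = (\<integral>\<^sup>+x. order_law c b j (\<lambda>L. order_law c b i (\<lambda>R. f (Node L x R))) \<partial>exponential b)"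
  proof -
    note [measurable (raw)] = borel_measurable_order_law[OF b]
    show ?thesis
      unfolding order_law_def[of c b j] by (intro order_sum_nn_integral sf) measurable
  qed
  finally show ?thesis .
qed

lemma order_law_rec:
  assumes "0 < b" "1 \<le> K" and f: "f \<in> borel_measurable (tree_sigma borel)"
  shows "order_law c b K f =
    ennreal (1 / c ^ (K - 1)) * (\<integral>\<^sup>+x. order_law c b (K - 1) (\<lambda>L. order_law c b (K - 1) (\<lambda>R. f (Node L x R))) \<partial>exponential b) +
    (\<Sum>i\<in>{1..<K}. ennreal ((c - 1) / c ^ i) *
      (\<integral>\<^sup>+x. order_law c b K (\<lambda>L. order_law c b i (\<lambda>R. f (Node L x R))) \<partial>exponential b))"
  using order_sum_rec[OF assms(2), of c "\<lambda>s. \<integral>\<^sup>+t. f t \<partial>edge_law b s"]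
  unfolding order_sum_edge_law_Node[OF assms(1) f] order_law_def[symmetric] .


section \<open>Pruning\<close>

text \<open>The conditional expectation given that the root edge has length \<open>x\<close>.
  Keeping the root edge apart allows it a rate other than the rate \<open>b\<close> of the edges
  below, as is the case for the first piece of a merged edge.\<close>

definition order_step :: "real \<Rightarrow> real \<Rightarrow> nat \<Rightarrow> (real tree \<Rightarrow> ennreal) \<Rightarrow> real \<Rightarrow> ennreal" where
  "order_step c b K f x =
    ennreal (1 / c ^ (K - 1)) * order_law c b (K - 1) (\<lambda>L. order_law c b (K - 1) (\<lambda>R. f (Node L x R))) +
    (\<Sum>i\<in>{1..<K}. ennreal ((c - 1) / c ^ i) * order_law c b K (\<lambda>L. order_law c b i (\<lambda>R. f (Node L x R))))"

lemma nn_integral_order_step: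
  assumes "0 < b" and [measurable]: "f \<in> borel_measurable (tree_sigma borel)"
  shows "(\<integral>\<^sup>+x. order_step c b K f x \<partial>exponential a) =
    ennreal (1 / c ^ (K - 1)) * (\<integral>\<^sup>+x. order_law c b (K - 1) (\<lambda>L. order_law c b (K - 1) (\<lambda>R. f (Node L x R))) \<partial>exponential a) +
    (\<Sum>i\<in>{1..<K}. ennreal ((c - 1) / c ^ i) *
      (\<integral>\<^sup>+x. order_law c b K (\<lambda>L. order_law c b i (\<lambda>R. f (Node L x R))) \<partial>exponential a))"
proof -
  note [measurable (raw)] = borel_measurable_order_law[OF assms(1)]
  have [measurable]: "(\<lambda>x. order_law c b j (\<lambda>L. order_law c b i (\<lambda>R. f (Node L x R)))) \<in> borel_measurable borel" for i j
    by measurable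
  show ?thesis
    unfolding order_step_def by (subst nn_integral_add, measurable, measurable, subst nn_integral_sum, measurable)
      (simp add: nn_integral_cmult)
qed

lemma measurable_order_step:
  assumes "0 < b" and [measurable]: "f \<in> borel_measurable (tree_sigma borel)"
  shows "order_step c b K f \<in> borel_measurable borel"
proof -
  note [measurable (raw)] = borel_measurable_order_law[OF assms(1)]
  show ?thesis unfolding order_step_def by measurable
qed

lemma order_law_const:
  assumes "1 \<le> c" "0 < b"
  shows "order_law c b K (\<lambda>_. a) = a"
  unfolding order_law_def using prob_space.emeasure_space_1[OF prob_space_edge_law[OF assms(2)]]
    order_sum_multc[of c K "\<lambda>_. 1" a] order_sum_1[OF assms(1)] by simp

text \<open>The root edge of rate \<open>b / c\<close> is decomposed as a geometric sum. With
  probability \<open>1 / c\<close> it is one piece of rate \<open>b\<close> above the two subtrees;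
  otherwise such a piece sits on top of an independent copy of the whole tree, and
  \<open>merge_edge\<close> with an empty sibling glues them. Pruning a tree of rate
  \<open>b\<close> leads to the same equation.\<close>

lemma order_law_geometric:
  assumes c: "1 \<le> c" and b: "0 < b" and K: "1 \<le> K" and f [measurable]: "f \<in> borel_measurable (tree_sigma borel)"
  shows "order_law c (b / c) K f =
    ennreal (1 / c) * (\<integral>\<^sup>+x. order_step c (b / c) K f x \<partial>exponential b) +
    ennreal (1 - 1 / c) * (\<integral>\<^sup>+x. order_law c (b / c) K (\<lambda>t. f (merge_edge (+) t x Leaf)) \<partial>exponential b)"
proof -
  have bc: "0 < b / c" using b c by simp
  have rec: "order_law c (b / c) K g = (\<integral>\<^sup>+x. order_step c (b / c) K g x \<partial>exponential (b / c))"
    if "g \<in> borel_measurable (tree_sigma borel)" for g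
    using nn_integral_order_step[OF bc that] order_law_rec[OF bc K that] by simp
  have merge: "(\<lambda>t. f (merge_edge (+) t x Leaf)) \<in> borel_measurable (tree_sigma borel)" for x
    by measurable
  have "order_law c (b / c) K (\<lambda>t. f (merge_edge (+) t x Leaf)) = (\<integral>\<^sup>+y. order_step c (b / c) K f (x + y) \<partial>exponential (b / c))" for x
    unfolding rec[OF merge] by (rule nn_integral_cong) (simp add: order_step_def)
  then show ?thesis
    using exponential_geometric_sum[OF b c measurable_order_step[OF bc f]] rec[OF f] by simp
qed

text \<open>Edges merge only where exactly one side is empty, and the condition on \<open>a\<close>
  and \<open>i\<close> excludes this.\<close>

lemma order_law_Node_merge_edge:
  assumes "0 < b" "a = 0 \<longleftrightarrow> i = 0"
  shows "order_law c b a (\<lambda>L. order_law c b i (\<lambda>R. f (merge_edge (+) L x R))) =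
    order_law c b a (\<lambda>L. order_law c b i (\<lambda>R. f (Node L x R)))"
proof (intro order_law_cong assms(1))
  fix L R :: "real tree" assume "strahler L = a" "strahler R = i"
  with assms(2) have "L = Leaf \<longleftrightarrow> R = Leaf" by auto
  then show "f (merge_edge (+) L x R) = f (Node L x R)"
    by (cases L; cases R) auto
qed

text \<open>Pruning lowers the order of both sides of the root split by one. Side branches of order
  1, of weight (c - 1) / c = 1 - 1 / c, disappear and extend the root edge; every other split keeps
  \<open>1 / c\<close> times the weight that its pruned version has in a tree of order
  \<open>K\<close>. This reproduces the two terms of \<open>order_law_geometric\<close>. The
  truncation on the left loses mass, whence the inequality.\<close>

lemma order_sum_prune_le:
  assumes c: "1 \<le> c" and b: "0 < b" and f: "f \<in> borel_measurable (tree_sigma borel)"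
  shows "order_sum c (Suc K) (\<lambda>s. if size s < n then \<integral>\<^sup>+t. f (prune_pl t) \<partial>edge_law b s else 0) \<le> order_law c (b / c) K f"
  using f
proof (induction n arbitrary: K f)
  case 0
  show ?case by (simp add: order_sum_def cong: if_cong)
next
  case (Suc n)
  note [measurable] = Suc.prems
  have bc: "0 < b / c" using b c by simp
  let ?Q = "\<lambda>j f. order_sum c j (\<lambda>s. if size s < n then \<integral>\<^sup>+t. f (prune_pl t) \<partial>edge_law b s else 0)"
  let ?P = "order_law c (b / c)"
  let ?h = "\<lambda>s. if size s < Suc n then \<integral>\<^sup>+t. f (prune_pl t) \<partial>edge_law b s else 0"
  show ?case
  proof (cases "K = 0")
    case True
    have "order_sum c (Suc K) ?h \<le> order_law c b 1 (\<lambda>t. f (prune_pl t))"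
      unfolding order_law_def True One_nat_def by (intro order_sum_mono) auto
    also have "\<dots> = order_law c b 1 (\<lambda>_. f Leaf)"
    proof (rule order_law_cong[OF b])
      fix t :: "real tree" assume "strahler t = 1" "reduced t"
      then have "strahler (prune_pl t) = 0" by (simp only: strahler_prune_planar)
      then show "f (prune_pl t) = f Leaf" by simp
    qed
    also have "\<dots> = ?P K f"
      using c b by (simp add: order_law_const True order_law_0)
    finally show ?thesis .
  next
    case False
    then have K: "1 \<le> K" by simp
    \<comment> \<open>One kind of split at a time: sums over shapes and integrals over lengths are
      interchanged until the pruning of each side stands alone, and the induction hypothesis is
      applied to the right side inside the integral over the left one.\<close>
    have B: "order_sum c j (\<lambda>l. order_sum c i (\<lambda>r. ?h (Node l () r))) \<le>
        (\<integral>\<^sup>+x. ?P (j - 1) (\<lambda>L. ?P (i - 1) (\<lambda>R. f (merge_edge (+) L x R))) \<partial>exponential b)"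
      if ji: "1 \<le> j" "1 \<le> i" for j i
    proof -
      note [measurable (raw)] = borel_measurable_edge_law_integral[OF b] borel_measurable_order_law[OF bc]
      have sf: "sigma_finite_measure (exponential b)" "sigma_finite_measure (edge_law b l)" for l
        using b by (auto intro: prob_space_imp_sigma_finite prob_space_exponential prob_space_edge_law)
      have meas_Q: "(\<lambda>x. ?Q k (g x)) \<in> borel_measurable M"
        if [measurable]: "(\<lambda>(x, t). g x t) \<in> borel_measurable (M \<Otimes>\<^sub>M tree_sigma borel)" for g :: "'c \<Rightarrow> real tree \<Rightarrow> ennreal" and M k
        by (intro borel_measurable_order_sum) measurable
      let ?F = "\<lambda>L x R. f (merge_edge (+) (prune_pl L) x (prune_pl R))"
      let ?I = "\<lambda>r L x. if size r < n then \<integral>\<^sup>+R. ?F L x R \<partial>edge_law b r else 0"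
      have "?h (Node l () r) \<le> (\<integral>\<^sup>+x. (if size l < n then \<integral>\<^sup>+L. ?I r L x \<partial>edge_law b l else 0) \<partial>exponential b)"
        if l: "strahler l = j" for l r
      proof (cases "size l < n \<and> size r < n")
        case True
        have "(\<integral>\<^sup>+t. f (prune_pl t) \<partial>edge_law b (Node l () r)) =
          (\<integral>\<^sup>+x. \<integral>\<^sup>+L. \<integral>\<^sup>+R. f (prune_pl (Node L x R)) \<partial>edge_law b r \<partial>edge_law b l \<partial>exponential b)"
          using b by (intro nn_integral_edge_law_Node) auto
        also have "\<dots> = (\<integral>\<^sup>+x. \<integral>\<^sup>+L. \<integral>\<^sup>+R. ?F L x R \<partial>edge_law b r \<partial>edge_law b l \<partial>exponential b)"
        proof (rule nn_integral_cong, rule nn_integral_cong_AE)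
          fix x
          \<comment> \<open>The left side is almost surely nonempty, so the root edge is not a leaf
            edge and survives the cutting of leaves.\<close>
          show "AE L in edge_law b l. (\<integral>\<^sup>+R. f (prune_pl (Node L x R)) \<partial>edge_law b r) = (\<integral>\<^sup>+R. ?F L x R \<partial>edge_law b r)"
            using AE_edge_law[OF b, of l]
          proof eventually_elim
            case (elim L)
            then have "strahler L = j" using l by auto
            then have "L \<noteq> Leaf" using ji by auto
            then show ?case by (simp add: prune_planar_Node)
          qed
        qed
        finally show ?thesis using True by simp
      qed auto
      then have "order_sum c j (\<lambda>l. order_sum c i (\<lambda>r. ?h (Node l () r))) \<le>
        order_sum c j (\<lambda>l. order_sum c i (\<lambda>r. \<integral>\<^sup>+x. (if size l < n then \<integral>\<^sup>+L. ?I r L x \<partial>edge_law b l else 0) \<partial>exponential b))"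
        by (intro order_sum_mono)
      also have "\<dots> = order_sum c j (\<lambda>l. \<integral>\<^sup>+x. (if size l < n then \<integral>\<^sup>+L. order_sum c i (\<lambda>r. ?I r L x) \<partial>edge_law b l else 0) \<partial>exponential b)"
      proof (intro order_sum_cong)
        fix l :: "unit tree"
        have "order_sum c i (\<lambda>r. \<integral>\<^sup>+x. (if size l < n then \<integral>\<^sup>+L. ?I r L x \<partial>edge_law b l else 0) \<partial>exponential b) =
            (\<integral>\<^sup>+x. order_sum c i (\<lambda>r. if size l < n then \<integral>\<^sup>+L. ?I r L x \<partial>edge_law b l else 0) \<partial>exponential b)"
          by (intro order_sum_nn_integral sf) measurable
        moreover have "order_sum c i (\<lambda>r. if size l < n then \<integral>\<^sup>+L. ?I r L x \<partial>edge_law b l else 0) =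
            (if size l < n then \<integral>\<^sup>+L. order_sum c i (\<lambda>r. ?I r L x) \<partial>edge_law b l else 0)" for x
        proof (cases "size l < n")
          case True
          then show ?thesis by (simp only: if_True, intro order_sum_nn_integral sf) measurable
        qed (simp add: order_sum_def cong: if_cong)
        ultimately show "order_sum c i (\<lambda>r. \<integral>\<^sup>+x. (if size l < n then \<integral>\<^sup>+L. ?I r L x \<partial>edge_law b l else 0) \<partial>exponential b) =
          (\<integral>\<^sup>+x. (if size l < n then \<integral>\<^sup>+L. order_sum c i (\<lambda>r. ?I r L x) \<partial>edge_law b l else 0) \<partial>exponential b)"
          by (simp only:)
      qed
      also have "\<dots> = (\<integral>\<^sup>+x. ?Q j (\<lambda>L. ?Q i (\<lambda>R. f (merge_edge (+) L x R))) \<partial>exponential b)"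
      proof (intro order_sum_nn_integral sf)
        have J: "(\<lambda>(x, L). order_sum c i (\<lambda>r. ?I r L x)) \<in> borel_measurable (borel \<Otimes>\<^sub>M tree_sigma borel)"
          unfolding split_def by (intro borel_measurable_order_sum) measurable
        show "(\<lambda>x. if size l < n then \<integral>\<^sup>+L. order_sum c i (\<lambda>r. ?I r L x) \<partial>edge_law b l else 0)
            \<in> borel_measurable (exponential b)" for l :: "unit tree"
          using borel_measurable_edge_law_integral[OF b J, of l]
          by (cases "size l < n") (simp_all cong: measurable_cong_sets)
      qed
      also have "\<dots> \<le> (\<integral>\<^sup>+x. ?P (j - 1) (\<lambda>L. ?P (i - 1) (\<lambda>R. f (merge_edge (+) L x R))) \<partial>exponential b)"
      proof (intro nn_integral_mono)
        fix x
        have i: "?Q i (\<lambda>R. f (merge_edge (+) L x R)) \<le> ?P (i - 1) (\<lambda>R. f (merge_edge (+) L x R))" for L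
          using Suc.IH[of "\<lambda>R. f (merge_edge (+) L x R)" "i - 1"] ji by simp
        have "?Q j (\<lambda>L. ?Q i (\<lambda>R. f (merge_edge (+) L x R))) \<le> ?Q j (\<lambda>L. ?P (i - 1) (\<lambda>R. f (merge_edge (+) L x R)))"
          using i by (intro order_sum_mono) (auto intro!: nn_integral_mono)
        also have "\<dots> \<le> ?P (j - 1) (\<lambda>L. ?P (i - 1) (\<lambda>R. f (merge_edge (+) L x R)))"
          using Suc.IH[of "\<lambda>L. ?P (i - 1) (\<lambda>R. f (merge_edge (+) L x R))" "j - 1"] ji by simp
        finally show "?Q j (\<lambda>L. ?Q i (\<lambda>R. f (merge_edge (+) L x R))) \<le> \<dots>" .
      qed
      finally show ?thesis .
    qed
    let ?N = "\<lambda>j i. \<integral>\<^sup>+x. ?P j (\<lambda>L. ?P i (\<lambda>R. f (Node L x R))) \<partial>exponential b"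
    let ?M = "\<lambda>j i. \<integral>\<^sup>+x. ?P j (\<lambda>L. ?P i (\<lambda>R. f (merge_edge (+) L x R))) \<partial>exponential b"
    have MN: "?M j i = ?N j i" if "j = 0 \<longleftrightarrow> i = 0" for j i
      using order_law_Node_merge_edge[OF bc that] by simp
    have "order_sum c (Suc K) ?h \<le> ennreal (1 / c ^ K) * ?M (K - 1) (K - 1) +
        (\<Sum>i\<in>{1..<Suc K}. ennreal ((c - 1) / c ^ i) * ?M K (i - 1))"
      using B[of K K] B[of "Suc K"] K
      by (subst order_sum_rec) (auto intro!: add_mono sum_mono mult_left_mono simp del: sum.op_ivl_Suc)
    \<comment> \<open>The term for \<open>i = 1\<close> is singled out: its side branch is cut off
      and leaves a vertex of degree two, which is where edges merge.\<close>
    also have "(\<Sum>i\<in>{1..<Suc K}. ennreal ((c - 1) / c ^ i) * ?M K (i - 1)) =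
        ennreal ((c - 1) / c) * ?M K 0 + (\<Sum>i\<in>{1..<K}. ennreal ((c - 1) / c ^ Suc i) * ?M K i)"
      using K by (subst sum.atLeast_Suc_lessThan) (auto simp: sum.shift_bounds_Suc_ivl simp del: sum.op_ivl_Suc)
    also have "\<dots> = ennreal (1 - 1 / c) * ?M K 0 + (\<Sum>i\<in>{1..<K}. ennreal (1 / c) * (ennreal ((c - 1) / c ^ i) * ?N K i))"
    proof -
      have "ennreal ((c - 1) / c ^ Suc i) * ?M K i = ennreal (1 / c) * (ennreal ((c - 1) / c ^ i) * ?N K i)" if "i \<in> {1..<K}" for i
      proof -
        have "ennreal ((c - 1) / c ^ Suc i) = ennreal (1 / c) * ennreal ((c - 1) / c ^ i)"
          using c by (subst ennreal_mult[symmetric]) auto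
        then show ?thesis using MN[of K i] that by (simp add: mult.assoc)
      qed
      moreover have "(c - 1) / c = 1 - 1 / c" using c by (simp add: diff_divide_distrib)
      ultimately show ?thesis by simp
    qed
    also have "ennreal (1 / c ^ K) * ?M (K - 1) (K - 1) = ennreal (1 / c) * (ennreal (1 / c ^ (K - 1)) * ?N (K - 1) (K - 1))"
    proof -
      have "ennreal (1 / c ^ K) = ennreal (1 / c) * ennreal (1 / c ^ (K - 1))"
        using c K by (cases K) (auto simp: ennreal_mult[symmetric])
      then show ?thesis using MN[of "K - 1" "K - 1"] by (simp add: mult.assoc)
    qed
    also have "?M K 0 = (\<integral>\<^sup>+x. ?P K (\<lambda>t. f (merge_edge (+) t x Leaf)) \<partial>exponential b)"
      by (simp add: order_law_0)
    finally show ?thesis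
      unfolding order_law_geometric[OF c b K Suc.prems] nn_integral_order_step[OF bc Suc.prems]
      by (simp add: distrib_left sum_distrib_left add_ac)
  qed
qed

text \<open>The values for \<open>f\<close> and \<open>1 - f\<close> add up to 1 on both sides, so
  the upper bound for \<open>1 - f\<close> is a lower bound for \<open>f\<close>. This is where
  \<open>f\<close> has to be bounded by 1.\<close>

lemma order_law_prune:
  assumes c: "1 \<le> c" and b: "0 < b" and f [measurable]: "f \<in> borel_measurable (tree_sigma borel)" and f1: "\<And>t. f t \<le> 1"
  shows "order_law c b (Suc K) (\<lambda>t. f (prune_pl t)) = order_law c (b / c) K f"
proof -
  have bc: "0 < b / c" using b c by simp
  have le: "order_law c b (Suc K) (\<lambda>t. g (prune_pl t)) \<le> order_law c (b / c) K g"
    if "g \<in> borel_measurable (tree_sigma borel)" for g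
    unfolding order_law_def[of c b] by (rule order_sum_le_by_size, rule order_sum_prune_le[OF c b that])
  let ?g = "\<lambda>t. 1 - f t"
  have fg: "f t + ?g t = 1" for t
    using f1[of t] by (simp add: add_diff_inverse_ennreal)
  have 1: "order_law c (b / c) K f + order_law c (b / c) K ?g = 1"
    using order_law_1[OF c bc, of K] by (subst order_law_add[symmetric]) (auto simp: fg)
  have 2: "order_law c b (Suc K) (\<lambda>t. f (prune_pl t)) + order_law c b (Suc K) (\<lambda>t. ?g (prune_pl t)) = 1"
    using order_law_1[OF c b, of "Suc K"] by (subst order_law_add[symmetric]) (auto simp: fg)
  have "order_law c (b / c) K f + order_law c (b / c) K ?g =
      order_law c b (Suc K) (\<lambda>t. f (prune_pl t)) + order_law c b (Suc K) (\<lambda>t. ?g (prune_pl t))"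
    using 1 2 by simp
  also have "\<dots> \<le> order_law c b (Suc K) (\<lambda>t. f (prune_pl t)) + order_law c (b / c) K ?g"
    by (intro add_left_mono le) measurable
  finally have "order_law c (b / c) K f + order_law c (b / c) K ?g \<le>
      order_law c b (Suc K) (\<lambda>t. f (prune_pl t)) + order_law c (b / c) K ?g" .
  moreover have "order_law c (b / c) K ?g \<noteq> \<infinity>"
  proof -
    have "order_law c (b / c) K ?g \<le> 1"
      using 1 add_increasing[of "order_law c (b / c) K f" "order_law c (b / c) K ?g" "order_law c (b / c) K ?g"] by simp
    then show ?thesis by (auto simp: top_unique)
  qed
  ultimately have "order_law c (b / c) K f \<le> order_law c b (Suc K) (\<lambda>t. f (prune_pl t))"
    by (simp add: ennreal_add_left_cancel_le add.commute)
  then show ?thesis using le[OF f] by simp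
qed


section \<open>Complete subtrees\<close>

text \<open>On the way down from the root, complete subtrees of order \<open>K\<close> are entered
  at the first vertex of number \<open>K\<close>. Stopping there replaces the record of the parent's
  order that \<open>complete_subtrees_below\<close> carries along.\<close>

primrec complete_sum :: "nat \<Rightarrow> ('a tree \<Rightarrow> ennreal) \<Rightarrow> 'a tree \<Rightarrow> ennreal" where
  "complete_sum K g Leaf = 0"
| "complete_sum K g (Node l x r) =
    (if strahler (Node l x r) < K then 0 else if strahler (Node l x r) = K then g (Node l x r)
     else complete_sum K g l + complete_sum K g r)"

text \<open>The size of the part above the stopping line, which does not change with the size of the
  complete subtrees below it.\<close>

primrec edges_above :: "nat \<Rightarrow> 'a tree \<Rightarrow> nat" where
  "edges_above K Leaf = 0"
| "edges_above K (Node l x r) =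
    (if strahler (Node l x r) \<le> K then 0 else Suc (edges_above K l + edges_above K r))"

lemma complete_sum_0: "strahler s < K \<Longrightarrow> complete_sum K g s = 0"
  by (cases s) auto

lemma complete_sum_eq: "1 \<le> K \<Longrightarrow> strahler s = K \<Longrightarrow> complete_sum K g s = g s"
  by (cases s) auto

lemma edges_above_0_iff: "edges_above K s = 0 \<longleftrightarrow> strahler s \<le> K"
  by (cases s) auto

lemma complete_sum_1_ge: "1 \<le> K \<Longrightarrow> K \<le> strahler s \<Longrightarrow> 1 \<le> complete_sum K (\<lambda>_. 1) s"
proof (induction s)
  case (Node l x r)
  show ?case
  proof (cases "strahler (Node l x r) = K")
    case False
    with Node.prems have "K \<le> strahler l \<or> K \<le> strahler r" by (auto split: if_splits)
    then have "1 \<le> complete_sum K (\<lambda>_. 1) l \<or> 1 \<le> complete_sum K (\<lambda>_. 1) r"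
      using Node.IH Node.prems(1) by blast
    then have "1 \<le> complete_sum K (\<lambda>_. 1) l + complete_sum K (\<lambda>_. 1) r"
      using add_increasing add_increasing2 by (metis zero_le)
    then show ?thesis using False Node.prems(2) by simp
  qed simp
qed simp

lemma complete_sum_1_finite: "complete_sum K (\<lambda>_. 1) s < \<infinity>"
  by (induction s) auto

text \<open>
  The induction is on the number of edges above the complete subtrees of order \<open>K\<close>, as truncating the
  tree at those subtrees would destroy the identity.
\<close>

lemma complete_sum_above:
  fixes g :: "unit tree \<Rightarrow> ennreal"
  assumes c: "1 \<le> c" and K: "1 \<le> K"
  defines "G \<equiv> complete_sum K g" and "N \<equiv> complete_sum K (\<lambda>_. 1) :: unit tree \<Rightarrow> ennreal"
  shows "(\<integral>\<^sup>+s. (if edges_above K s = m then tree_weight c s * (\<phi> (strahler s) (N s) * G s) else 0) \<partial>count_space UNIV) =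
    order_sum c K g * (\<integral>\<^sup>+s. (if edges_above K s = m then tree_weight c s * (\<phi> (strahler s) (N s) * N s) else 0) \<partial>count_space UNIV)"
proof (induction m arbitrary: \<phi> rule: less_induct)
  case (less m)
  let ?w = "tree_weight c" and ?e = "edges_above K" and ?g = "order_sum c K g"
  have swap: "(\<integral>\<^sup>+l. \<integral>\<^sup>+r. f l r \<partial>count_space UNIV \<partial>count_space UNIV) = (\<integral>\<^sup>+r. \<integral>\<^sup>+l. f l r \<partial>count_space UNIV \<partial>count_space UNIV)"
    for f :: "unit tree \<Rightarrow> unit tree \<Rightarrow> ennreal"
    by (intro nn_integral_tree_swap sigma_finite_measure_count_space_countable) auto
  show ?case
  proof (cases m)
    \<comment> \<open>With no edge above the line, the tree is its own only complete subtree or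
      contains none.\<close>
    case 0
    have *: "(\<integral>\<^sup>+s. (if ?e s = 0 then ?w s * (\<phi> (strahler s) (complete_sum K (\<lambda>_. 1) s) * complete_sum K h s) else 0) \<partial>count_space UNIV) =
      \<phi> K 1 * order_sum c K h" for h :: "unit tree \<Rightarrow> ennreal"
    proof -
      have "(\<integral>\<^sup>+s. (if ?e s = 0 then ?w s * (\<phi> (strahler s) (complete_sum K (\<lambda>_. 1) s) * complete_sum K h s) else 0) \<partial>count_space UNIV) =
        order_sum c K (\<lambda>s. \<phi> K 1 * h s)"
        unfolding order_sum_def edges_above_0_iff
      proof (rule nn_integral_cong)
        fix s :: "unit tree"
        show "(if strahler s \<le> K then ?w s * (\<phi> (strahler s) (complete_sum K (\<lambda>_. 1) s) * complete_sum K h s) else 0) =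
          (if strahler s = K then ?w s * (\<phi> K 1 * h s) else 0)"
          using K complete_sum_0[of s K h] complete_sum_eq[of K s h] complete_sum_eq[of K s "\<lambda>_. 1"] by auto
      qed
      then show ?thesis by (simp add: order_sum_cmult)
    qed
    show ?thesis unfolding 0 G_def N_def * using order_sum_1[OF c] by (simp add: mult.commute)
  next
    case (Suc m')
    let ?v = "\<lambda>a b. ennreal (split_weight c a b)"
    let ?ord = "\<lambda>a b. if a = b then Suc a else max a b"
    let ?c = "\<lambda>l r. ?v (strahler l) (strahler r) * (\<phi> (?ord (strahler l) (strahler r)) (N l + N r))"
    let ?p = "\<lambda>l r. K < ?ord (strahler l) (strahler r) \<and> ?e l + ?e r = m'"
    have split: "(\<integral>\<^sup>+s. (if ?e s = m then ?w s * (\<phi> (strahler s) (N s) * complete_sum K h s) else 0) \<partial>count_space UNIV) =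
        (\<integral>\<^sup>+l. \<integral>\<^sup>+r. (if ?p l r then ?w l * (?w r * (?c l r * complete_sum K h l)) else 0) \<partial>count_space UNIV \<partial>count_space UNIV) +
        (\<integral>\<^sup>+l. \<integral>\<^sup>+r. (if ?p l r then ?w l * (?w r * (?c l r * complete_sum K h r)) else 0) \<partial>count_space UNIV \<partial>count_space UNIV)"
      for h
    proof -
      have "(\<integral>\<^sup>+s. (if ?e s = m then ?w s * (\<phi> (strahler s) (N s) * complete_sum K h s) else 0) \<partial>count_space UNIV) =
        (\<integral>\<^sup>+l. \<integral>\<^sup>+r. (if ?p l r then ?w l * (?w r * (?c l r * complete_sum K h l)) else 0) +
          (if ?p l r then ?w l * (?w r * (?c l r * complete_sum K h r)) else 0) \<partial>count_space UNIV \<partial>count_space UNIV)"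
        (is "(\<integral>\<^sup>+s. ?F s \<partial>_) = (\<integral>\<^sup>+l. \<integral>\<^sup>+r. ?A l r + ?B l r \<partial>_ \<partial>_)")
      proof -
        have "?F (Node l () r) = ?A l r + ?B l r" for l r
        proof (cases "?p l r")
          case True
          then have p: "?e (Node l () r) = m" "\<not> strahler (Node l () r) \<le> K" using Suc by (auto split: if_splits)
          then have "complete_sum K h (Node l () r) = complete_sum K h l + complete_sum K h r"
              "N (Node l () r) = N l + N r"
            by (auto simp: N_def split: if_splits)
          then show ?thesis using True p by (simp only: if_True simp_thms tree_weight.simps strahler.simps distrib_left distrib_right mult_ac)
        next
          case False
          then have "?e (Node l () r) \<noteq> m" using Suc by (auto split: if_splits)
          with False show ?thesis by (simp only: if_False add_0)
        qed
        then show ?thesis using Suc by (subst nn_integral_count_space_tree) simp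
      qed
      then show ?thesis by (simp add: nn_integral_add)
    qed
    \<comment> \<open>With the right subtree fixed, the split weight, the resulting order and the
      total count depend on the left subtree only through its order and its count. They are absorbed
      into a new \<phi>, which is why \<phi> has to be arbitrary. The guard
      \<open>?e r \<le> m'\<close> protects the truncated subtraction in
      \<open>m' - ?e r\<close>.\<close>
    have left: "(\<integral>\<^sup>+l. (if ?p l r then ?w l * (?w r * (?c l r * G l)) else 0) \<partial>count_space UNIV) =
        ?g * (\<integral>\<^sup>+l. (if ?p l r then ?w l * (?w r * (?c l r * N l)) else 0) \<partial>count_space UNIV)" for r
    proof -
      let ?f = "\<lambda>a n. if K < ?ord a (strahler r) \<and> ?e r \<le> m' then ?w r * (?v a (strahler r) * \<phi> (?ord a (strahler r)) (n + N r)) else 0"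
      have "(if ?p l r then ?w l * (?w r * (?c l r * y)) else 0) =
          (if ?e l = m' - ?e r then ?w l * (?f (strahler l) (N l) * y) else 0)" for l y
        by (cases "?e r \<le> m'") (auto simp: mult_ac)
      then show ?thesis using less.IH[of "m' - ?e r" ?f] Suc by simp
    qed
    have right: "(\<integral>\<^sup>+r. (if ?p l r then ?w l * (?w r * (?c l r * G r)) else 0) \<partial>count_space UNIV) =
        ?g * (\<integral>\<^sup>+r. (if ?p l r then ?w l * (?w r * (?c l r * N r)) else 0) \<partial>count_space UNIV)" for l
    proof -
      let ?f = "\<lambda>a n. if K < ?ord (strahler l) a \<and> ?e l \<le> m' then ?w l * (?v (strahler l) a * \<phi> (?ord (strahler l) a) (N l + n)) else 0"
      have "(if ?p l r then ?w l * (?w r * (?c l r * y)) else 0) =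
          (if ?e r = m' - ?e l then ?w r * (?f (strahler r) (N r) * y) else 0)" for r y
        by (cases "?e l \<le> m'") (auto simp: mult_ac)
      then show ?thesis using less.IH[of "m' - ?e l" ?f] Suc by simp
    qed
    show ?thesis
      unfolding G_def N_def split[unfolded N_def]
      unfolding G_def[symmetric] N_def[symmetric] right
      unfolding swap[of "\<lambda>l r. if ?p l r then ?w l * (?w r * (?c l r * G l)) else 0"] left
        swap[of "\<lambda>l r. if ?p l r then ?w l * (?w r * (?c l r * N l)) else 0"]
      by (simp add: nn_integral_cmult distrib_left)
  qed
qed

text \<open>A Wald identity: conditionally on the number of complete subtrees, the expected sum of
  \<open>g\<close> over them is that number times the mean of \<open>g\<close> for order
  \<open>K\<close>. It is obtained by summing over the size of the part above the line, with \<phi>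
  also selecting the order \<open>H\<close>.\<close>

lemma order_sum_complete_sum:
  assumes c: "1 \<le> c" and K: "1 \<le> K"
  shows "order_sum c H (\<lambda>s. \<phi> (complete_sum K (\<lambda>_. 1) s) * complete_sum K g s) =
    order_sum c K g * order_sum c H (\<lambda>s. \<phi> (complete_sum K (\<lambda>_. 1) s) * complete_sum K (\<lambda>_. 1) s)"
proof -
  let ?e = "edges_above K" and ?N = "complete_sum K (\<lambda>_. 1) :: unit tree \<Rightarrow> ennreal"
  let ?f = "\<lambda>h m s. if ?e s = m then tree_weight c s * ((if strahler s = H then \<phi> (?N s) else 0) * complete_sum K h s) else 0"
  have "order_sum c H (\<lambda>s. \<phi> (?N s) * complete_sum K h s) = (\<Sum>m. \<integral>\<^sup>+s. ?f h m s \<partial>count_space UNIV)" for h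
  proof -
    have "order_sum c H (\<lambda>s. \<phi> (?N s) * complete_sum K h s) = (\<integral>\<^sup>+s. (\<Sum>m. ?f h m s) \<partial>count_space UNIV)"
      unfolding order_sum_def
    proof (rule nn_integral_cong)
      fix s :: "unit tree"
      have "(\<Sum>m. ?f h m s) = (\<Sum>m\<in>{?e s}. ?f h m s)"
        by (rule suminf_finite) auto
      then show "(if strahler s = H then tree_weight c s * (\<phi> (?N s) * complete_sum K h s) else 0) = (\<Sum>m. ?f h m s)"
        by simp
    qed
    then show ?thesis by (simp add: nn_integral_suminf)
  qed
  then show ?thesis
    using complete_sum_above[OF c K, where \<phi> = "\<lambda>a n. if a = H then \<phi> n else 0" and g = g] by simp
qed

text \<open>The weighting by the inverse of the number turns the Wald identity into one for
  averages, as a tree of order at least \<open>K\<close> contains a complete subtree of order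
  \<open>K\<close>.\<close>

lemma order_sum_complete_average:
  assumes c: "1 \<le> c" and K: "1 \<le> K" and KH: "K \<le> H"
  shows "order_sum c H (\<lambda>s. complete_sum K g s / complete_sum K (\<lambda>_. 1) s) = order_sum c K g"
proof -
  let ?N = "complete_sum K (\<lambda>_. 1) :: unit tree \<Rightarrow> ennreal"
  have "order_sum c H (\<lambda>s. inverse (?N s) * ?N s) = order_sum c H (\<lambda>_. 1)"
  proof (rule order_sum_cong)
    fix s :: "unit tree" assume "strahler s = H"
    then have "1 \<le> ?N s" using K KH by (intro complete_sum_1_ge) auto
    then have "?N s \<noteq> 0" by auto
    then show "inverse (?N s) * ?N s = 1"
      using complete_sum_1_finite[of K s] by (simp add: mult.commute ennreal_divide_self flip: divide_ennreal_def)
  qed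
  then show ?thesis
    using order_sum_complete_sum[OF c K, where \<phi> = inverse and H = H and g = g] order_sum_1[OF c]
    by (simp add: divide_ennreal_def mult.commute)
qed

lemma measurable_complete_sum [measurable]:
  assumes [measurable]: "f \<in> borel_measurable (tree_sigma borel)"
  shows "complete_sum K f \<in> borel_measurable (tree_sigma (borel :: real measure))"
proof -
  have [measurable]: "strahler \<in> (tree_sigma borel :: real tree measure) \<rightarrow>\<^sub>M count_space UNIV"
    using measurable_compose[OF measurable_skeleton, of "strahler :: unit tree \<Rightarrow> nat" "count_space UNIV"] by simp
  have "complete_sum K f = rec_tree 0 (\<lambda>l (x::real) r l' r'. if strahler (Node l x r) < K then 0
      else if strahler (Node l x r) = K then f (Node l x r) else l' + r')"
    by (rule ext) (induct_tac x, auto)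
  also have "\<dots> \<in> borel_measurable (tree_sigma borel)"
    by (rule measurable_rec_tree) measurable
  finally show ?thesis .
qed

text \<open>Which subtrees are complete is decided by the skeleton, so the lengths can be integrated
  out within each of them.\<close>

lemma nn_integral_complete_sum:
  assumes b: "0 < b" and f [measurable]: "f \<in> borel_measurable (tree_sigma borel)"
  shows "(\<integral>\<^sup>+t. complete_sum K f t \<partial>edge_law b s) = complete_sum K (\<lambda>s. \<integral>\<^sup>+t. f t \<partial>edge_law b s) s"
proof (induction s)
  case (Node l u r)
  let ?s = "strahler (Node l u r)"
  interpret l: prob_space "edge_law b l" by (rule prob_space_edge_law) fact
  interpret r: prob_space "edge_law b r" by (rule prob_space_edge_law) fact
  interpret x: prob_space "exponential b" by (rule prob_space_exponential) fact
  have "(\<integral>\<^sup>+t. complete_sum K f t \<partial>edge_law b (Node l u r)) = (\<integral>\<^sup>+t. (if ?s < K then 0 else if ?s = K then f t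
      else complete_sum K f (Tree.left t) + complete_sum K f (Tree.right t)) \<partial>edge_law b (Node l u r))"
  proof (rule nn_integral_cong_AE)
    show "AE t in edge_law b (Node l u r). complete_sum K f t = (if ?s < K then 0 else if ?s = K then f t
      else complete_sum K f (Tree.left t) + complete_sum K f (Tree.right t))"
      using AE_edge_law[OF b, of "Node l u r"]
    proof eventually_elim
      case (elim t)
      then obtain L x R where t: "t = Node L x R" "skeleton L = l" "skeleton R = r" by (cases t) auto
      then have "strahler L = strahler l" "strahler R = strahler r" by auto
      then show ?case unfolding t by (auto simp: complete_sum_0)
    qed
  qed
  also have "\<dots> = (if ?s < K then 0 else if ?s = K then (\<integral>\<^sup>+t. f t \<partial>edge_law b (Node l u r))
      else (\<integral>\<^sup>+t. complete_sum K f (Tree.left t) + complete_sum K f (Tree.right t) \<partial>edge_law b (Node l u r)))"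
    by simp
  also have "(\<integral>\<^sup>+t. complete_sum K f (Tree.left t) + complete_sum K f (Tree.right t) \<partial>edge_law b (Node l u r)) =
      complete_sum K (\<lambda>s. \<integral>\<^sup>+t. f t \<partial>edge_law b s) l + complete_sum K (\<lambda>s. \<integral>\<^sup>+t. f t \<partial>edge_law b s) r"
    using l.emeasure_space_1 r.emeasure_space_1 x.emeasure_space_1
    by (subst nn_integral_edge_law_Node[OF b]) (simp_all add: nn_integral_add Node)
  finally show ?case by simp
qed simp


section \<open>The branching history\<close>

text \<open>Independence of disjoint families of coordinates, without splitting the product space:
  if \<open>h\<close> reads the coordinates in \<open>J\<close> from \<open>x\<close> and the others
  from \<open>y\<close>, the two points may be taken independent. Gluing two independent points
  along \<open>J\<close> gives the product measure again, which is checked on cylinders.\<close>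

lemma nn_integral_PiM_decouple:
  fixes M :: "'i \<Rightarrow> 'a measure"
  assumes M: "\<And>i. i \<in> I \<Longrightarrow> prob_space (M i)"
    and h [measurable]: "(\<lambda>(x, y). h x y) \<in> borel_measurable (PiM I M \<Otimes>\<^sub>M PiM I M)"
    and dep: "\<And>x y x' y'. (\<And>i. i \<in> I \<Longrightarrow> i \<in> J \<Longrightarrow> x i = x' i) \<Longrightarrow> (\<And>i. i \<in> I \<Longrightarrow> i \<notin> J \<Longrightarrow> y i = y' i) \<Longrightarrow> h x y = h x' y'"
  shows "(\<integral>\<^sup>+x. h x x \<partial>PiM I M) = (\<integral>\<^sup>+x. \<integral>\<^sup>+y. h x y \<partial>PiM I M \<partial>PiM I M)"
proof -
  let ?P = "PiM I M" and ?m = "\<lambda>p. \<lambda>i\<in>I. if i \<in> J then fst p i else snd p i"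
  interpret P: prob_space ?P by (rule prob_space_PiM) (rule M)
  interpret PP: pair_prob_space ?P ?P ..
  have m: "?m \<in> ?P \<Otimes>\<^sub>M ?P \<rightarrow>\<^sub>M ?P"
  proof (rule measurable_restrict)
    fix i assume "i \<in> I"
    then show "(\<lambda>p. if i \<in> J then fst p i else snd p i) \<in> ?P \<Otimes>\<^sub>M ?P \<rightarrow>\<^sub>M M i"
      by (cases "i \<in> J") simp_all
  qed
  have "?P = distr (?P \<Otimes>\<^sub>M ?P) ?P ?m"
  proof (rule measure_eqI_PiM_infinite)
    fix L A assume L: "finite L" "L \<subseteq> I" and A: "\<And>j. j \<in> L \<Longrightarrow> A j \<in> sets (M j)"
    let ?emb = "\<lambda>L. prod_emb I M L (Pi\<^sub>E L A)"
    have sets: "?emb L' \<in> sets ?P" if "L' \<subseteq> L" for L'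
      using that L A by (intro sets_PiM_I) (auto intro: finite_subset)
    have "emeasure (distr (?P \<Otimes>\<^sub>M ?P) ?P ?m) (?emb L) = emeasure (?P \<Otimes>\<^sub>M ?P) (?m -` ?emb L \<inter> space (?P \<Otimes>\<^sub>M ?P))"
      by (rule emeasure_distr[OF m sets]) simp
    also have "?m -` ?emb L \<inter> space (?P \<Otimes>\<^sub>M ?P) = ?emb (L \<inter> J) \<times> ?emb (L - J)"
    proof (rule set_eqI)
      have emb: "x \<in> ?emb L' \<longleftrightarrow> x \<in> space ?P \<and> (\<forall>i\<in>L'. x i \<in> A i)" for x L'
        by (auto simp: prod_emb_def space_PiM PiE_iff)
      fix p
      show "p \<in> ?m -` ?emb L \<inter> space (?P \<Otimes>\<^sub>M ?P) \<longleftrightarrow> p \<in> ?emb (L \<inter> J) \<times> ?emb (L - J)"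
      proof (cases "p \<in> space (?P \<Otimes>\<^sub>M ?P)")
        case True
        then have "?m p \<in> space ?P" by (rule measurable_space[OF m])
        moreover have "(\<forall>i\<in>L. ?m p i \<in> A i) \<longleftrightarrow> (\<forall>i\<in>L \<inter> J. fst p i \<in> A i) \<and> (\<forall>i\<in>L - J. snd p i \<in> A i)"
          using L(2) by (auto simp: subset_iff)
        ultimately show ?thesis using True unfolding emb mem_Times_iff vimage_def Int_iff mem_Collect_eq space_pair_measure
          by blast
      qed (auto simp: emb space_pair_measure)
    qed
    also have "emeasure (?P \<Otimes>\<^sub>M ?P) \<dots> = emeasure ?P (?emb (L \<inter> J)) * emeasure ?P (?emb (L - J))"
      by (intro P.emeasure_pair_measure_Times sets) auto
    also have "\<dots> = (\<Prod>i\<in>L \<inter> J. emeasure (M i) (A i)) * (\<Prod>i\<in>L - J. emeasure (M i) (A i))"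
      using L A by (subst (1 2) emeasure_PiM_emb[OF M]) (auto intro: finite_subset)
    also have "\<dots> = (\<Prod>i\<in>L. emeasure (M i) (A i))"
      by (rule prod.Int_Diff[OF L(1), symmetric])
    also have "\<dots> = emeasure ?P (?emb L)"
      using L A by (subst emeasure_PiM_emb[OF M]) auto
    finally show "emeasure ?P (?emb L) = emeasure (distr (?P \<Otimes>\<^sub>M ?P) ?P ?m) (?emb L)" ..
  qed (auto intro: P.finite_measure_axioms)
  then have "(\<integral>\<^sup>+x. h x x \<partial>?P) = (\<integral>\<^sup>+x. h x x \<partial>distr (?P \<Otimes>\<^sub>M ?P) ?P ?m)"
    by simp
  also have "\<dots> = (\<integral>\<^sup>+p. h (?m p) (?m p) \<partial>(?P \<Otimes>\<^sub>M ?P))"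
    using measurable_compose[OF measurable_Pair[OF measurable_ident measurable_ident] h]
    by (intro nn_integral_distr m) simp
  also have "\<dots> = (\<integral>\<^sup>+p. (case p of (x, y) \<Rightarrow> h x y) \<partial>(?P \<Otimes>\<^sub>M ?P))"
    by (intro nn_integral_cong) (auto simp: split_def intro!: dep)
  also have "\<dots> = (\<integral>\<^sup>+x. \<integral>\<^sup>+y. h x y \<partial>?P \<partial>?P)"
    by (subst P.nn_integral_fst[symmetric]) auto
  finally show ?thesis .
qed

section \<open>Branching histories as planar shapes driven by the clocks\<close>

text \<open>The event that ends the root edge, in the numbering of \<open>event_rate\<close>: a
  termination is numbered by the order of the branch itself, an offspring by its own order.\<close>

definition node_event :: "nat \<Rightarrow> nat \<Rightarrow> nat" where
  "node_event a b = (if a = b then Suc a else b)"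

text \<open>The event that the clocks produce the planar shape below the path \<open>u\<close>. It
  replaces the inductive relation by a structural recursion over countably many shapes, so that
  measurability and probabilities can be found by induction. The comparison of orders encodes that
  offspring are put on the right.\<close>

primrec follows :: "(nat \<Rightarrow> real) \<Rightarrow> (nat \<Rightarrow> real) \<Rightarrow> unit tree \<Rightarrow> (bool list \<times> nat \<Rightarrow> real) \<Rightarrow> bool list \<Rightarrow> bool" where
  "follows T lam Leaf \<omega> u \<longleftrightarrow> True"
| "follows T lam (Node l x r) \<omega> u \<longleftrightarrow>
    strahler r \<le> strahler l \<and>
    rings_first T lam \<omega> u (strahler (Node l x r)) (node_event (strahler l) (strahler r)) \<and>
    follows T lam l \<omega> (False # u) \<and> follows T lam r \<omega> (True # u)"

primrec clock_tree :: "(nat \<Rightarrow> real) \<Rightarrow> (nat \<Rightarrow> real) \<Rightarrow> unit tree \<Rightarrow> (bool list \<times> nat \<Rightarrow> real) \<Rightarrow> bool list \<Rightarrow> real tree" where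
  "clock_tree T lam Leaf \<omega> u = Leaf"
| "clock_tree T lam (Node l x r) \<omega> u =
    Node (clock_tree T lam l \<omega> (False # u))
      (ring_time T lam \<omega> u (strahler (Node l x r)) (node_event (strahler l) (strahler r)))
      (clock_tree T lam r \<omega> (True # u))"

lemma rings_first_unique: "rings_first T lam \<omega> u j i \<Longrightarrow> rings_first T lam \<omega> u j i' \<Longrightarrow> i = i'"
  unfolding rings_first_def by (metis DiffI order_less_asym singletonD)

lemma branching_history_imp:
  "branching_history T lam \<omega> u j t \<Longrightarrow> 1 \<le> j \<and> (\<exists>s. strahler s = j \<and> follows T lam s \<omega> u \<and> t = clock_tree T lam s \<omega> u)"
proof (induction rule: branching_history.induct)
  case (stop u)
  then show ?case by (intro conjI exI[of _ "Node Leaf () Leaf"]) (auto simp: node_event_def)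
next
  case (split j u l r)
  then obtain sl sr where "strahler sl = j - 1" "follows T lam sl \<omega> (False # u)" "l = clock_tree T lam sl \<omega> (False # u)"
    "strahler sr = j - 1" "follows T lam sr \<omega> (True # u)" "r = clock_tree T lam sr \<omega> (True # u)"
    by blast
  with split.hyps show ?case by (intro conjI exI[of _ "Node sl () sr"]) (auto simp: node_event_def)
next
  case (offspring i j u l r)
  then obtain sl sr where "strahler sl = j" "follows T lam sl \<omega> (False # u)" "l = clock_tree T lam sl \<omega> (False # u)"
    "strahler sr = i" "follows T lam sr \<omega> (True # u)" "r = clock_tree T lam sr \<omega> (True # u)"
    by blast
  with offspring.hyps show ?case by (intro conjI exI[of _ "Node sl () sr"]) (auto simp: node_event_def)
qed

lemma follows_imp_branching_history:
  "s \<noteq> Leaf \<Longrightarrow> follows T lam s \<omega> u \<Longrightarrow> branching_history T lam \<omega> u (strahler s) (clock_tree T lam s \<omega> u)"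
proof (induction s arbitrary: u)
  case (Node l x r)
  let ?a = "strahler l" and ?b = "strahler r"
  from Node.prems have ab: "?b \<le> ?a" and rf: "rings_first T lam \<omega> u (strahler (Node l x r)) (node_event ?a ?b)"
    and f: "follows T lam l \<omega> (False # u)" "follows T lam r \<omega> (True # u)" by auto
  show ?case
  proof (cases "?b = ?a")
    case True
    show ?thesis
    proof (cases "l = Leaf")
      case True
      with \<open>?b = ?a\<close> rf show ?thesis using branching_history.stop[of T lam \<omega> u] by (auto simp: node_event_def)
    next
      case False
      with True have "r \<noteq> Leaf" by auto
      with False True f Node.IH[of "False # u"] Node.IH(2)[of "True # u"] rf show ?thesis
        using branching_history.split[of "Suc ?a" T lam \<omega> u]
        by (auto simp: node_event_def Suc_le_eq simp del: neq0_conv simp: neq0_conv[symmetric])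
    qed
  next
    case False
    with rf have "1 \<le> ?b" by (auto simp: node_event_def rings_first_def)
    then have "l \<noteq> Leaf" "r \<noteq> Leaf" using ab by auto
    with False ab f Node.IH(1)[of "False # u"] Node.IH(2)[of "True # u"] rf show ?thesis
      using branching_history.offspring[of ?b ?a T lam \<omega> u]
      by (auto simp: node_event_def max_def)
  qed
qed simp

text \<open>The order of a branch and the event that rings first fix the orders of both parts, so
  the shape is determined from the root downwards. Hence different shapes of one order correspond to
  disjoint events.\<close>

lemma follows_unique:
  "follows T lam s \<omega> u \<Longrightarrow> follows T lam s' \<omega> u \<Longrightarrow> strahler s = strahler s' \<Longrightarrow> s = s'"
proof (induction s arbitrary: s' u)
  case (Node l x r)
  from Node.prems(3) obtain l' y r' where s': "s' = Node l' y r'" by (cases s') (auto split: if_splits)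
  let ?j = "strahler (Node l x r)"
  have e: "node_event (strahler l) (strahler r) = node_event (strahler l') (strahler r')"
    using Node.prems unfolding s' by (intro rings_first_unique[of T lam \<omega> u ?j]) auto
  have "strahler l = strahler l' \<and> strahler r = strahler r'"
    using e Node.prems unfolding s' by (auto simp: node_event_def max_def split: if_splits)
  then show ?case using Node.IH(1)[of "False # u" l'] Node.IH(2)[of "True # u" r'] Node.prems unfolding s' by auto
qed simp

lemma history_tree_follows:
  assumes "follows T lam s \<omega> []" "strahler s = K" "1 \<le> K"
  shows "history_tree T lam (K, \<omega>) = forget_embedding (clock_tree T lam s \<omega> [])"
proof -
  have "branching_history T lam \<omega> [] K t \<longleftrightarrow> t = clock_tree T lam s \<omega> []" for t
    using follows_imp_branching_history[of s T lam \<omega> "[]"] branching_history_imp[of T lam \<omega> "[]" K t] assms follows_unique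
    by (metis not_one_le_zero strahler_eq_0_iff(1))
  then have "branching_history T lam \<omega> [] K = (\<lambda>t. t = clock_tree T lam s \<omega> [])" by blast
  then show ?thesis by (simp add: history_tree_def)
qed

lemma history_tree_no_history:
  assumes "\<And>s. strahler s = K \<Longrightarrow> \<not> follows T lam s \<omega> []"
  shows "history_tree T lam (K, \<omega>) = empty_tree"
  using assms branching_history_imp by (fastforce simp: history_tree_def)

abbreviation clocks :: "(bool list \<times> nat \<Rightarrow> real) measure" where
  "clocks \<equiv> PiM UNIV (\<lambda>_. exponential 1)"

lemma sets_clocks: "sets clocks = sets (PiM UNIV (\<lambda>_. borel))"
  by (intro sets_PiM_cong) auto

lemma measurable_ring_time [measurable]: "(\<lambda>\<omega>. ring_time T lam \<omega> u j i) \<in> borel_measurable clocks"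
  unfolding ring_time_def by (simp add: measurable_cong_sets[OF sets_clocks refl])

lemma measurable_rings_first [measurable]: "Measurable.pred clocks (\<lambda>\<omega>. rings_first T lam \<omega> u j i)"
  unfolding rings_first_def by measurable

lemma measurable_follows [measurable]: "Measurable.pred clocks (\<lambda>\<omega>. follows T lam s \<omega> u)"
  by (induction s arbitrary: u) simp_all

lemma measurable_clock_tree [measurable]: "(\<lambda>\<omega>. clock_tree T lam s \<omega> u) \<in> clocks \<rightarrow>\<^sub>M tree_sigma borel"
  by (induction s arbitrary: u) simp_all

lemma rings_first_cong:
  "(\<And>i. \<omega> (u, i) = \<omega>' (u, i)) \<Longrightarrow> rings_first T lam \<omega> u j i = rings_first T lam \<omega>' u j i"
  "(\<And>i. \<omega> (u, i) = \<omega>' (u, i)) \<Longrightarrow> ring_time T lam \<omega> u j i = ring_time T lam \<omega>' u j i"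
  by (auto simp: rings_first_def ring_time_def)

text \<open>Paths list the last step first, so the edges at or below \<open>u\<close> are those with
  paths of the form \<open>v @ u\<close>.\<close>

lemma follows_cong:
  "(\<And>v i. \<omega> (v @ u, i) = \<omega>' (v @ u, i)) \<Longrightarrow> follows T lam s \<omega> u = follows T lam s \<omega>' u"
  "(\<And>v i. \<omega> (v @ u, i) = \<omega>' (v @ u, i)) \<Longrightarrow> clock_tree T lam s \<omega> u = clock_tree T lam s \<omega>' u"
proof (induction s arbitrary: u)
  case (Node l x r)
  {
    case 1
    have sub: "\<omega> (v @ b # u, i) = \<omega>' (v @ b # u, i)" for v b i
      using 1[of "v @ [b]" i] by simp
    have root: "\<omega> (u, i) = \<omega>' (u, i)" for i
      using 1[of "[]" i] by simp
    show ?case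
      using Node.IH(1)[of "False # u"] Node.IH(3)[of "True # u"] sub rings_first_cong(1)[of \<omega> u \<omega>'] root by simp
  next
    case 2
    have sub: "\<omega> (v @ b # u, i) = \<omega>' (v @ b # u, i)" for v b i
      using 2[of "v @ [b]" i] by simp
    have root: "\<omega> (u, i) = \<omega>' (u, i)" for i
      using 2[of "[]" i] by simp
    show ?case
      using Node.IH(2)[of "False # u"] Node.IH(4)[of "True # u"] sub rings_first_cong(2)[of \<omega> u \<omega>'] root by simp
  }
qed simp_all

section \<open>Competition of exponential clocks\<close>

lemma nn_integral_clocks_component:
  assumes [measurable]: "f \<in> borel_measurable borel"
  shows "(\<integral>\<^sup>+\<omega>. f (\<omega> v) \<partial>clocks) = (\<integral>\<^sup>+x. f x \<partial>exponential 1)"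
proof -
  interpret product_prob_space "\<lambda>_::bool list \<times> nat. exponential 1" UNIV
    by (rule product_prob_spaceI) (simp add: prob_space_exponential)
  have "(\<integral>\<^sup>+x. f x \<partial>exponential 1) = (\<integral>\<^sup>+x. f x \<partial>distr clocks (exponential 1) (\<lambda>\<omega>. \<omega> v))"
    using PiM_component[of v] by simp
  also have "\<dots> = (\<integral>\<^sup>+\<omega>. f (\<omega> v) \<partial>clocks)"
    by (intro nn_integral_distr) simp_all
  finally show ?thesis ..
qed

text \<open>The winner of the competition is independent of the winning time, which has the sum of
  the rates as its rate. Given that clock \<open>i\<close> rings at \<open>x\<close>, the others
  ring later with probability exp (- (total rate - own rate) x), and this factor turns the density
  of clock \<open>i\<close> into a multiple of the density with the total rate.\<close>

lemma nn_integral_rings_first: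
  assumes i: "i \<in> {1..j}" and r: "\<And>k. 0 \<le> event_rate T lam j k" and pos: "0 < (\<Sum>k\<in>{1..j}. event_rate T lam j k)"
    and f [measurable]: "f \<in> borel_measurable borel"
  shows "(\<integral>\<^sup>+\<omega>. (if rings_first T lam \<omega> u j i then f (ring_time T lam \<omega> u j i) else 0) \<partial>clocks) =
    ennreal (event_rate T lam j i / (\<Sum>k\<in>{1..j}. event_rate T lam j k)) *
      (\<integral>\<^sup>+x. f x \<partial>exponential (\<Sum>k\<in>{1..j}. event_rate T lam j k))"
proof (cases "event_rate T lam j i = 0")
  case True
  then show ?thesis by (simp add: rings_first_def)
next
  case False
  let ?r = "event_rate T lam j" and ?b = "\<Sum>k\<in>{1..j}. event_rate T lam j k"
  have ri: "0 < ?r i" using False r[of i] by simp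
  \<comment> \<open>Events of rate 0 have no clock and do not compete; in the total rate they
    contribute 0.\<close>
  define L where "L = {k \<in> {1..j} - {i}. 0 < ?r k}"
  interpret product_prob_space "\<lambda>_::bool list \<times> nat. exponential 1" UNIV
    by (rule product_prob_spaceI) (simp add: prob_space_exponential)
  let ?h = "\<lambda>x y. if \<forall>k\<in>L. x (u, i) / ?r i < y (u, k) / ?r k then f (x (u, i) / ?r i) else 0"
  have coord: "(\<lambda>\<omega>. \<omega> v) \<in> borel_measurable clocks" for v
    by (simp add: measurable_cong_sets[OF sets_clocks refl])
  have fin: "finite L" by (simp add: L_def)
  define g where "g x = f x * ennreal (exp (- (?b - ?r i) * x))" for x
  have [measurable]: "g \<in> borel_measurable borel" unfolding g_def by measurable
  define h where "h z = (\<integral>\<^sup>+y. (if \<forall>k\<in>L. z / ?r i < y (u, k) / ?r k then f (z / ?r i) else 0) \<partial>clocks)" for z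
  have pos1: "AE z in exponential 1. 0 < z" by (rule AE_exponential_pos) simp
  have "(\<integral>\<^sup>+\<omega>. (if rings_first T lam \<omega> u j i then f (ring_time T lam \<omega> u j i) else 0) \<partial>clocks) = (\<integral>\<^sup>+\<omega>. ?h \<omega> \<omega> \<partial>clocks)"
    using i ri by (intro nn_integral_cong) (auto simp: rings_first_def ring_time_def L_def)
  also have "\<dots> = (\<integral>\<^sup>+x. \<integral>\<^sup>+y. ?h x y \<partial>clocks \<partial>clocks)"
  proof (rule nn_integral_PiM_decouple[where J = "{(u, i)}"])
    note [measurable] = coord
    show "(\<lambda>(x, y). ?h x y) \<in> borel_measurable (clocks \<Otimes>\<^sub>M clocks)"
      using fin by measurable
    show "?h x y = ?h x' y'" if "\<And>v. v \<in> UNIV \<Longrightarrow> v \<in> {(u, i)} \<Longrightarrow> x v = x' v" "\<And>v. v \<in> UNIV \<Longrightarrow> v \<notin> {(u, i)} \<Longrightarrow> y v = y' v"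
      for x y x' y' using that by (auto simp: L_def)
  qed (simp add: prob_space_exponential)
  also have "\<dots> = (\<integral>\<^sup>+x. h (x (u, i)) \<partial>clocks)"
    unfolding h_def ..
  also have "\<dots> = (\<integral>\<^sup>+z. h z \<partial>exponential 1)"
  proof (rule nn_integral_clocks_component)
    note [measurable] = coord
    show "h \<in> borel_measurable borel"
      unfolding h_def using fin by measurable
  qed
  also have "\<dots> = (\<integral>\<^sup>+z. g (1 / ?r i * z) \<partial>exponential 1)"
  proof (rule nn_integral_cong_AE, rule AE_mp[OF pos1], rule AE_I2, rule impI)
    fix z :: real assume z: "0 < z"
    let ?x = "z / ?r i"
    have "(\<integral>\<^sup>+y. (if \<forall>k\<in>L. ?x < y (u, k) / ?r k then f ?x else 0) \<partial>clocks) =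
        (\<integral>\<^sup>+y. f ?x * indicator {y \<in> space clocks. \<forall>v\<in>Pair u ` L. y v \<in> {?r (snd v) * ?x<..}} y \<partial>clocks)"
      by (intro nn_integral_cong) (auto simp: L_def pos_less_divide_eq mult.commute split: split_indicator)
    also have "\<dots> = f ?x * emeasure clocks {y \<in> space clocks. \<forall>v\<in>Pair u ` L. y v \<in> {?r (snd v) * ?x<..}}"
      using fin coord by (intro nn_integral_cmult_indicator) measurable
    also have "emeasure clocks {y \<in> space clocks. \<forall>v\<in>Pair u ` L. y v \<in> {?r (snd v) * ?x<..}} =
        (\<Prod>v\<in>Pair u ` L. emeasure (exponential 1) {?r (snd v) * ?x<..})"
      using fin by (intro emeasure_PiM_Collect) auto
    also have "\<dots> = (\<Prod>k\<in>L. ennreal (exp (- (?r k * ?x))))"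
      using z ri by (subst prod.reindex) (auto simp: inj_on_def emeasure_exponential_gt L_def intro!: prod.cong)
    also have "\<dots> = ennreal (exp (\<Sum>k\<in>L. - (?r k * ?x)))"
      by (subst prod_ennreal) (simp_all add: exp_sum[OF fin])
    also have "(\<Sum>k\<in>L. - (?r k * ?x)) = - (\<Sum>k\<in>L. ?r k) * ?x"
      by (simp add: sum_negf sum_distrib_right sum_divide_distrib)
    also have "(\<Sum>k\<in>L. ?r k) = (\<Sum>k\<in>{1..j} - {i}. ?r k)"
      using r by (intro sum.mono_neutral_left) (auto simp: L_def order.order_iff_strict)
    also have "\<dots> = ?b - ?r i" using i by (simp add: sum_diff1)
    finally show "h z = g (1 / ?r i * z)"
      by (simp add: h_def g_def ring_distribs)
  qed
  also have "\<dots> = (\<integral>\<^sup>+x. g x \<partial>exponential (1 / (1 / ?r i)))"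
    using ri by (intro nn_integral_exponential_scale) auto
  also have "\<dots> = (\<integral>\<^sup>+x. ennreal (exponential_density (?r i) x) * (f x * ennreal (exp (- (?b - ?r i) * x))) \<partial>lborel)"
    unfolding g_def by (subst nn_integral_exponential) auto
  also have "\<dots> = (\<integral>\<^sup>+x. ennreal (?r i / ?b) * (ennreal (exponential_density ?b x) * f x) \<partial>lborel)"
  proof (intro nn_integral_cong)
    fix x
    let ?D = "ennreal (exponential_density (?r i) x)" and ?e = "ennreal (exp (- (?b - ?r i) * x))"
    have "- x * ?r i + - (?b - ?r i) * x = - x * ?b" by (simp add: left_diff_distrib)
    then have "exp (- x * ?r i) * exp (- (?b - ?r i) * x) = exp (- x * ?b)"
      unfolding exp_add[symmetric] by simp
    then have "exponential_density (?r i) x * exp (- (?b - ?r i) * x) = ?r i / ?b * exponential_density ?b x"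
      using pos by (simp add: exponential_density_def mult.assoc)
    then have "?D * ?e = ennreal (?r i / ?b * exponential_density ?b x)"
      using exponential_density_nonneg[OF ri, of x] by (simp add: ennreal_mult[symmetric])
    also have "\<dots> = ennreal (?r i / ?b) * ennreal (exponential_density ?b x)"
      using pos ri exponential_density_nonneg[OF pos, of x] by (intro ennreal_mult) auto
    finally have *: "?D * ?e = ennreal (?r i / ?b) * ennreal (exponential_density ?b x)" .
    have "?D * (f x * ?e) = ?D * ?e * f x" by (simp only: mult_ac)
    then show "?D * (f x * ?e) = ennreal (?r i / ?b) * (ennreal (exponential_density ?b x) * f x)"
      unfolding * by (simp only: mult.assoc)
  qed
  also have "\<dots> = ennreal (?r i / ?b) * (\<integral>\<^sup>+x. f x \<partial>exponential ?b)"
    by (simp add: nn_integral_cmult nn_integral_exponential)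
  finally show ?thesis .
qed

text \<open>The factor \<open>\<gamma> * c\<close> is the total rate, and what remains is the
  probability recorded in \<open>split_weight\<close>.\<close>

lemma event_rate_tok:
  assumes "0 < \<gamma>" "1 \<le> c" "1 \<le> i" "i \<le> j"
  shows "event_rate (tok_T c) (tok_lam c \<gamma>) j i = \<gamma> * c * (if i = j then 1 / c ^ (j - 1) else (c - 1) / c ^ i)"
proof -
  have lam: "tok_lam c \<gamma> n = \<gamma> * c\<^sup>2 / c ^ n" for n
    using assms by (simp add: tok_lam_def power_int_diff)
  show ?thesis
  proof (cases "i = j")
    case True
    with assms show ?thesis
      by (cases j) (auto simp: event_rate_def lam power2_eq_square field_simps)
  next
    case False
    with assms(4) obtain k where j: "j = Suc (i + k)" by (metis less_imp_Suc_add order.not_eq_order_implies_strict)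
    show ?thesis unfolding j
      using assms by (simp add: event_rate_def lam tok_T_def power2_eq_square power_add field_simps)
  qed
qed

lemma event_rate_tok_sum:
  assumes "0 < \<gamma>" "1 \<le> c" "1 \<le> j"
  shows "(\<Sum>i\<in>{1..j}. event_rate (tok_T c) (tok_lam c \<gamma>) j i) = \<gamma> * c"
proof -
  have "(\<Sum>i\<in>{1..j}. event_rate (tok_T c) (tok_lam c \<gamma>) j i) =
      event_rate (tok_T c) (tok_lam c \<gamma>) j j + (\<Sum>i\<in>{1..<j}. event_rate (tok_T c) (tok_lam c \<gamma>) j i)"
  proof -
    have "{1..j} = insert j {1..<j}" using assms(3) by auto
    then show ?thesis by simp
  qed
  also have "\<dots> = \<gamma> * c * (1 / c ^ (j - 1)) + (\<Sum>i\<in>{1..<j}. \<gamma> * c * ((c - 1) / c ^ i))"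
    using assms by (intro arg_cong2[where f = "(+)"] sum.cong) (auto simp: event_rate_tok)
  also have "\<dots> = \<gamma> * c * (1 / c ^ (j - 1) + (\<Sum>i\<in>{1..<j}. (c - 1) / c ^ i))"
    by (simp add: distrib_left sum_distrib_left)
  finally show ?thesis using split_weights_sum_real[OF assms(2,3)] by simp
qed

text \<open>The probability of a shape and the law of the lengths given the shape in one formula.
  The clocks of the root edge, of the left part and of the right part form disjoint families, so
  decoupling twice leaves one competition of clocks and two instances of the induction
  hypothesis.\<close>

lemma nn_integral_follows:
  assumes g: "0 < \<gamma>" and c: "1 \<le> c" and f: "f \<in> borel_measurable (tree_sigma borel)"
  shows "(\<integral>\<^sup>+\<omega>. (if follows (tok_T c) (tok_lam c \<gamma>) s \<omega> u then f (clock_tree (tok_T c) (tok_lam c \<gamma>) s \<omega> u) else 0) \<partial>clocks) =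
    tree_weight c s * (\<integral>\<^sup>+t. f t \<partial>edge_law (\<gamma> * c) s)"
  using f
proof (induction s arbitrary: f u)
  case Leaf
  have "prob_space clocks" by (intro prob_space_PiM prob_space_exponential) simp
  then show ?case using Leaf by (simp add: prob_space.emeasure_space_1)
next
  case (Node l x r)
  note [measurable] = Node.prems
  let ?T = "tok_T c" and ?lam = "tok_lam c \<gamma>" and ?b = "\<gamma> * c"
  have b: "0 < ?b" using g c by simp
  note [measurable (raw)] = borel_measurable_edge_law_integral[OF b]
  let ?fo = "follows ?T ?lam" and ?ct = "clock_tree ?T ?lam" and ?rf = "rings_first ?T ?lam" and ?rt = "ring_time ?T ?lam"
  let ?a = "strahler l" and ?d = "strahler r"
  let ?j = "strahler (Node l x r)" and ?i = "node_event ?a ?d"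
  have rate: "0 \<le> event_rate ?T ?lam j k" for j k
    using g c by (auto simp: event_rate_def tok_T_def tok_lam_def)
  show ?case
  proof (cases "?d \<le> ?a \<and> ?i \<in> {1..?j}")
    \<comment> \<open>Such a shape cannot arise from any history, and its weight is 0 as
      well.\<close>
    case False
    then have "split_weight c ?a ?d = 0"
      by (auto simp: split_weight_def node_event_def split: if_splits)
    moreover have "\<not> ?fo (Node l x r) \<omega> u" for \<omega>
      using False by (auto simp: rings_first_def)
    ultimately show ?thesis by (simp del: follows.simps)
  next
    case True
    have j: "1 \<le> ?j" using True unfolding atLeastAtMost_iff by (elim conjE) (rule le_trans)
    let ?F = "\<lambda>y. \<integral>\<^sup>+L. \<integral>\<^sup>+R. f (Node L y R) \<partial>edge_law ?b r \<partial>edge_law ?b l"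
    have probs: "prob_space ((\<lambda>_. exponential 1) i)" for i :: "bool list \<times> nat"
      by (simp add: prob_space_exponential)
    have sub: "(\<integral>\<^sup>+\<omega>. (if ?fo l \<omega> (False # u) \<and> ?fo r \<omega> (True # u) then f (Node (?ct l \<omega> (False # u)) y (?ct r \<omega> (True # u))) else 0) \<partial>clocks) =
        tree_weight c l * tree_weight c r * ?F y" for y
    proof -
      let ?h = "\<lambda>p q. if ?fo l p (False # u) \<and> ?fo r q (True # u) then f (Node (?ct l p (False # u)) y (?ct r q (True # u))) else 0"
      have "(\<integral>\<^sup>+\<omega>. ?h \<omega> \<omega> \<partial>clocks) = (\<integral>\<^sup>+p. \<integral>\<^sup>+q. ?h p q \<partial>clocks \<partial>clocks)"
      proof (rule nn_integral_PiM_decouple[where J = "{(v, i). \<exists>w. v = w @ False # u}"])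
        show "(\<lambda>(p, q). ?h p q) \<in> borel_measurable (clocks \<Otimes>\<^sub>M clocks)" by measurable
        fix p q p' q' :: "bool list \<times> nat \<Rightarrow> real"
        assume p: "\<And>i. i \<in> UNIV \<Longrightarrow> i \<in> {(v, i). \<exists>w. v = w @ False # u} \<Longrightarrow> p i = p' i"
          and q: "\<And>i. i \<in> UNIV \<Longrightarrow> i \<notin> {(v, i). \<exists>w. v = w @ False # u} \<Longrightarrow> q i = q' i"
        have "p (v @ False # u, i) = p' (v @ False # u, i)" for v i by (rule p) auto
        moreover have "q (v @ True # u, i) = q' (v @ True # u, i)" for v i
        proof (rule q)
          have "v @ True # u \<noteq> w @ False # u" for w
          proof
            assume "v @ True # u = w @ False # u"
            then have "(v @ [True]) @ u = (w @ [False]) @ u" by simp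
            then show False by (simp only: append_same_eq) simp
          qed
          then show "(v @ True # u, i) \<notin> {(v, i). \<exists>w. v = w @ False # u}" by auto
        qed simp
        ultimately show "?h p q = ?h p' q'"
          using follows_cong[of p "False # u" p' ?T ?lam l] follows_cong[of q "True # u" q' ?T ?lam r] by simp
      qed (rule probs)
      also have "\<dots> = (\<integral>\<^sup>+p. (if ?fo l p (False # u) then tree_weight c r * (\<integral>\<^sup>+R. f (Node (?ct l p (False # u)) y R) \<partial>edge_law ?b r) else 0) \<partial>clocks)"
      proof (rule nn_integral_cong)
        fix p
        show "(\<integral>\<^sup>+q. ?h p q \<partial>clocks) = (if ?fo l p (False # u) then tree_weight c r * (\<integral>\<^sup>+R. f (Node (?ct l p (False # u)) y R) \<partial>edge_law ?b r) else 0)"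
          using Node.IH(2)[of "\<lambda>R. f (Node (?ct l p (False # u)) y R)" "True # u"]
          by (cases "?fo l p (False # u)") simp_all
      qed
      also have "\<dots> = tree_weight c l * (\<integral>\<^sup>+L. tree_weight c r * (\<integral>\<^sup>+R. f (Node L y R) \<partial>edge_law ?b r) \<partial>edge_law ?b l)"
        by (rule Node.IH(1)) measurable
      also have "\<dots> = tree_weight c l * tree_weight c r * ?F y"
        by (subst nn_integral_cmult) (measurable, simp add: mult.assoc)
      finally show ?thesis .
    qed
    let ?h = "\<lambda>p q. if ?rf p u ?j ?i then (if ?fo l q (False # u) \<and> ?fo r q (True # u) then f (Node (?ct l q (False # u)) (?rt p u ?j ?i) (?ct r q (True # u))) else 0) else 0"
    have "(\<integral>\<^sup>+\<omega>. (if ?fo (Node l x r) \<omega> u then f (?ct (Node l x r) \<omega> u) else 0) \<partial>clocks) = (\<integral>\<^sup>+\<omega>. ?h \<omega> \<omega> \<partial>clocks)"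
      using True by (intro nn_integral_cong) (simp del: strahler.simps)
    also have "\<dots> = (\<integral>\<^sup>+p. \<integral>\<^sup>+q. ?h p q \<partial>clocks \<partial>clocks)"
    proof (rule nn_integral_PiM_decouple[where J = "{(v, i). v = u}"])
      show "(\<lambda>(p, q). ?h p q) \<in> borel_measurable (clocks \<Otimes>\<^sub>M clocks)" by measurable
      fix p q p' q' :: "bool list \<times> nat \<Rightarrow> real"
      assume p: "\<And>i. i \<in> UNIV \<Longrightarrow> i \<in> {(v, i). v = u} \<Longrightarrow> p i = p' i"
        and q: "\<And>i. i \<in> UNIV \<Longrightarrow> i \<notin> {(v, i). v = u} \<Longrightarrow> q i = q' i"
      have "p (u, i) = p' (u, i)" for i by (rule p) auto
      moreover have "q (v @ z # u, i) = q' (v @ z # u, i)" for v z i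
        by (rule q) (auto dest: arg_cong[of _ _ length])
      ultimately show "?h p q = ?h p' q'"
        using follows_cong[of q "False # u" q' ?T ?lam l] follows_cong[of q "True # u" q' ?T ?lam r] rings_first_cong[of p u p' ?T ?lam]
        by (simp del: strahler.simps)
    qed (rule probs)
    also have "\<dots> = (\<integral>\<^sup>+p. (if ?rf p u ?j ?i then tree_weight c l * tree_weight c r * ?F (?rt p u ?j ?i) else 0) \<partial>clocks)"
    proof (rule nn_integral_cong)
      fix p
      show "(\<integral>\<^sup>+q. ?h p q \<partial>clocks) = (if ?rf p u ?j ?i then tree_weight c l * tree_weight c r * ?F (?rt p u ?j ?i) else 0)"
        using sub[of "?rt p u ?j ?i"] by (cases "?rf p u ?j ?i") (simp_all del: strahler.simps)
    qed
    also have "\<dots> = ennreal (event_rate ?T ?lam ?j ?i / ?b) * (\<integral>\<^sup>+y. tree_weight c l * tree_weight c r * ?F y \<partial>exponential ?b)"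
      unfolding event_rate_tok_sum[OF g c j, symmetric]
      using True rate event_rate_tok_sum[OF g c j] b by (intro nn_integral_rings_first) measurable
    also have "event_rate ?T ?lam ?j ?i / ?b = split_weight c ?a ?d"
    proof (cases "?a = ?d")
      case True
      then show ?thesis using g c by (simp add: event_rate_tok node_event_def split_weight_def)
    next
      case False
      with \<open>?d \<le> ?a \<and> ?i \<in> {1..?j}\<close> have "1 \<le> ?d" "?d < ?a" by (auto simp: node_event_def)
      then show ?thesis using g c by (simp add: event_rate_tok node_event_def split_weight_def)
    qed
    also have "(\<integral>\<^sup>+y. tree_weight c l * tree_weight c r * ?F y \<partial>exponential ?b) =
        tree_weight c l * tree_weight c r * (\<integral>\<^sup>+t. f t \<partial>edge_law ?b (Node l x r))"
      by (subst nn_integral_cmult, measurable, simp add: nn_integral_edge_law_Node[OF b])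
    finally show ?thesis by (simp add: mult.assoc)
  qed
qed


section \<open>The law of the critical Tokunaga process\<close>

lemma measurable_forget_embedding [measurable]: "forget_embedding \<in> tree_sigma borel \<rightarrow>\<^sub>M tree_space"
  by (rule measurableI) (auto simp: sets_tree_space)

text \<open>The universal property of the quotient sigma-algebra: measurability may be checked on
  planar representatives.\<close>

lemma measurable_tree_spaceI:
  assumes "(\<lambda>t. f (forget_embedding t)) \<in> tree_sigma borel \<rightarrow>\<^sub>M N"
  shows "f \<in> tree_space \<rightarrow>\<^sub>M N"
proof (rule measurableI)
  fix t :: "real utree"
  obtain s where "t = forget_embedding s" by (induction t rule: utree.abs_induct) auto
  then show "f t \<in> space N" using measurable_space[OF assms, of s] by simp
next
  fix A assume "A \<in> sets N"
  from measurable_sets[OF assms this] show "f -` A \<inter> space tree_space \<in> sets tree_space"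
    by (simp add: sets_tree_space vimage_def)
qed

lemma measurable_history_tree:
  assumes "1 \<le> K"
  shows "(\<lambda>\<omega>. history_tree T lam (K, \<omega>)) \<in> clocks \<rightarrow>\<^sub>M tree_space"
proof (rule measurableI)
  fix A assume A [measurable]: "A \<in> sets tree_space"
  have "history_tree T lam (K, \<omega>) \<in> A \<longleftrightarrow>
      (\<exists>s. strahler s = K \<and> follows T lam s \<omega> [] \<and> forget_embedding (clock_tree T lam s \<omega> []) \<in> A) \<or>
      ((\<forall>s. strahler s = K \<longrightarrow> \<not> follows T lam s \<omega> []) \<and> empty_tree \<in> A)" for \<omega>
  proof (cases "\<exists>s. strahler s = K \<and> follows T lam s \<omega> []")
    case True
    then obtain s where s: "strahler s = K" "follows T lam s \<omega> []" by blast
    have "s' = s" if "strahler s' = K" "follows T lam s' \<omega> []" for s'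
      using that s follows_unique[of T lam s' \<omega> "[]" s] by simp
    with s show ?thesis unfolding history_tree_follows[OF s(2,1) assms] by blast
  next
    case False
    then show ?thesis using history_tree_no_history[of K T lam \<omega>] by auto
  qed
  then have "(\<lambda>\<omega>. history_tree T lam (K, \<omega>)) -` A \<inter> space clocks = {\<omega> \<in> space clocks.
      (\<exists>s. strahler s = K \<and> follows T lam s \<omega> [] \<and> forget_embedding (clock_tree T lam s \<omega> []) \<in> A) \<or>
      ((\<forall>s. strahler s = K \<longrightarrow> \<not> follows T lam s \<omega> []) \<and> empty_tree \<in> A)}"
    by auto
  also have "\<dots> \<in> sets clocks" by measurable
  finally show "(\<lambda>\<omega>. history_tree T lam (K, \<omega>)) -` A \<inter> space clocks \<in> sets clocks" .
qed simp

text \<open>The disjoint events of following a given shape have total probability 1 by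
  \<open>order_law_1\<close>. So a finite history exists almost surely, and the dummy value of
  \<open>history_tree\<close> does not contribute.\<close>

lemma nn_integral_history_tree:
  assumes g: "0 < \<gamma>" and c: "1 \<le> c" and K: "1 \<le> K" and f [measurable]: "f \<in> borel_measurable tree_space"
  shows "(\<integral>\<^sup>+\<omega>. f (history_tree (tok_T c) (tok_lam c \<gamma>) (K, \<omega>)) \<partial>clocks) = order_law c (\<gamma> * c) K (\<lambda>t. f (forget_embedding t))"
proof -
  let ?fo = "follows (tok_T c) (tok_lam c \<gamma>)" and ?ct = "clock_tree (tok_T c) (tok_lam c \<gamma>)"
  \<comment> \<open>At most one term of this sum is nonzero, the one for the shape that the clocks
    follow.\<close>
  let ?S = "\<lambda>h \<omega>. \<integral>\<^sup>+s. (if strahler s = K then (if ?fo s \<omega> [] then h (?ct s \<omega> []) else 0) else 0) \<partial>count_space UNIV"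
  have b: "0 < \<gamma> * c" using g c by simp
  interpret clocks: prob_space clocks by (intro prob_space_PiM prob_space_exponential) simp
  have int: "(\<integral>\<^sup>+\<omega>. ?S h \<omega> \<partial>clocks) = order_law c (\<gamma> * c) K h" if [measurable]: "h \<in> borel_measurable (tree_sigma borel)" for h
  proof -
    have "(\<integral>\<^sup>+\<omega>. ?S h \<omega> \<partial>clocks) =
      (\<integral>\<^sup>+s. (\<integral>\<^sup>+\<omega>. (if strahler s = K then (if ?fo s \<omega> [] then h (?ct s \<omega> []) else 0) else 0) \<partial>clocks) \<partial>count_space UNIV)"
      by (intro nn_integral_tree_swap[symmetric] clocks.sigma_finite_measure_axioms) measurable
    also have "\<dots> = order_law c (\<gamma> * c) K h"
      unfolding order_law_def order_sum_def
    proof (intro nn_integral_cong)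
      fix s :: "unit tree"
      show "(\<integral>\<^sup>+\<omega>. (if strahler s = K then (if ?fo s \<omega> [] then h (?ct s \<omega> []) else 0) else 0) \<partial>clocks) =
          (if strahler s = K then tree_weight c s * (\<integral>\<^sup>+t. h t \<partial>edge_law (\<gamma> * c) s) else 0)"
        using nn_integral_follows[OF g c that, of s "[]"] by (cases "strahler s = K") simp_all
    qed
    finally show ?thesis .
  qed
  have S: "?S h \<omega> = h (?ct s \<omega> [])" if s: "strahler s = K" "?fo s \<omega> []" for h \<omega> s
  proof -
    have "?S h \<omega> = (\<integral>\<^sup>+s'. h (?ct s \<omega> []) * indicator {s} s' \<partial>count_space UNIV)"
    proof (intro nn_integral_cong)
      fix s'
      have "s' = s" if "strahler s' = K" "?fo s' \<omega> []"
        using that s follows_unique[of "tok_T c" "tok_lam c \<gamma>" s' \<omega> "[]" s] by simp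
      then show "(if strahler s' = K then (if ?fo s' \<omega> [] then h (?ct s' \<omega> []) else 0) else 0) = h (?ct s \<omega> []) * indicator {s} s'"
        using s by (cases "s' = s") auto
    qed
    then show ?thesis by (simp add: one_ennreal_def[symmetric])
  qed
  let ?ex = "\<lambda>\<omega>. \<exists>s. strahler s = K \<and> ?fo s \<omega> []"
  have "emeasure clocks {\<omega> \<in> space clocks. ?ex \<omega>} = (\<integral>\<^sup>+\<omega>. indicator {\<omega> \<in> space clocks. ?ex \<omega>} \<omega> \<partial>clocks)"
    by (intro nn_integral_indicator[symmetric]) measurable
  also have "\<dots> = (\<integral>\<^sup>+\<omega>. ?S (\<lambda>_. 1) \<omega> \<partial>clocks)"
  proof (rule nn_integral_cong)
    fix \<omega> assume "\<omega> \<in> space clocks"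
    show "indicator {\<omega> \<in> space clocks. ?ex \<omega>} \<omega> = ?S (\<lambda>_. 1) \<omega>"
    proof (cases "?ex \<omega>")
      case True
      then obtain s where s: "strahler s = K" "?fo s \<omega> []" by blast
      show ?thesis using S[OF s, of "\<lambda>_. 1"] True \<open>\<omega> \<in> space clocks\<close> by (simp add: indicator_def)
    next
      case False
      then have "?S (\<lambda>_. 1) \<omega> = (\<integral>\<^sup>+s. 0 \<partial>count_space (UNIV :: unit tree set))"
        by (intro nn_integral_cong) auto
      with False show ?thesis by simp
    qed
  qed
  also have "\<dots> = 1" using int[of "\<lambda>_. 1"] by (simp add: order_law_1[OF c b])
  finally have "AE \<omega> in clocks. ?ex \<omega>"
    using clocks.AE_prob_1[of "{\<omega> \<in> space clocks. ?ex \<omega>}"] by (simp add: measure_def)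
  then have "(\<integral>\<^sup>+\<omega>. f (history_tree (tok_T c) (tok_lam c \<gamma>) (K, \<omega>)) \<partial>clocks) = (\<integral>\<^sup>+\<omega>. ?S (\<lambda>t. f (forget_embedding t)) \<omega> \<partial>clocks)"
  proof (intro nn_integral_cong_AE, eventually_elim)
    case (elim \<omega>)
    then obtain s where s: "strahler s = K" "?fo s \<omega> []" by blast
    show ?case using S[OF s, of "\<lambda>t. f (forget_embedding t)"] history_tree_follows[OF s(2,1) K] by simp
  qed
  then show ?thesis using int[of "\<lambda>t. f (forget_embedding t)"] by simp
qed

lemma nn_integral_tok_law:
  assumes g: "0 < \<gamma>" and c: "1 \<le> c" and f [measurable]: "f \<in> borel_measurable tree_space"
  shows "(\<integral>\<^sup>+t. f t \<partial>tok_law c \<gamma>) =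
    (\<integral>\<^sup>+K. ennreal (1 / 2 ^ K) * order_law c (\<gamma> * c) K (\<lambda>t. f (forget_embedding t)) \<partial>count_space {1..})"
proof -
  let ?D = "density (count_space {1..}) (\<lambda>K. ennreal (tok_p K))" and ?h = "history_tree (tok_T c) (tok_lam c \<gamma>)"
  interpret clocks: prob_space clocks by (intro prob_space_PiM prob_space_exponential) simp
  have h: "?h \<in> count_space {1..} \<Otimes>\<^sub>M clocks \<rightarrow>\<^sub>M tree_space"
    by (rule measurable_pair_measure_countable1) (auto intro: measurable_history_tree)
  have sets: "sets (?D \<Otimes>\<^sub>M clocks) = sets (count_space {1..} \<Otimes>\<^sub>M clocks)"
    by (intro sets_pair_measure_cong) auto
  have h': "?h \<in> ?D \<Otimes>\<^sub>M clocks \<rightarrow>\<^sub>M tree_space"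
    using h measurable_cong_sets[OF sets refl] by blast
  have "(\<integral>\<^sup>+t. f t \<partial>tok_law c \<gamma>) = (\<integral>\<^sup>+p. f (?h p) \<partial>(?D \<Otimes>\<^sub>M clocks))"
    unfolding tok_law_def hbp_law_def hbp_sample_space_def by (intro nn_integral_distr h') simp
  also have "\<dots> = (\<integral>\<^sup>+K. \<integral>\<^sup>+\<omega>. f (?h (K, \<omega>)) \<partial>clocks \<partial>?D)"
    by (rule clocks.nn_integral_fst[OF measurable_compose[OF h' f], symmetric])
  also have "\<dots> = (\<integral>\<^sup>+K. ennreal (tok_p K) * (\<integral>\<^sup>+\<omega>. f (?h (K, \<omega>)) \<partial>clocks) \<partial>count_space {1..})"
    by (intro nn_integral_density) auto
  also have "\<dots> = (\<integral>\<^sup>+K. ennreal (1 / 2 ^ K) * order_law c (\<gamma> * c) K (\<lambda>t. f (forget_embedding t)) \<partial>count_space {1..})"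
    by (intro nn_integral_cong) (simp add: nn_integral_history_tree[OF g c] tok_p_def)
  finally show ?thesis .
qed

lemma measurable_shape [measurable]: "shape \<in> tree_space \<rightarrow>\<^sub>M count_space UNIV"
proof (rule measurable_tree_spaceI)
  show "(\<lambda>t :: real tree. shape (forget_embedding t)) \<in> tree_sigma borel \<rightarrow>\<^sub>M count_space UNIV"
    unfolding shape_forget using measurable_comp[OF measurable_skeleton, of forget_embedding "count_space UNIV"]
    by (simp add: o_def)
qed

lemma forget_embedding_eq_empty_iff [simp]: "forget_embedding t = empty_tree \<longleftrightarrow> t = Leaf"
  using same_up_to_swaps_Leaf_iff[of t Leaf]
  by (auto simp: empty_tree.abs_eq utree.abs_eq_iff intro: same_up_to_swaps.intros)

lemma shape_eq_empty_iff [simp]: "shape t = empty_tree \<longleftrightarrow> t = empty_tree"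
proof -
  obtain s where "t = forget_embedding s" by (induction t rule: utree.abs_induct) auto
  then show ?thesis by (cases s) (simp_all add: shape_forget)
qed

text \<open>The order read off from the shape alone. This gives the measurability of
  \<open>order\<close> and relates conditioning on the order to conditioning on the shape.\<close>

definition shape_order :: "unit utree \<Rightarrow> nat" where
  "shape_order \<tau> = (LEAST k. (prune_shape ^^ k) \<tau> = empty_tree)"

lemma order_eq_shape_order: "order t = shape_order (shape t)"
proof -
  have "shape ((prune_metric ^^ k) t) = (prune_shape ^^ k) (shape t)" for k
    by (induction k) (auto simp: shape_prune)
  then show ?thesis unfolding order_def shape_order_def by (metis shape_eq_empty_iff)
qed

lemma measurable_order [measurable]: "order \<in> tree_space \<rightarrow>\<^sub>M count_space UNIV"
  unfolding order_eq_shape_order[abs_def] by (rule measurable_compose[OF measurable_shape]) simp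

lemma sets_order [measurable]: "{t. order t = K} \<in> sets tree_space"
  using measurable_sets[OF measurable_order, of "{K}"] by (simp add: vimage_def)

lemma sets_shape [measurable]: "{t. shape t = \<tau>} \<in> sets tree_space"
  using measurable_sets[OF measurable_shape, of "{\<tau>}"] by (simp add: vimage_def)

section \<open>Conditioning the law on the order and on the shape\<close>

text \<open>Of the branching process only its integral formula is retained; the edge rate
  \<open>b\<close> stands for \<open>\<gamma> * c\<close>.\<close>

locale tokunaga_law =
  fixes c b :: real and M :: "real utree measure"
  assumes c: "1 \<le> c" and b: "0 < b" and sets_M [measurable_cong]: "sets M = sets tree_space"
    and nn_integral_M: "\<And>f. f \<in> borel_measurable tree_space \<Longrightarrow> (\<integral>\<^sup>+t. f t \<partial>M) =
      (\<integral>\<^sup>+K. ennreal (1 / 2 ^ K) * order_law c b K (\<lambda>t. f (forget_embedding t)) \<partial>count_space {1..})"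
begin

lemma space_M [simp]: "space M = UNIV"
  using sets_eq_imp_space_eq[OF sets_M] by simp

lemma sum_p: "(\<integral>\<^sup>+K. ennreal (1 / 2 ^ K) \<partial>count_space {1..}) = 1"
proof -
  have "(\<integral>\<^sup>+K. ennreal (1 / 2 ^ K) \<partial>count_space {1..}) = (\<integral>\<^sup>+K. ennreal (1 / 2 ^ Suc K) \<partial>count_space UNIV)"
    by (intro nn_integral_bij_count_space[symmetric] bij_betwI[of _ _ _ "\<lambda>k. k - 1"]) auto
  also have "\<dots> = (\<Sum>K. ennreal (1 / 2 ^ Suc K))" by (rule nn_integral_count_space_nat)
  also have "\<dots> = ennreal (\<Sum>K. 1 / 2 ^ Suc K)"
    using power_half_series by (intro suminf_ennreal2) (auto simp: sums_iff power_divide)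
  also have "(\<Sum>K. 1 / 2 ^ Suc K) = (1 :: real)"
    using power_half_series by (simp add: sums_iff power_divide)
  finally show ?thesis unfolding ennreal_1 .
qed

lemma prob_space_M: "prob_space M"
proof
  have "emeasure M (space M) = (\<integral>\<^sup>+t. 1 \<partial>M)" by simp
  also have "\<dots> = 1" by (subst nn_integral_M) (simp_all add: order_law_1[OF c b] sum_p del: One_nat_def)
  finally show "emeasure M (space M) = 1" .
qed

lemma nn_integral_order:
  assumes [measurable]: "f \<in> borel_measurable tree_space" and K: "1 \<le> K"
  shows "(\<integral>\<^sup>+t. f t * indicator {t. order t = K} t \<partial>M) = ennreal (1 / 2 ^ K) * order_law c b K (\<lambda>t. f (forget_embedding t))"
proof -
  have "(\<integral>\<^sup>+t. f t * indicator {t. order t = K} t \<partial>M) = (\<integral>\<^sup>+k. ennreal (1 / 2 ^ k) *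
      order_law c b k (\<lambda>t. f (forget_embedding t) * indicator {t. order t = K} (forget_embedding t)) \<partial>count_space {1..})"
    by (intro nn_integral_M) measurable
  also have "\<dots> = (\<integral>\<^sup>+k. ennreal (1 / 2 ^ K) * order_law c b K (\<lambda>t. f (forget_embedding t)) * indicator {K} k \<partial>count_space {1..})"
  proof (intro nn_integral_cong)
    fix k :: nat assume "k \<in> space (count_space {1..})"
    have "order_law c b k (\<lambda>t. f (forget_embedding t) * indicator {t. order t = K} (forget_embedding t)) =
        order_law c b k (\<lambda>t. if k = K then f (forget_embedding t) else 0)"
      by (intro order_law_cong[OF b]) (auto simp: order_forget)
    also have "\<dots> = (if k = K then order_law c b K (\<lambda>t. f (forget_embedding t)) else 0)"
      using order_law_const[OF c b, of k 0] by auto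
    finally show "ennreal (1 / 2 ^ k) * order_law c b k (\<lambda>t. f (forget_embedding t) * indicator {t. order t = K} (forget_embedding t)) =
        ennreal (1 / 2 ^ K) * order_law c b K (\<lambda>t. f (forget_embedding t)) * indicator {K} k"
      by (auto split: split_indicator)
  qed
  also have "\<dots> = ennreal (1 / 2 ^ K) * order_law c b K (\<lambda>t. f (forget_embedding t))"
    using K by (simp add: nn_integral_cmult_indicator)
  finally show ?thesis .
qed

lemma emeasure_order: "1 \<le> K \<Longrightarrow> emeasure M {t. order t = K} = ennreal (1 / 2 ^ K)"
  using nn_integral_order[of "\<lambda>_. 1" K] by (simp add: order_law_1[OF c b] sets_M sets_order)

lemma nn_integral_given_order:
  assumes [measurable]: "f \<in> borel_measurable tree_space" and K: "1 \<le> K"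
  shows "(\<integral>\<^sup>+t. f t \<partial>given_order M K) = order_law c b K (\<lambda>t. f (forget_embedding t))"
proof -
  have "(\<integral>\<^sup>+t. f t \<partial>given_order M K) = (\<integral>\<^sup>+t. f t * indicator {t. order t = K} t \<partial>M) / emeasure M {t. order t = K}"
    unfolding given_order_def by (subst nn_integral_uniform_measure)
      (simp_all add: measurable_cong_sets[OF sets_M refl] sets_M sets_order)
  also have "\<dots> = order_law c b K (\<lambda>t. f (forget_embedding t))"
    unfolding nn_integral_order[OF assms] emeasure_order[OF K]
    by (subst mult.commute, rule ennreal_mult_divide_eq) simp_all
  finally show ?thesis .
qed

lemma AE_M:
  assumes "\<And>t. reduced t \<Longrightarrow> positive_tree t \<Longrightarrow> t \<noteq> Leaf \<Longrightarrow> P (forget_embedding t)" and [measurable]: "Measurable.pred tree_space P"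
  shows "AE t in M. P t"
proof -
  have "(\<integral>\<^sup>+t. indicator {t. \<not> P t} t \<partial>M) = (\<integral>\<^sup>+K. ennreal (1 / 2 ^ K) * order_law c b K (\<lambda>t. indicator {t. \<not> P t} (forget_embedding t)) \<partial>count_space {1..})"
    by (intro nn_integral_M) measurable
  also have "\<dots> = (\<integral>\<^sup>+K. 0 \<partial>count_space {1::nat..})"
  proof (intro nn_integral_cong)
    fix K :: nat assume K: "K \<in> space (count_space {1..})"
    have "order_law c b K (\<lambda>t. indicator {t. \<not> P t} (forget_embedding t)) = order_sum c K (\<lambda>_. 0)"
      unfolding order_law_def
    proof (rule order_sum_cong)
      fix s :: "unit tree" assume s: "strahler s = K" "tree_weight c s \<noteq> 0"
      have "(\<integral>\<^sup>+t. indicator {t. \<not> P t} (forget_embedding t) \<partial>edge_law b s) = (\<integral>\<^sup>+t. 0 \<partial>edge_law b s)"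
      proof (rule nn_integral_cong_AE, rule AE_mp[OF AE_edge_law[OF b]], rule AE_I2, rule impI)
        fix t :: "real tree" assume t: "skeleton t = s \<and> positive_tree t"
        have "reduced (map_tree h t) \<Longrightarrow> reduced t" for h :: "real \<Rightarrow> unit"
          by (induction t) auto
        then have "reduced t" using t tree_weight_reduced[OF s(2)] by blast
        moreover have "t \<noteq> Leaf" using t s(1) K by auto
        ultimately show "indicator {t. \<not> P t} (forget_embedding t) = (0 :: ennreal)"
          using t assms(1) by auto
      qed
      then show "(\<integral>\<^sup>+t. indicator {t. \<not> P t} (forget_embedding t) \<partial>edge_law b s) = 0" by simp
    qed
    then show "ennreal (1 / 2 ^ K) * order_law c b K (\<lambda>t. indicator {t. \<not> P t} (forget_embedding t)) = 0"
      by (simp add: order_sum_def cong: if_cong)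
  qed
  finally have "(\<integral>\<^sup>+t. indicator {t. \<not> P t} t \<partial>M) = 0" by simp
  moreover have "indicator {t. \<not> P t} \<in> borel_measurable M" by measurable
  ultimately have "AE t in M. indicator {t. \<not> P t} t = (0 :: ennreal)"
    using nn_integral_0_iff_AE by blast
  then show ?thesis by (rule eventually_mono) (auto simp: indicator_def split: if_splits)
qed

text \<open>All planar shapes in one swap class contribute the same integral over the lengths, so it
  factors out and the weights of the class add up to the probability of the unembedded
  shape.\<close>

lemma nn_integral_shape:
  assumes [measurable]: "f \<in> borel_measurable tree_space"
  shows "(\<integral>\<^sup>+t. f t * indicator {t. shape t = forget_embedding s} t \<partial>M) =
    (\<integral>\<^sup>+t. f (forget_embedding t) \<partial>edge_law b s) * emeasure M {t. shape t = forget_embedding s}"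
proof -
  let ?\<tau> = "forget_embedding s" and ?X = "\<integral>\<^sup>+t. f (forget_embedding t) \<partial>edge_law b s"
  have edge: "(\<integral>\<^sup>+t. g (forget_embedding t) * indicator {t. shape t = ?\<tau>} (forget_embedding t) \<partial>edge_law b s') =
      (\<integral>\<^sup>+t. g (forget_embedding t) \<partial>edge_law b s) * indicator {s'. forget_embedding s' = ?\<tau>} s'"
    if [measurable]: "g \<in> borel_measurable tree_space" for g s'
  proof -
    have "(\<integral>\<^sup>+t. g (forget_embedding t) * indicator {t. shape t = ?\<tau>} (forget_embedding t) \<partial>edge_law b s') =
        (\<integral>\<^sup>+t. g (forget_embedding t) * indicator {s'. forget_embedding s' = ?\<tau>} s' \<partial>edge_law b s')"
      by (rule nn_integral_cong_AE, rule AE_mp[OF AE_edge_law[OF b]], rule AE_I2)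
        (auto simp: shape_forget split: split_indicator)
    also have "\<dots> = (\<integral>\<^sup>+t. g (forget_embedding t) \<partial>edge_law b s') * indicator {s'. forget_embedding s' = ?\<tau>} s'"
      by (simp add: nn_integral_multc)
    also have "\<dots> = (\<integral>\<^sup>+t. g (forget_embedding t) \<partial>edge_law b s) * indicator {s'. forget_embedding s' = ?\<tau>} s'"
    proof (cases "forget_embedding s' = ?\<tau>")
      case True
      then have "same_up_to_swaps s' s" by (simp add: utree.abs_eq_iff)
      then have "(\<integral>\<^sup>+t. g (forget_embedding t) \<partial>edge_law b s') = (\<integral>\<^sup>+t. g (forget_embedding t) \<partial>edge_law b s)"
        by (rule nn_integral_edge_law_cong_swaps[OF _ b]) (measurable, simp add: utree.abs_eq_iff[THEN iffD2])
      then show ?thesis by simp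
    qed simp
    finally show ?thesis .
  qed
  have *: "(\<integral>\<^sup>+t. g t * indicator {t. shape t = ?\<tau>} t \<partial>M) = (\<integral>\<^sup>+t. g (forget_embedding t) \<partial>edge_law b s) *
      (\<integral>\<^sup>+K. ennreal (1 / 2 ^ K) * order_sum c K (indicator {s'. forget_embedding s' = ?\<tau>}) \<partial>count_space {1..})"
    if [measurable]: "g \<in> borel_measurable tree_space" for g
  proof -
    have "(\<integral>\<^sup>+t. g t * indicator {t. shape t = ?\<tau>} t \<partial>M) = (\<integral>\<^sup>+K. ennreal (1 / 2 ^ K) *
      order_law c b K (\<lambda>t. g (forget_embedding t) * indicator {t. shape t = ?\<tau>} (forget_embedding t)) \<partial>count_space {1..})"
      by (intro nn_integral_M) measurable
    also have "\<dots> = (\<integral>\<^sup>+K. (\<integral>\<^sup>+t. g (forget_embedding t) \<partial>edge_law b s) * (ennreal (1 / 2 ^ K) *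
      order_sum c K (indicator {s'. forget_embedding s' = ?\<tau>})) \<partial>count_space {1..})"
      unfolding order_law_def edge[OF that] order_sum_cmult by (simp add: mult_ac)
    finally show ?thesis by (simp add: nn_integral_cmult)
  qed
  have "emeasure M {t. shape t = ?\<tau>} = (\<integral>\<^sup>+t. 1 * indicator {t. shape t = ?\<tau>} t \<partial>M)"
    by simp
  also have "\<dots> = (\<integral>\<^sup>+K. ennreal (1 / 2 ^ K) * order_sum c K (indicator {s'. forget_embedding s' = ?\<tau>}) \<partial>count_space {1..})"
    using prob_space.emeasure_space_1[OF prob_space_edge_law[OF b]] by (subst *) simp_all
  finally show ?thesis using *[OF assms] by simp
qed

lemma nn_integral_given_shape:
  assumes [measurable]: "f \<in> borel_measurable tree_space" and pos: "0 < emeasure M {t. shape t = forget_embedding s}"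
  shows "(\<integral>\<^sup>+t. f t \<partial>given_shape M (forget_embedding s)) = (\<integral>\<^sup>+t. f (forget_embedding t) \<partial>edge_law b s)"
proof -
  let ?\<tau> = "forget_embedding s"
  interpret M: prob_space M by (rule prob_space_M)
  have "(\<integral>\<^sup>+t. f t \<partial>given_shape M ?\<tau>) = (\<integral>\<^sup>+t. f t * indicator {t. shape t = ?\<tau>} t \<partial>M) / emeasure M {t. shape t = ?\<tau>}"
    unfolding given_shape_def by (subst nn_integral_uniform_measure)
      (simp_all add: measurable_cong_sets[OF sets_M refl] sets_M sets_shape)
  then show ?thesis
    unfolding nn_integral_shape[OF assms(1)] using pos M.emeasure_finite by (simp add: ennreal_mult_divide_eq)
qed

end

lemma tokunaga_law_tok_law:
  assumes "0 < \<gamma>" "1 \<le> c"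
  shows "tokunaga_law c (\<gamma> * c) (tok_law c \<gamma>)"
proof
  show "sets (tok_law c \<gamma>) = sets tree_space" by (simp add: tok_law_def hbp_law_def)
qed (use assms nn_integral_tok_law in auto)


section \<open>Relative edge lengths and total length\<close>

lemma length_preorder [simp]: "length (preorder t) = size t"
  by (induction t) auto

lemma tree_length_forget: "tree_length (forget_embedding t) = sum_list (preorder t)"
  by (rule tree_length.abs_eq)

lemma num_edges_forget: "num_edges (forget_embedding t) = size t"
  by (rule num_edges.abs_eq)

lemma measurable_tree_length [measurable]: "tree_length \<in> borel_measurable tree_space"
proof (rule measurable_tree_spaceI)
  have "(\<lambda>t. sum_list (preorder t)) = rec_tree 0 (\<lambda>l (x::real) r a b. x + (a + b))"
    by (rule ext) (induct_tac t, auto)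
  also have "\<dots> \<in> borel_measurable (tree_sigma borel)"
    by (rule measurable_rec_tree) measurable
  finally show "(\<lambda>t. tree_length (forget_embedding t)) \<in> borel_measurable (tree_sigma borel)"
    by (simp add: tree_length_forget)
qed

lemma measurable_size_comp:
  assumes "f \<in> M \<rightarrow>\<^sub>M tree_sigma (borel :: real measure)"
  shows "(\<lambda>x. size (f x)) \<in> M \<rightarrow>\<^sub>M count_space UNIV"
  using measurable_compose[OF assms measurable_size_tree] .

text \<open>Induction on the position rather than on the tree: a positive position lies in one of
  the two subtrees at a smaller index. Outside the list the value is unspecified, but on the empty
  tree it is the constant \<open>[] ! i\<close>.\<close>

lemma measurable_preorder_nth:
  "f \<in> M \<rightarrow>\<^sub>M tree_sigma (borel :: real measure) \<Longrightarrow> (\<lambda>x. preorder (f x) ! i) \<in> borel_measurable M"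
proof (induction i arbitrary: f rule: less_induct)
  case (less i)
  note [measurable] = less.prems
  have l [measurable]: "(\<lambda>x. Tree.left (f x)) \<in> M \<rightarrow>\<^sub>M tree_sigma borel"
    and r [measurable]: "(\<lambda>x. Tree.right (f x)) \<in> M \<rightarrow>\<^sub>M tree_sigma borel"
    by (rule measurable_compose[OF less.prems], measurable)+
  have v [measurable]: "(\<lambda>x. case f x of Leaf \<Rightarrow> 0 | Node a y b \<Rightarrow> y) \<in> borel_measurable M"
    by measurable
  have sz: "(\<lambda>x. size (Tree.left (f x))) \<in> M \<rightarrow>\<^sub>M count_space UNIV"
    by (rule measurable_size_comp[OF l])
  show ?case
  proof (cases i)
    case 0
    have "preorder (f x) ! i = (if f x = Leaf then [] ! i else case f x of Leaf \<Rightarrow> 0 | Node a y b \<Rightarrow> y)" for x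
      by (cases "f x") (auto simp: 0)
    then show ?thesis by simp
  next
    case (Suc k)
    have eq: "preorder (f x) ! i = (if f x = Leaf then [] ! i
       else if k < size (Tree.left (f x)) then preorder (Tree.left (f x)) ! k
       else (\<lambda>n. preorder (Tree.right (f x)) ! (k - n)) (size (Tree.left (f x))))" for x
      by (cases "f x") (auto simp: Suc nth_append)
    have [measurable]: "(\<lambda>x. preorder (Tree.left (f x)) ! k) \<in> borel_measurable M"
      using less.IH[OF _ l, of k] Suc by simp
    have "(\<lambda>x. preorder (Tree.right (f x)) ! (k - n)) \<in> borel_measurable M" for n
      using less.IH[OF _ r, of "k - n"] Suc by simp
    from measurable_compose_countable[OF this sz]
    have [measurable]: "(\<lambda>x. (\<lambda>n. preorder (Tree.right (f x)) ! (k - n)) (size (Tree.left (f x)))) \<in> borel_measurable M"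
      by simp
    note [measurable] = sz
    show ?thesis unfolding eq by measurable
  qed
qed

lemma measurable_scale_tree [measurable]: "scale_tree a \<in> tree_space \<rightarrow>\<^sub>M tree_space"
proof (rule measurable_tree_spaceI)
  have "(\<lambda>t. scale_tree a (forget_embedding t)) = (\<lambda>t. forget_embedding (map_tree (\<lambda>x. a * x) t))"
    by (simp add: scale_tree_def map_utree.abs_eq)
  also have "\<dots> \<in> tree_sigma borel \<rightarrow>\<^sub>M tree_space" by measurable
  finally show "(\<lambda>t. scale_tree a (forget_embedding t)) \<in> tree_sigma borel \<rightarrow>\<^sub>M tree_space" .
qed

lemma scale_forget: "scale_tree a (forget_embedding t) = forget_embedding (map_tree (\<lambda>x. a * x) t)"
  by (simp add: scale_tree_def map_utree.abs_eq)

lemma skeleton_map [simp]: "skeleton (map_tree h t) = skeleton t"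
  by (induction t) auto

lemma shape_scale [simp]: "shape (scale_tree a t) = shape t"
  by (induction t rule: utree.abs_induct) (simp add: scale_forget shape_forget)

lemma set_tree_swaps: "same_up_to_swaps s t \<Longrightarrow> set_tree s = set_tree t"
  by (induction rule: same_up_to_swaps.induct) auto

lemma forget_in_metric_trees_iff: "forget_embedding t \<in> metric_trees \<longleftrightarrow> reduced t \<and> positive_tree t"
  unfolding metric_trees_def positive_tree_def
  using reduced_swaps set_tree_swaps by (fastforce simp: utree.abs_eq_iff intro: same_up_to_swaps_refl)

lemma measurable_reduced [measurable]: "Measurable.pred (tree_sigma (borel :: real measure)) reduced"
proof -
  have "reduced = rec_tree True (\<lambda>l (x::real) r a b. (l = Leaf \<longleftrightarrow> r = Leaf) \<and> a \<and> b)"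
    by (rule ext) (induct_tac x, auto)
  also have "Measurable.pred (tree_sigma borel) \<dots>"
    by (rule measurable_rec_tree) measurable
  finally show ?thesis .
qed

lemma measurable_metric_trees [measurable]: "Measurable.pred tree_space (\<lambda>t. t \<in> metric_trees)"
  by (rule measurable_tree_spaceI) (simp add: forget_in_metric_trees_iff)

text \<open>The condition of \<open>cond_length_density\<close> with the conditional law as an
  argument, so that it can be established for explicit laws.\<close>

definition length_density ::
  "(real utree \<Rightarrow> real tree) \<Rightarrow> nat \<Rightarrow> real utree measure \<Rightarrow> ((nat \<Rightarrow> real) \<Rightarrow> real \<Rightarrow> real) \<Rightarrow> bool" where
  "length_density E n L f \<longleftrightarrow>
    (\<lambda>(x, l). f x l) \<in> borel_measurable (vectors n \<Otimes>\<^sub>M lborel) \<and> (\<forall>x l. 0 \<le> f x l) \<and>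
    distr L (vectors n \<Otimes>\<^sub>M lborel) (\<lambda>t. (rel_lengths E n t, tree_length t)) =
    density (distr L (vectors n) (rel_lengths E n) \<Otimes>\<^sub>M lborel) (\<lambda>(x, l). ennreal (f x l))"

lemma cond_length_density_iff:
  "cond_length_density E M \<tau> f \<longleftrightarrow> length_density E (num_edges \<tau>) (given_shape M \<tau>) f"
  by (simp add: cond_length_density_def length_density_def rel_lengths_law_def)

text \<open>A substitution in the length for each fixed vector of relative lengths. It turns the
  condition on densities in the definition of self-similarity into an equality of joint
  laws.\<close>

lemma density_scale_length:
  assumes rho: "prob_space \<rho>" "sets \<rho> = sets (vectors n)" and z: "0 < \<zeta>"
    and f: "(\<lambda>(x, l). f x l) \<in> borel_measurable (vectors n \<Otimes>\<^sub>M lborel)" "\<And>x l. 0 \<le> f x l"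
  shows "density (\<rho> \<Otimes>\<^sub>M lborel) (\<lambda>(x, l). ennreal (f x (l / \<zeta>) / \<zeta>)) =
    distr (density (\<rho> \<Otimes>\<^sub>M lborel) (\<lambda>(x, l). ennreal (f x l))) (vectors n \<Otimes>\<^sub>M lborel) (\<lambda>(x, l). (x, \<zeta> * l))"
proof (rule measure_eqI)
  interpret rho: prob_space \<rho> by fact
  interpret pair_sigma_finite \<rho> lborel ..
  have sets_p: "sets (\<rho> \<Otimes>\<^sub>M lborel) = sets (vectors n \<Otimes>\<^sub>M lborel)"
    by (intro sets_pair_measure_cong rho) simp
  show "sets (density (\<rho> \<Otimes>\<^sub>M lborel) (\<lambda>(x, l). ennreal (f x (l / \<zeta>) / \<zeta>))) =
      sets (distr (density (\<rho> \<Otimes>\<^sub>M lborel) (\<lambda>(x, l). ennreal (f x l))) (vectors n \<Otimes>\<^sub>M lborel) (\<lambda>(x, l). (x, \<zeta> * l)))"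
    using sets_p by simp
  fix A assume "A \<in> sets (density (\<rho> \<Otimes>\<^sub>M lborel) (\<lambda>(x, l). ennreal (f x (l / \<zeta>) / \<zeta>)))"
  then have A [measurable]: "A \<in> sets (\<rho> \<Otimes>\<^sub>M lborel)" by simp
  have A': "A \<in> sets (vectors n \<Otimes>\<^sub>M lborel)"
    using A unfolding sets_p .
  have [measurable]: "(\<lambda>(x, l). f x l) \<in> borel_measurable (\<rho> \<Otimes>\<^sub>M lborel)"
    using f(1) measurable_cong_sets[OF sets_p refl] by blast
  have scale: "(\<lambda>(x, l). (x, \<zeta> * l)) \<in> \<rho> \<Otimes>\<^sub>M lborel \<rightarrow>\<^sub>M \<rho> \<Otimes>\<^sub>M lborel"
    by measurable
  have scale': "(\<lambda>(x, l). (x, \<zeta> * l)) \<in> density (\<rho> \<Otimes>\<^sub>M lborel) (\<lambda>(x, l). ennreal (f x l)) \<rightarrow>\<^sub>M vectors n \<Otimes>\<^sub>M lborel"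
    using scale by (simp only: measurable_cong_sets[OF sets_density sets_p[symmetric]])
  have m1 [measurable]: "(\<lambda>p. indicator A (case p of (x, l) \<Rightarrow> (x, \<zeta> * l)) :: ennreal) \<in> borel_measurable (\<rho> \<Otimes>\<^sub>M lborel)"
    by (rule measurable_compose[OF scale borel_measurable_indicator[OF A]])
  have "(\<lambda>p. case p of (x, l) \<Rightarrow> ennreal (f x l)) \<in> borel_measurable (\<rho> \<Otimes>\<^sub>M lborel)"
    by measurable
  note prod = borel_measurable_times_ennreal[OF this m1]
  have inv: "(\<lambda>(x, l). (x, l / \<zeta>)) \<in> \<rho> \<Otimes>\<^sub>M lborel \<rightarrow>\<^sub>M \<rho> \<Otimes>\<^sub>M lborel"
    by measurable
  have [measurable]: "(\<lambda>(x, l). f x (l / \<zeta>)) \<in> borel_measurable (\<rho> \<Otimes>\<^sub>M lborel)"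
    using measurable_compose[OF inv, of "\<lambda>(x, l). f x l"] by (simp add: split_def)
  have "(\<lambda>p. case p of (x, l) \<Rightarrow> ennreal (f x (l / \<zeta>) / \<zeta>)) \<in> borel_measurable (\<rho> \<Otimes>\<^sub>M lborel)"
    by measurable
  note dens = this and prod' = borel_measurable_times_ennreal[OF this borel_measurable_indicator[OF A]]
  have "emeasure (distr (density (\<rho> \<Otimes>\<^sub>M lborel) (\<lambda>(x, l). ennreal (f x l))) (vectors n \<Otimes>\<^sub>M lborel) (\<lambda>(x, l). (x, \<zeta> * l))) A =
      (\<integral>\<^sup>+p. indicator A p \<partial>distr (density (\<rho> \<Otimes>\<^sub>M lborel) (\<lambda>(x, l). ennreal (f x l))) (vectors n \<Otimes>\<^sub>M lborel) (\<lambda>(x, l). (x, \<zeta> * l)))"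
    by (intro nn_integral_indicator[symmetric]) (simp only: sets_distr A')
  also have "\<dots> = (\<integral>\<^sup>+p. indicator A (case p of (x, l) \<Rightarrow> (x, \<zeta> * l)) \<partial>density (\<rho> \<Otimes>\<^sub>M lborel) (\<lambda>(x, l). ennreal (f x l)))"
    by (intro nn_integral_distr scale') (simp only: measurable_distr_eq1 borel_measurable_indicator A')
  also have "\<dots> = (\<integral>\<^sup>+p. (case p of (x, l) \<Rightarrow> ennreal (f x l)) * indicator A (case p of (x, l) \<Rightarrow> (x, \<zeta> * l)) \<partial>(\<rho> \<Otimes>\<^sub>M lborel))"
    by (intro nn_integral_density) measurable
  also have "\<dots> = (\<integral>\<^sup>+x. \<integral>\<^sup>+l. ennreal (f x l) * indicator A (x, \<zeta> * l) \<partial>lborel \<partial>\<rho>)"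
    by (subst lborel.nn_integral_fst[OF prod, symmetric]) simp
  also have "\<dots> = (\<integral>\<^sup>+x. \<integral>\<^sup>+l. ennreal (f x (l / \<zeta>) / \<zeta>) * indicator A (x, l) \<partial>lborel \<partial>\<rho>)"
  proof (rule nn_integral_cong)
    fix x assume x [measurable]: "x \<in> space \<rho>"
    have [measurable]: "f x \<in> borel_measurable borel"
      using measurable_Pair2[of "\<lambda>(x, l). f x l" \<rho> lborel borel x] x by simp
    have [measurable]: "(\<lambda>l. indicator A (x, l) :: ennreal) \<in> borel_measurable borel"
      using measurable_Pair2[of "indicator A :: _ \<Rightarrow> ennreal" \<rho> lborel borel x] x by simp
    have "(\<integral>\<^sup>+l. ennreal (f x (l / \<zeta>) / \<zeta>) * indicator A (x, l) \<partial>lborel) =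
        ennreal \<bar>\<zeta>\<bar> * (\<integral>\<^sup>+l. ennreal (f x ((0 + \<zeta> * l) / \<zeta>) / \<zeta>) * indicator A (x, 0 + \<zeta> * l) \<partial>lborel)"
      using z by (intro nn_integral_real_affine) auto
    also have "\<dots> = (\<integral>\<^sup>+l. ennreal (f x l) * indicator A (x, \<zeta> * l) \<partial>lborel)"
    proof -
      have *: "ennreal (f x l) = ennreal \<zeta> * ennreal (f x l / \<zeta>)" for l
        using z f(2)[of x l] by (simp add: ennreal_mult[symmetric])
      show ?thesis unfolding * using z by (subst nn_integral_cmult[symmetric]) (auto simp: mult.assoc)
    qed
    finally show "(\<integral>\<^sup>+l. ennreal (f x l) * indicator A (x, \<zeta> * l) \<partial>lborel) =
        (\<integral>\<^sup>+l. ennreal (f x (l / \<zeta>) / \<zeta>) * indicator A (x, l) \<partial>lborel)" ..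
  qed
  also have "\<dots> = (\<integral>\<^sup>+p. (case p of (x, l) \<Rightarrow> ennreal (f x (l / \<zeta>) / \<zeta>)) * indicator A p \<partial>(\<rho> \<Otimes>\<^sub>M lborel))"
    by (subst lborel.nn_integral_fst[OF prod', symmetric]) simp
  also have "\<dots> = emeasure (density (\<rho> \<Otimes>\<^sub>M lborel) (\<lambda>(x, l). ennreal (f x (l / \<zeta>) / \<zeta>))) A"
    by (rule emeasure_density[OF dens A, symmetric])
  finally show "emeasure (density (\<rho> \<Otimes>\<^sub>M lborel) (\<lambda>(x, l). ennreal (f x (l / \<zeta>) / \<zeta>))) A =
      emeasure (distr (density (\<rho> \<Otimes>\<^sub>M lborel) (\<lambda>(x, l). ennreal (f x l))) (vectors n \<Otimes>\<^sub>M lborel) (\<lambda>(x, l). (x, \<zeta> * l))) A" ..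
qed


definition shape_edge_law :: "real \<Rightarrow> unit tree \<Rightarrow> real utree measure" where
  "shape_edge_law b s = distr (edge_law b s) tree_space forget_embedding"

lemma sets_shape_edge_law [measurable_cong, simp]: "sets (shape_edge_law b s) = sets tree_space"
  by (simp add: shape_edge_law_def)

lemma space_shape_edge_law [simp]: "space (shape_edge_law b s) = UNIV"
  by (simp add: shape_edge_law_def)

lemma measurable_forget_edge_law: "forget_embedding \<in> edge_law b s \<rightarrow>\<^sub>M tree_space"
  using measurable_forget_embedding by (simp cong: measurable_cong_sets)

lemma prob_space_shape_edge_law: "0 < b \<Longrightarrow> prob_space (shape_edge_law b s)"
  unfolding shape_edge_law_def
  by (intro prob_space.prob_space_distr prob_space_edge_law measurable_forget_edge_law)

lemma nn_integral_shape_edge_law: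
  "f \<in> borel_measurable tree_space \<Longrightarrow> (\<integral>\<^sup>+t. f t \<partial>shape_edge_law b s) = (\<integral>\<^sup>+t. f (forget_embedding t) \<partial>edge_law b s)"
  unfolding shape_edge_law_def by (intro nn_integral_distr measurable_forget_edge_law) simp

lemma AE_shape_edge_law:
  assumes "0 < b" "reduced s" and [measurable]: "Measurable.pred tree_space P"
    and "\<And>t. reduced t \<Longrightarrow> positive_tree t \<Longrightarrow> skeleton t = s \<Longrightarrow> P (forget_embedding t)"
  shows "AE t in shape_edge_law b s. P t"
proof -
  have "AE t in edge_law b s. P (forget_embedding t)"
  proof (rule AE_mp[OF AE_edge_law[OF assms(1)]], rule AE_I2, rule impI)
    fix t :: "real tree" assume t: "skeleton t = s \<and> positive_tree t"
    have "reduced (map_tree h t) \<Longrightarrow> reduced t" for h :: "real \<Rightarrow> unit"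
      by (induction t) auto
    then show "P (forget_embedding t)" using t assms(2,4) by blast
  qed
  then show ?thesis unfolding shape_edge_law_def
    by (subst AE_distr_iff[OF measurable_forget_edge_law]) measurable
qed

lemma shape_edge_law_scale:
  assumes "0 < a" "0 < b"
  shows "shape_edge_law (b / a) s = distr (shape_edge_law b s) tree_space (scale_tree a)"
proof (rule measure_eqI)
  fix A assume "A \<in> sets (shape_edge_law (b / a) s)"
  then have [measurable]: "A \<in> sets tree_space" by simp
  have "emeasure (distr (shape_edge_law b s) tree_space (scale_tree a)) A =
      (\<integral>\<^sup>+t. indicator A t \<partial>distr (shape_edge_law b s) tree_space (scale_tree a))"
    by simp
  also have "\<dots> = (\<integral>\<^sup>+t. indicator A (forget_embedding (map_tree (\<lambda>x. a * x) t)) \<partial>edge_law b s)"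
    by (subst nn_integral_distr, measurable, subst nn_integral_shape_edge_law, measurable, simp add: scale_forget)
  also have "\<dots> = (\<integral>\<^sup>+t. indicator A (forget_embedding t) \<partial>edge_law (b / a) s)"
    by (rule nn_integral_edge_law_scale[OF assms]) measurable
  also have "\<dots> = (\<integral>\<^sup>+t. indicator A t \<partial>shape_edge_law (b / a) s)"
    by (subst nn_integral_shape_edge_law) measurable
  also have "\<dots> = emeasure (shape_edge_law (b / a) s) A" by simp
  finally show "emeasure (shape_edge_law (b / a) s) A = emeasure (distr (shape_edge_law b s) tree_space (scale_tree a)) A" ..
qed simp

lemma nn_integral_shape_edge_law_eq_0_iff:
  assumes "0 < a" "0 < b" and [measurable]: "f \<in> borel_measurable tree_space"
  shows "(\<integral>\<^sup>+t. f t \<partial>shape_edge_law a s) = 0 \<longleftrightarrow> (\<integral>\<^sup>+t. f t \<partial>shape_edge_law b s) = 0"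
  using nn_integral_edge_law_eq_0_iff[OF assms(1,2), of "\<lambda>t. f (forget_embedding t)" s]
  by (simp add: nn_integral_shape_edge_law)

section \<open>Relative lengths and total length under a proper embedding\<close>

locale planar_embedding =
  fixes E :: "real utree \<Rightarrow> real tree"
  assumes E: "proper_embedding E"
begin

lemma measurable_E [measurable]: "E \<in> tree_space \<rightarrow>\<^sub>M tree_sigma borel"
  using E by (simp add: proper_embedding_def)

lemma size_E: "t \<in> metric_trees \<Longrightarrow> size (E t) = num_edges t"
  using E num_edges_forget[of "E t"] by (simp add: proper_embedding_def)

lemma E_scale: "t \<in> metric_trees \<Longrightarrow> 0 < a \<Longrightarrow> E (scale_tree a t) = map_tree (\<lambda>x. a * x) (E t)"
  using E by (simp add: proper_embedding_def)

lemma measurable_rel_lengths [measurable]: "rel_lengths E n \<in> tree_space \<rightarrow>\<^sub>M vectors n"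
  unfolding rel_lengths_def
proof (rule measurable_restrict)
  fix i assume "i \<in> {..<n}"
  have [measurable]: "(\<lambda>t. preorder (E t) ! i) \<in> borel_measurable tree_space"
    by (rule measurable_preorder_nth) measurable
  show "(\<lambda>t. preorder (E t) ! i / tree_length t) \<in> tree_space \<rightarrow>\<^sub>M borel" by measurable
qed

lemma tree_length_scale: "tree_length (scale_tree a t) = a * tree_length t"
proof (induction t rule: utree.abs_induct)
  case (1 t)
  have "sum_list (preorder (map_tree (\<lambda>x. a * x) t)) = a * sum_list (preorder t)"
    by (induction t) (auto simp: distrib_left)
  then show ?case by (simp add: scale_forget tree_length_forget)
qed

lemma preorder_map: "preorder (map_tree h t) = map h (preorder t)"
  by (induction t) auto

text \<open>Equivariance of the embedding under a change of unit keeps the enumeration of the edges,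
  so the common factor cancels.\<close>

lemma rel_lengths_scale:
  assumes "t \<in> metric_trees" "0 < a"
  shows "rel_lengths E (num_edges t) (scale_tree a t) = rel_lengths E (num_edges t) t"
  unfolding rel_lengths_def E_scale[OF assms] tree_length_scale preorder_map
  using assms size_E[OF assms(1)] by (intro restrict_ext) (simp)

abbreviation lengths :: "nat \<Rightarrow> real utree \<Rightarrow> (nat \<Rightarrow> real) \<times> real" where
  "lengths n t \<equiv> (rel_lengths E n t, tree_length t)"

context
  fixes b :: real and s :: "unit tree"
  assumes b: "0 < b" and s: "reduced s" "s \<noteq> Leaf"
begin

abbreviation (input) "n \<equiv> size s"

lemma AE_good: "AE t in shape_edge_law b s. t \<in> metric_trees \<and> num_edges t = n \<and> 0 < tree_length t"
proof (rule AE_shape_edge_law[OF b s(1)])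
  have eq: "(num_edges :: real utree \<Rightarrow> nat) = (\<lambda>t. num_edges (shape t))"
  proof
    show "num_edges t = num_edges (shape t)" for t :: "real utree"
      by (induction t rule: utree.abs_induct) (simp add: shape_forget num_edges_forget)
  qed
  have [measurable]: "(num_edges :: real utree \<Rightarrow> nat) \<in> tree_space \<rightarrow>\<^sub>M count_space UNIV"
    by (subst eq) (rule measurable_compose[OF measurable_shape], simp)
  show "Measurable.pred tree_space (\<lambda>t. t \<in> metric_trees \<and> num_edges t = n \<and> 0 < tree_length t)"
    by measurable
  fix t :: "real tree" assume t: "reduced t" "positive_tree t" "skeleton t = s"
  have nn: "0 \<le> sum_list (preorder t)" if "positive_tree t" for t
    using that by (induction t) auto
  have "0 < sum_list (preorder t)" if "positive_tree t" "t \<noteq> Leaf"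
    using that nn by (cases t) (auto intro!: add_pos_nonneg)
  moreover have "t \<noteq> Leaf" using t(3) s(2) by auto
  moreover have "size t = n" using t(3) by auto
  ultimately show "forget_embedding t \<in> metric_trees \<and> num_edges (forget_embedding t) = n \<and> 0 < tree_length (forget_embedding t)"
    using t by (simp add: forget_in_metric_trees_iff num_edges_forget tree_length_forget)
qed

lemma measurable_lengths: "lengths n \<in> shape_edge_law b s \<rightarrow>\<^sub>M vectors n \<Otimes>\<^sub>M lborel"
  by measurable

lemma rel_law_scale:
  assumes "0 < a"
  shows "distr (shape_edge_law (b / a) s) (vectors n) (rel_lengths E n) = distr (shape_edge_law b s) (vectors n) (rel_lengths E n)"
proof -
  have "distr (shape_edge_law (b / a) s) (vectors n) (rel_lengths E n) = distr (shape_edge_law b s) (vectors n) (rel_lengths E n \<circ> scale_tree a)"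
    unfolding shape_edge_law_scale[OF assms b] by (rule distr_distr) measurable
  also have "\<dots> = distr (shape_edge_law b s) (vectors n) (rel_lengths E n)"
    by (rule distr_cong_AE[OF refl refl], rule eventually_mono[OF AE_good])
      (use rel_lengths_scale assms in force, (unfold o_def, measurable)+)
  finally show ?thesis .
qed

lemma lengths_law_scale:
  assumes "0 < a"
  shows "distr (shape_edge_law (b / a) s) (vectors n \<Otimes>\<^sub>M lborel) (lengths n) =
    distr (distr (shape_edge_law b s) (vectors n \<Otimes>\<^sub>M lborel) (lengths n)) (vectors n \<Otimes>\<^sub>M lborel) (\<lambda>(x, l). (x, a * l))"
proof -
  have "distr (shape_edge_law (b / a) s) (vectors n \<Otimes>\<^sub>M lborel) (lengths n) =
      distr (shape_edge_law b s) (vectors n \<Otimes>\<^sub>M lborel) (lengths n \<circ> scale_tree a)"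
    unfolding shape_edge_law_scale[OF assms b] by (rule distr_distr) measurable
  also have "\<dots> = distr (shape_edge_law b s) (vectors n \<Otimes>\<^sub>M lborel) ((\<lambda>(x, l). (x, a * l)) \<circ> lengths n)"
    by (rule distr_cong_AE[OF refl refl], rule eventually_mono[OF AE_good])
      (use rel_lengths_scale assms tree_length_scale in force, (unfold o_def, measurable)+)
  also have "\<dots> = distr (distr (shape_edge_law b s) (vectors n \<Otimes>\<^sub>M lborel) (lengths n)) (vectors n \<Otimes>\<^sub>M lborel) (\<lambda>(x, l). (x, a * l))"
    by (rule distr_distr[symmetric]) measurable
  finally show ?thesis .
qed

lemma prob_space_rel_law: "prob_space (distr (shape_edge_law b s) (vectors n) (rel_lengths E n))"
  by (intro prob_space.prob_space_distr prob_space_shape_edge_law b) measurable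

text \<open>
  Exponential laws with different rates have the same null sets, and changing the rate rescales the
  total length without changing the relative lengths.  Averaging over the rate therefore compares
  the joint law with the product of the law of the relative lengths and the Lebesgue measure.
\<close>

lemma lengths_absolutely_continuous:
  "absolutely_continuous (distr (shape_edge_law b s) (vectors n) (rel_lengths E n) \<Otimes>\<^sub>M lborel)
    (distr (shape_edge_law b s) (vectors n \<Otimes>\<^sub>M lborel) (lengths n))"
proof -
  let ?L = "shape_edge_law b s" and ?V = "vectors n \<Otimes>\<^sub>M lborel"
  let ?\<rho> = "distr ?L (vectors n) (rel_lengths E n)"
  interpret L: prob_space ?L by (rule prob_space_shape_edge_law[OF b])
  interpret \<rho>: prob_space ?\<rho> by (rule prob_space_rel_law)
  interpret pair_sigma_finite lborel ?L ..
  have sets_p: "sets (?\<rho> \<Otimes>\<^sub>M lborel) = sets ?V"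
    by (intro sets_pair_measure_cong) simp_all
  have "emeasure (distr ?L ?V (lengths n)) B = 0" if B: "B \<in> sets (?\<rho> \<Otimes>\<^sub>M lborel)" "emeasure (?\<rho> \<Otimes>\<^sub>M lborel) B = 0" for B
  proof -
    have [measurable]: "B \<in> sets ?V" using B(1) sets_p by simp
    have len: "(\<lambda>(t, l). (rel_lengths E n t, l)) \<in> tree_space \<Otimes>\<^sub>M lborel \<rightarrow>\<^sub>M ?V"
      by measurable
    have ind [measurable]: "(\<lambda>(t, l). indicator B (rel_lengths E n t, l) :: ennreal) \<in> borel_measurable (tree_space \<Otimes>\<^sub>M lborel)"
      using measurable_compose[OF len, of "indicator B :: _ \<Rightarrow> ennreal" borel] by (simp add: split_def)
    have "0 = (\<integral>\<^sup>+x. emeasure lborel (Pair x -` B) \<partial>?\<rho>)"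
      using B by (simp add: lborel.emeasure_pair_measure_alt)
    also have "\<dots> = (\<integral>\<^sup>+t. emeasure lborel (Pair (rel_lengths E n t) -` B) \<partial>?L)"
      using lborel.measurable_emeasure_Pair[of B "vectors n"] by (intro nn_integral_distr) simp_all
    also have "\<dots> = (\<integral>\<^sup>+t. \<integral>\<^sup>+l. indicator B (rel_lengths E n t, l) \<partial>lborel \<partial>?L)"
    proof (rule nn_integral_cong)
      fix t
      have "Pair (rel_lengths E n t) -` B \<in> sets lborel"
        by (rule sets_Pair1[OF \<open>B \<in> sets ?V\<close>])
      then have "emeasure lborel (Pair (rel_lengths E n t) -` B) = (\<integral>\<^sup>+l. indicator (Pair (rel_lengths E n t) -` B) l \<partial>lborel)"
        by simp
      then show "emeasure lborel (Pair (rel_lengths E n t) -` B) = (\<integral>\<^sup>+l. indicator B (rel_lengths E n t, l) \<partial>lborel)"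
        by (simp add: indicator_vimage o_def)
    qed
    finally have "(\<integral>\<^sup>+t. \<integral>\<^sup>+l. indicator B (rel_lengths E n t, l) \<partial>lborel \<partial>?L) = 0" ..
    moreover have "(\<lambda>t. \<integral>\<^sup>+l. indicator B (rel_lengths E n t, l) \<partial>lborel) \<in> borel_measurable ?L"
      using lborel.borel_measurable_nn_integral[OF ind] by (simp cong: measurable_cong_sets)
    ultimately have AE0: "AE t in ?L. (\<integral>\<^sup>+l. indicator B (rel_lengths E n t, l) \<partial>lborel) = 0"
      using nn_integral_0_iff_AE by blast
    \<comment> \<open>The mass of \<open>B\<close> after all lengths are multiplied by
      \<open>a\<close>. Integrating over \<open>a\<close> runs through the trees of fixed relative
      lengths, where \<open>B\<close> is null for almost every tree; so \<open>?h\<close> vanishes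
      almost everywhere, in particular at some positive \<open>a\<close>.\<close>
    let ?h = "\<lambda>a. \<integral>\<^sup>+t. indicator B (rel_lengths E n t, a * tree_length t) \<partial>?L"
    have m: "(\<lambda>(a, t). (rel_lengths E n t, a * tree_length t)) \<in> lborel \<Otimes>\<^sub>M ?L \<rightarrow>\<^sub>M ?V"
      by measurable
    have ind2: "(\<lambda>(a, t). indicator B (rel_lengths E n t, a * tree_length t) :: ennreal) \<in> borel_measurable (lborel \<Otimes>\<^sub>M ?L)"
      using measurable_compose[OF m, of "indicator B :: _ \<Rightarrow> ennreal" borel] by (simp add: split_def)
    have "(\<integral>\<^sup>+a. ?h a \<partial>lborel) = (\<integral>\<^sup>+t. \<integral>\<^sup>+a. indicator B (rel_lengths E n t, a * tree_length t) \<partial>lborel \<partial>?L)"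
      using Fubini'[OF ind2] by simp
    also have "\<dots> = (\<integral>\<^sup>+t. 0 \<partial>?L)"
    proof (rule nn_integral_cong_AE, use AE0 AE_good in eventually_elim)
      case (elim t)
      have [measurable]: "(\<lambda>l. indicator B (rel_lengths E n t, l) :: ennreal) \<in> borel_measurable borel"
        using measurable_Pair2[OF ind, of t] by simp
      have "(\<integral>\<^sup>+l. indicator B (rel_lengths E n t, l) \<partial>lborel) =
          ennreal \<bar>tree_length t\<bar> * (\<integral>\<^sup>+a. indicator B (rel_lengths E n t, 0 + tree_length t * a) \<partial>lborel)"
        using elim by (intro nn_integral_real_affine) auto
      with elim show ?case by (simp add: mult.commute)
    qed
    finally have "(\<integral>\<^sup>+a. ?h a \<partial>lborel) = 0" by simp
    moreover have "?h \<in> borel_measurable lborel"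
      using L.borel_measurable_nn_integral[OF ind2] by simp
    ultimately have h0: "AE a in lborel. ?h a = 0"
      using nn_integral_0_iff_AE by blast
    have no: "\<not> (AE a in lborel. \<not> (0 :: real) < a)"
    proof
      assume "AE a in lborel. \<not> (0 :: real) < a"
      then have "AE a in lborel. a \<notin> {0 <..< 1 :: real}"
        by (rule eventually_mono) auto
      then have "{0 <..< 1 :: real} \<in> null_sets lborel"
        by (rule AE_iff_null_sets[THEN iffD2, rotated]) simp
      then have "emeasure lborel {0 <..< 1 :: real} = 0" by (rule null_setsD1)
      then show False by simp
    qed
    have "\<exists>a>0. ?h a = 0"
    proof (rule ccontr)
      assume "\<not> ?thesis"
      then have "\<not> 0 < a" if "?h a = 0" for a using that by blast
      then have "AE a in lborel. \<not> (0 :: real) < a" by (rule eventually_mono[OF h0])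
      with no show False by blast
    qed
    then obtain a where a: "0 < a" "?h a = 0" by blast
    have il [measurable]: "(\<lambda>t. indicator B (lengths n t) :: ennreal) \<in> borel_measurable tree_space"
      by measurable
    have "(\<integral>\<^sup>+t. indicator B (lengths n t) \<partial>shape_edge_law (b / a) s) = (\<integral>\<^sup>+t. indicator B (lengths n (scale_tree a t)) \<partial>?L)"
      unfolding shape_edge_law_scale[OF a(1) b] by (rule nn_integral_distr) measurable
    also have "\<dots> = ?h a"
      by (intro nn_integral_cong_AE eventually_mono[OF AE_good])
        (use rel_lengths_scale a(1) tree_length_scale in force)
    \<comment> \<open>\<open>B\<close> is null for the rate \<open>b / a\<close>, and hence for the
      rate \<open>b\<close>, as the null sets do not depend on the rate.\<close>
    finally have "(\<integral>\<^sup>+t. indicator B (lengths n t) \<partial>?L) = 0"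
      using a b nn_integral_shape_edge_law_eq_0_iff[OF _ b il, of "b / a" s] by simp
    moreover have "emeasure (distr ?L ?V (lengths n)) B = (\<integral>\<^sup>+t. indicator B (lengths n t) \<partial>?L)"
    proof -
      have "emeasure (distr ?L ?V (lengths n)) B = (\<integral>\<^sup>+p. indicator B p \<partial>distr ?L ?V (lengths n))"
        by (intro nn_integral_indicator[symmetric]) (simp only: sets_distr \<open>B \<in> sets ?V\<close>)
      also have "\<dots> = (\<integral>\<^sup>+t. indicator B (lengths n t) \<partial>?L)"
        by (rule nn_integral_distr[OF measurable_lengths]) measurable
      finally show ?thesis .
    qed
    ultimately show ?thesis by simp
  qed
  then show ?thesis
    unfolding absolutely_continuous_def null_sets_def using sets_p by auto
qed

text \<open>A Radon-Nikodym derivative of the joint law. It is finite almost everywhere because the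
  joint law has mass 1, so it can be replaced by a real and everywhere nonnegative function.\<close>

lemma ex_length_density: "\<exists>f. length_density E n (shape_edge_law b s) f"
proof -
  let ?L = "shape_edge_law b s" and ?V = "vectors n \<Otimes>\<^sub>M lborel"
  let ?\<rho> = "distr ?L (vectors n) (rel_lengths E n)" and ?J = "distr ?L ?V (lengths n)"
  interpret L: prob_space ?L by (rule prob_space_shape_edge_law[OF b])
  interpret \<rho>: prob_space ?\<rho> by (rule prob_space_rel_law)
  interpret J: prob_space ?J by (rule L.prob_space_distr[OF measurable_lengths])
  interpret pair_sigma_finite ?\<rho> lborel ..
  have sets_p: "sets (?\<rho> \<Otimes>\<^sub>M lborel) = sets ?V"
    by (intro sets_pair_measure_cong) simp_all
  obtain g where g [measurable]: "g \<in> borel_measurable (?\<rho> \<Otimes>\<^sub>M lborel)" and J: "density (?\<rho> \<Otimes>\<^sub>M lborel) g = ?J"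
    using Radon_Nikodym[OF lengths_absolutely_continuous] sets_p by auto
  have "AE p in ?\<rho> \<Otimes>\<^sub>M lborel. g p \<noteq> \<infinity>"
  proof (rule nn_integral_PInf_AE[OF g])
    have "(\<integral>\<^sup>+p. g p \<partial>(?\<rho> \<Otimes>\<^sub>M lborel)) = emeasure (density (?\<rho> \<Otimes>\<^sub>M lborel) g) (space (?\<rho> \<Otimes>\<^sub>M lborel))"
      by (subst emeasure_density[OF g sets.top]) (auto intro!: nn_integral_cong)
    also have "\<dots> = 1"
    proof -
      have sp: "space (?\<rho> \<Otimes>\<^sub>M lborel) = space ?J"
        using sets_eq_imp_space_eq[OF sets_p] by simp
      show ?thesis unfolding J sp by (rule J.emeasure_space_1)
    qed
    finally show "(\<integral>\<^sup>+p. g p \<partial>(?\<rho> \<Otimes>\<^sub>M lborel)) \<noteq> \<infinity>" by simp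
  qed
  then have "density (?\<rho> \<Otimes>\<^sub>M lborel) g = density (?\<rho> \<Otimes>\<^sub>M lborel) (\<lambda>p. ennreal (enn2real (g p)))"
    by (intro density_cong) (auto elim!: eventually_mono simp: top.not_eq_extremum)
  moreover have "g \<in> borel_measurable ?V" using g measurable_cong_sets[OF sets_p refl] by blast
  ultimately have "length_density E n ?L (\<lambda>x l. enn2real (g (x, l)))"
    unfolding length_density_def J[symmetric] by (auto simp: split_beta')
  then show ?thesis by blast
qed

end

end


section \<open>Coordination\<close>

lemma complete_subtrees_below_cong:
  "(q = K \<longleftrightarrow> q' = K) \<Longrightarrow> complete_subtrees_below K q t = complete_subtrees_below K q' t"
  by (cases t) (auto simp: Let_def)

lemma complete_subtrees_below_less:
  "reduced t \<Longrightarrow> strahler t < K \<Longrightarrow> complete_subtrees_below K q t = {#}"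
proof (induction t arbitrary: q)
  case (Node l x r)
  moreover have "strahler l \<le> strahler (Node l x r)" "strahler r \<le> strahler (Node l x r)" by auto
  ultimately show ?case
    using order_forget[of "Node l x r"] by (auto simp: Let_def simp del: strahler.simps)
qed simp

lemma complete_subtrees_below_self:
  "reduced t \<Longrightarrow> strahler t \<le> K \<Longrightarrow> complete_subtrees_below K K t = {#}"
proof (induction t)
  case (Node l x r)
  have le: "strahler l \<le> strahler (Node l x r)" "strahler r \<le> strahler (Node l x r)" by auto
  show ?case
  proof (cases "strahler (Node l x r) = K")
    case True
    with Node le show ?thesis
      using order_forget[of "Node l x r"] by (auto simp: Let_def simp del: strahler.simps)
  next
    case False
    with Node.prems show ?thesis by (intro complete_subtrees_below_less) auto
  qed
qed simp

text \<open>Below the top of a branch of order \<open>K\<close>, further vertices of order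
  \<open>K\<close> lie on the same branch and start no complete subtree. So the test of the parent's
  order selects the same subtrees as stopping at the first vertex of number
  \<open>K\<close>.\<close>

lemma complete_subtrees_below_eq_complete_sum:
  assumes K: "1 \<le> K"
  shows "reduced t \<Longrightarrow> q \<noteq> K \<Longrightarrow> of_nat (size (filter_mset P (complete_subtrees_below K q t))) =
    complete_sum K (\<lambda>t. if P (forget_embedding t) then 1 else 0) t"
proof (induction t arbitrary: q)
  case (Node l x r)
  let ?k = "strahler (Node l x r)"
  have k: "order (forget_embedding (Node l x r)) = ?k" using Node.prems by (intro order_forget) auto
  have le: "strahler l \<le> ?k" "strahler r \<le> ?k" by auto
  have red: "reduced l" "reduced r" using Node.prems by auto
  have rest: "complete_subtrees_below K q (Node l x r) = (if ?k = K then {#forget_embedding (Node l x r)#} else {#}) +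
      complete_subtrees_below K ?k l + complete_subtrees_below K ?k r"
    unfolding complete_subtrees_below.simps Let_def k using Node.prems by simp
  consider "?k < K" | "?k = K" | "K < ?k" by linarith
  then show ?case
  proof cases
    case 1
    then show ?thesis
      using Node.prems by (simp add: complete_subtrees_below_less complete_sum_0 del: strahler.simps complete_subtrees_below.simps)
  next
    case 2
    with le red have "complete_subtrees_below K q (Node l x r) = {#forget_embedding (Node l x r)#}"
      unfolding rest by (simp add: complete_subtrees_below_self del: strahler.simps)
    with 2 show ?thesis
      by (simp add: complete_sum_eq[OF K] del: strahler.simps complete_subtrees_below.simps)
  next
    case 3
    then have ne: "?k \<noteq> K" by simp
    have "complete_sum K h (Node l x r) = complete_sum K h l + complete_sum K h r" for h :: "real tree \<Rightarrow> ennreal"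
      using 3 by (simp del: strahler.simps)
    then show ?thesis
      using ne Node.IH(1)[OF red(1) ne] Node.IH(2)[OF red(2) ne] unfolding rest by (simp del: strahler.simps complete_sum.simps)
  qed
qed simp

section \<open>The random choice of a complete subtree as a kernel\<close>

text \<open>The counting recursion passes the parent's order downwards, which
  \<open>rec_tree\<close> does not do. Only whether it equals \<open>K\<close> matters, so the
  counts for the parent orders 0 and \<open>K\<close> are computed together as a pair.\<close>

lemma measurable_count_complete_subtrees:
  assumes K: "1 \<le> K" and [measurable]: "A \<in> sets tree_space"
  shows "(\<lambda>t. of_nat (size (filter_mset (\<lambda>t. t \<in> A) (complete_subtrees K t))) :: ennreal) \<in> borel_measurable tree_space"
proof (rule measurable_tree_spaceI)
  let ?n = "\<lambda>q t. of_nat (size (filter_mset (\<lambda>t. t \<in> A) (complete_subtrees_below K q t))) :: ennreal"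
  let ?rest = "\<lambda>l x r (a :: ennreal \<times> ennreal) b. if order (forget_embedding (Node l x r)) = K then snd a + snd b else fst a + fst b"
  let ?g = "\<lambda>l (x::real) r a b. ((if order (forget_embedding (Node l x r)) = K \<and> forget_embedding (Node l x r) \<in> A then 1 else 0) + ?rest l x r a b,
      ?rest l x r a b)"
  have eq: "(?n 0 t, ?n K t) = rec_tree (0, 0) ?g t" for t
  proof (induction t)
    case (Node l x r)
    let ?k = "order (forget_embedding (Node l x r))"
    have "?n ?k l = (if ?k = K then ?n K l else ?n 0 l)" "?n ?k r = (if ?k = K then ?n K r else ?n 0 r)"
      using K complete_subtrees_below_cong[of ?k K 0 l] complete_subtrees_below_cong[of ?k K 0 r] by auto
    moreover have "rec_tree (0, 0) ?g (Node l x r) = ?g l x r (?n 0 l, ?n K l) (?n 0 r, ?n K r)"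
      using Node by simp
    ultimately show ?case using K by (auto simp: Let_def)
  qed simp
  have "(\<lambda>t. fst (rec_tree (0, 0) ?g t)) \<in> borel_measurable (tree_sigma borel)"
  proof (rule measurable_compose[where g = fst and N = "borel \<Otimes>\<^sub>M borel"])
    show "rec_tree (0, 0) ?g \<in> tree_sigma borel \<rightarrow>\<^sub>M borel \<Otimes>\<^sub>M borel"
      by (rule measurable_rec_tree) measurable
  qed measurable
  then have "?n 0 \<in> borel_measurable (tree_sigma borel)"
    by (simp add: eq[symmetric])
  then show "(\<lambda>t. of_nat (size (filter_mset (\<lambda>t. t \<in> A) (complete_subtrees K (forget_embedding t)))) :: ennreal) \<in> borel_measurable (tree_sigma borel)"
    by (simp add: complete_subtrees.abs_eq)
qed

abbreviation chosen_subtree :: "nat \<Rightarrow> real utree \<Rightarrow> real utree measure" where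
  "chosen_subtree K t \<equiv> distr (measure_pmf (pmf_of_multiset (complete_subtrees K t))) tree_space (\<lambda>s. s)"

lemma emeasure_chosen_subtree:
  assumes "complete_subtrees K t \<noteq> {#}" "A \<in> sets tree_space"
  shows "emeasure (chosen_subtree K t) A =
    of_nat (size (filter_mset (\<lambda>t. t \<in> A) (complete_subtrees K t))) / of_nat (size (complete_subtrees K t))"
proof -
  let ?m = "complete_subtrees K t"
  have "emeasure (chosen_subtree K t) A = emeasure (measure_pmf (pmf_of_multiset ?m)) A"
    using assms(2) by (subst emeasure_distr) auto
  also have "\<dots> = ennreal (measure_pmf.prob (pmf_of_multiset ?m) A)"
    by (rule measure_pmf.emeasure_eq_measure)
  also have "measure_pmf.prob (pmf_of_multiset ?m) A = (\<Sum>x\<in>A \<inter> set_mset ?m. pmf (pmf_of_multiset ?m) x)"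
  proof -
    have "measure_pmf.prob (pmf_of_multiset ?m) A = measure_pmf.prob (pmf_of_multiset ?m) (A \<inter> set_mset ?m)"
      using measure_Int_set_pmf[of "pmf_of_multiset ?m" A] assms(1) by simp
    then show ?thesis by (simp add: measure_measure_pmf_finite)
  qed
  also have "\<dots> = real (size (filter_mset (\<lambda>t. t \<in> A) ?m)) / real (size ?m)"
  proof -
    have "size (filter_mset (\<lambda>t. t \<in> A) ?m) = (\<Sum>x\<in>A \<inter> set_mset ?m. count ?m x)"
      unfolding size_multiset_overloaded_eq by (intro sum.cong) auto
    then show ?thesis using assms(1) by (simp add: sum_divide_distrib)
  qed
  also have "ennreal \<dots> = of_nat (size (filter_mset (\<lambda>t. t \<in> A) ?m)) / of_nat (size ?m)"
    using assms(1) by (simp add: divide_ennreal[symmetric] ennreal_of_nat_eq_real_of_nat nonempty_has_size)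
  finally show ?thesis .
qed

text \<open>For a tree without complete subtrees of order \<open>K\<close> the choice is made from
  an empty multiset. The result is unspecified but the same for all such trees, so the kernel is
  constant on this measurable set.\<close>

lemma measurable_chosen_subtree:
  assumes K: "1 \<le> K"
  shows "chosen_subtree K \<in> tree_space \<rightarrow>\<^sub>M subprob_algebra tree_space"
proof (rule measurable_subprob_algebra)
  fix t
  interpret prob_space "chosen_subtree K t"
    by (rule prob_space.prob_space_distr[OF measure_pmf.prob_space_axioms]) simp
  show "subprob_space (chosen_subtree K t)"
    using prob_space_axioms by (rule prob_space_imp_subprob_space)
next
  fix A assume A [measurable]: "A \<in> sets tree_space"
  let ?n = "\<lambda>A t. of_nat (size (filter_mset (\<lambda>t. t \<in> A) (complete_subtrees K t))) :: ennreal"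
  have [measurable]: "?n A \<in> borel_measurable tree_space" "?n UNIV \<in> borel_measurable tree_space"
    using K by (intro measurable_count_complete_subtrees; simp add: sets.top[of tree_space, simplified])+
  have "emeasure (chosen_subtree K t) A = (if ?n UNIV t = 0 then emeasure (distr (measure_pmf (pmf_of_multiset {#})) tree_space (\<lambda>s. s)) A
      else ?n A t / ?n UNIV t)" for t
    using emeasure_chosen_subtree[OF _ A, of K t] by (cases "complete_subtrees K t = {#}") auto
  then have eq: "(\<lambda>t. emeasure (chosen_subtree K t) A) = (\<lambda>t. if ?n UNIV t = 0
      then emeasure (distr (measure_pmf (pmf_of_multiset {#})) tree_space (\<lambda>s. s)) A else ?n A t / ?n UNIV t)"
    by blast
  show "(\<lambda>t. emeasure (chosen_subtree K t) A) \<in> borel_measurable tree_space"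
    unfolding eq by measurable
qed simp

context tokunaga_law
begin

lemma sets_given_order [measurable_cong, simp]: "sets (given_order M K) = sets tree_space"
  by (simp add: given_order_def sets_M)

lemma space_given_order [simp]: "space (given_order M K) = UNIV"
  using sets_eq_imp_space_eq[OF sets_given_order] by simp

text \<open>The metric laws themselves agree, which contains all clauses of coordination.
  Integrating out the lengths reduces the choice of a subtree to an average over shapes, where
  \<open>order_sum_complete_average\<close> applies.\<close>

lemma random_complete_subtree_eq:
  assumes K: "1 \<le> K" and KH: "K \<le> H"
  shows "random_complete_subtree M H K = given_order M K"
proof (rule measure_eqI)
  have kernel: "chosen_subtree K \<in> given_order M H \<rightarrow>\<^sub>M subprob_algebra tree_space"
    using measurable_chosen_subtree[OF K] by (simp cong: measurable_cong_sets)
  show "sets (random_complete_subtree M H K) = sets (given_order M K)"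
    unfolding random_complete_subtree_def by (subst sets_bind[OF sets_kernel[OF kernel]]) auto
  fix A assume "A \<in> sets (random_complete_subtree M H K)"
  then have A [measurable]: "A \<in> sets tree_space"
    using \<open>sets (random_complete_subtree M H K) = _\<close> by simp
  let ?i = "\<lambda>t. indicator A (forget_embedding t) :: ennreal" and ?N = "complete_sum K (\<lambda>_. 1)"
  have em: "(\<lambda>t. emeasure (chosen_subtree K t) A) \<in> borel_measurable tree_space"
    by (rule measurable_emeasure_subprob_algebra[OF A, THEN measurable_compose[OF measurable_chosen_subtree[OF K]]])
  have "emeasure (random_complete_subtree M H K) A = (\<integral>\<^sup>+t. emeasure (chosen_subtree K t) A \<partial>given_order M H)"
    unfolding random_complete_subtree_def by (rule emeasure_bind[OF _ kernel A]) simp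
  also have "\<dots> = order_law c b H (\<lambda>t. emeasure (chosen_subtree K (forget_embedding t)) A)"
    using K KH by (intro nn_integral_given_order em) simp
  also have "\<dots> = order_law c b H (\<lambda>t. complete_sum K ?i t / ?N t)"
  proof (rule order_law_cong[OF b])
    fix t :: "real tree" assume t: "strahler t = H" "reduced t"
    have n: "of_nat (size (filter_mset P (complete_subtrees K (forget_embedding t)))) =
        complete_sum K (\<lambda>t. if P (forget_embedding t) then 1 else 0) t" for P
      using complete_subtrees_below_eq_complete_sum[OF K t(2), of 0 P] K by (simp add: complete_subtrees.abs_eq)
    have N: "of_nat (size (complete_subtrees K (forget_embedding t))) = ?N t"
      using n[of "\<lambda>_. True"] by simp
    moreover have "1 \<le> ?N t" using K KH t by (intro complete_sum_1_ge) auto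
    ultimately have "complete_subtrees K (forget_embedding t) \<noteq> {#}" by auto
    from emeasure_chosen_subtree[OF this A] show "emeasure (chosen_subtree K (forget_embedding t)) A = complete_sum K ?i t / ?N t"
      unfolding N n by (simp add: indicator_def of_bool_def)
  qed
  also have "\<dots> = order_sum c H (\<lambda>s. complete_sum K (\<lambda>s. \<integral>\<^sup>+t. ?i t \<partial>edge_law b s) s / complete_sum K (\<lambda>_. 1) s)"
    unfolding order_law_def
  proof (rule order_sum_cong)
    fix s :: "unit tree"
    have sk: "complete_sum K (\<lambda>_. 1) (skeleton t) = complete_sum K (\<lambda>_. 1) t" for t :: "real tree"
      by (induction t) auto
    have "(\<integral>\<^sup>+t. complete_sum K ?i t / ?N t \<partial>edge_law b s) = (\<integral>\<^sup>+t. complete_sum K ?i t / complete_sum K (\<lambda>_. 1) s \<partial>edge_law b s)"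
      by (rule nn_integral_cong_AE, rule AE_mp[OF AE_edge_law[OF b]], rule AE_I2) (auto simp: sk)
    also have "\<dots> = (\<integral>\<^sup>+t. complete_sum K ?i t \<partial>edge_law b s) / complete_sum K (\<lambda>_. 1) s"
      by (rule nn_integral_divide) measurable
    also have "\<dots> = complete_sum K (\<lambda>s. \<integral>\<^sup>+t. ?i t \<partial>edge_law b s) s / complete_sum K (\<lambda>_. 1) s"
      by (subst nn_integral_complete_sum[OF b]) measurable
    finally show "(\<integral>\<^sup>+t. complete_sum K ?i t / ?N t \<partial>edge_law b s) = \<dots>" .
  qed
  also have "\<dots> = order_law c b K ?i"
    unfolding order_law_def by (rule order_sum_complete_average[OF c K KH])
  also have "\<dots> = (\<integral>\<^sup>+t. indicator A t \<partial>given_order M K)"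
    using K by (intro nn_integral_given_order[symmetric]) measurable
  also have "\<dots> = emeasure (given_order M K) A"
    by simp
  finally show "emeasure (random_complete_subtree M H K) A = emeasure (given_order M K) A" .
qed

lemma sets_given_shape [measurable_cong, simp]: "sets (given_shape M \<tau>) = sets tree_space"
  by (simp add: given_shape_def sets_M)

lemma given_shape_eq:
  assumes "0 < emeasure M {t. shape t = forget_embedding s}"
  shows "given_shape M (forget_embedding s) = shape_edge_law b s"
proof (rule measure_eqI)
  fix A assume "A \<in> sets (given_shape M (forget_embedding s))"
  then have [measurable]: "A \<in> sets tree_space" by simp
  have "emeasure (given_shape M (forget_embedding s)) A = (\<integral>\<^sup>+t. indicator A t \<partial>given_shape M (forget_embedding s))"
    by simp
  also have "\<dots> = (\<integral>\<^sup>+t. indicator A t \<partial>shape_edge_law b s)"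
    using nn_integral_given_shape[OF _ assms, of "indicator A"] nn_integral_shape_edge_law[of "indicator A" b s]
    by simp
  also have "\<dots> = emeasure (shape_edge_law b s) A"
    by simp
  finally show "emeasure (given_shape M (forget_embedding s)) A = emeasure (shape_edge_law b s) A" .
qed simp

lemma shape_reduced:
  assumes "0 < emeasure M {t. shape t = forget_embedding s}"
  shows "reduced s" "s \<noteq> Leaf"
proof -
  have red: "reduced (skeleton t)" if "reduced t" for t :: "real tree"
    using that by (induction t) auto
  have "reduced s \<and> s \<noteq> Leaf"
  proof (rule ccontr)
    assume s: "\<not> ?thesis"
    have "AE t in M. shape t \<noteq> forget_embedding s"
    proof (rule AE_M)
      fix t :: "real tree" assume t: "reduced t" "t \<noteq> Leaf"
      show "shape (forget_embedding t) \<noteq> forget_embedding s"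
      proof
        assume "shape (forget_embedding t) = forget_embedding s"
        then have sw: "same_up_to_swaps (skeleton t) s" by (simp add: shape_forget utree.abs_eq_iff)
        have "skeleton t \<noteq> Leaf" using t(2) by auto
        then show False using s reduced_swaps[OF sw] red[OF t(1)] same_up_to_swaps_Leaf_iff[OF sw] by blast
      qed
    qed measurable
    then have "emeasure M {t \<in> space M. \<not> shape t \<noteq> forget_embedding s} = 0"
      by (intro emeasure_eq_0_AE) simp
    with assms show False by simp
  qed
  then show "reduced s" "s \<noteq> Leaf" by auto
qed

text \<open>The shape determines the order, so the event of having the shape lies inside the event
  of having the order, and conditioning on the shape absorbs conditioning on the order.\<close>

lemma given_shape_given_order:
  assumes K: "1 \<le> K" and pos: "0 < emeasure (given_order M K) {t. shape t = \<tau>}"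
  shows "given_shape (given_order M K) \<tau> = given_shape M \<tau>" "0 < emeasure M {t. shape t = \<tau>}"
proof -
  let ?p = "emeasure M {t. order t = K}"
  interpret M: prob_space M by (rule prob_space_M)
  have p: "?p \<noteq> 0" "?p \<noteq> \<infinity>" using emeasure_order[OF K] by auto
  have em: "emeasure (given_order M K) A = emeasure M ({t. order t = K} \<inter> A) / ?p" if "A \<in> sets tree_space" for A
    unfolding given_order_def using that by (subst emeasure_uniform_measure) (simp_all add: sets_M sets_order)
  have "shape_order \<tau> = K"
  proof (rule ccontr)
    assume "shape_order \<tau> \<noteq> K"
    then have "{t. order t = K} \<inter> {t. shape t = \<tau>} = {}" by (auto simp: order_eq_shape_order)
    with pos em[OF sets_shape] show False by simp
  qed
  then have sub: "{t. shape t = \<tau>} \<subseteq> {t. order t = K}" by (auto simp: order_eq_shape_order)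
  have em': "emeasure (given_order M K) ({t. shape t = \<tau>} \<inter> A) = emeasure M ({t. shape t = \<tau>} \<inter> A) / ?p" if "A \<in> sets tree_space" for A
  proof -
    have "{t. shape t = \<tau>} \<inter> A \<in> sets tree_space" using that by (intro sets.Int sets_shape)
    moreover have "{t. order t = K} \<inter> ({t. shape t = \<tau>} \<inter> A) = {t. shape t = \<tau>} \<inter> A" using sub by auto
    ultimately show ?thesis by (simp add: em)
  qed
  have full: "emeasure (given_order M K) {t. shape t = \<tau>} = emeasure M {t. shape t = \<tau>} / ?p"
    using em'[OF sets.top] by simp
  show pos': "0 < emeasure M {t. shape t = \<tau>}"
    using pos unfolding full by (auto simp: zero_less_iff_neq_zero)
  show "given_shape (given_order M K) \<tau> = given_shape M \<tau>"
  proof (rule measure_eqI)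
    show "sets (given_shape (given_order M K) \<tau>) = sets (given_shape M \<tau>)"
      by (simp add: given_shape_def sets_M)
    fix A assume "A \<in> sets (given_shape (given_order M K) \<tau>)"
    then have A: "A \<in> sets tree_space" by (simp add: given_shape_def)
    have "emeasure (given_shape (given_order M K) \<tau>) A =
        emeasure (given_order M K) ({t. shape t = \<tau>} \<inter> A) / emeasure (given_order M K) {t. shape t = \<tau>}"
      unfolding given_shape_def using A by (subst emeasure_uniform_measure) (simp_all add: sets_shape)
    also have "\<dots> = emeasure M ({t. shape t = \<tau>} \<inter> A) / ?p / (emeasure M {t. shape t = \<tau>} / ?p)"
      by (simp only: em'[OF A] full)
    also have "\<dots> = emeasure M ({t. shape t = \<tau>} \<inter> A) / emeasure M {t. shape t = \<tau>}"
    proof -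
      have "?p = ennreal (1 / 2 ^ K)" by (rule emeasure_order[OF K])
      moreover obtain x where x: "emeasure M ({t. shape t = \<tau>} \<inter> A) = ennreal x" "0 \<le> x"
        using M.emeasure_eq_measure[of "{t. shape t = \<tau>} \<inter> A"] by auto
      moreover obtain y where y: "emeasure M {t. shape t = \<tau>} = ennreal y" "0 < y"
        using M.emeasure_eq_measure[of "{t. shape t = \<tau>}"] pos' by (auto simp: zero_less_measure_iff)
      ultimately show ?thesis by (simp add: divide_ennreal)
    qed
    also have "\<dots> = emeasure (given_shape M \<tau>) A"
      unfolding given_shape_def using A by (subst emeasure_uniform_measure) (simp_all add: sets_M sets_shape)
    finally show "emeasure (given_shape (given_order M K) \<tau>) A = emeasure (given_shape M \<tau>) A" .
  qed
qed

end


section \<open>Self-similarity\<close>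

lemma measurable_prune [measurable]: "prune_metric \<in> tree_space \<rightarrow>\<^sub>M tree_space"
proof (rule measurable_tree_spaceI)
  show "(\<lambda>t. prune_metric (forget_embedding t)) \<in> tree_sigma borel \<rightarrow>\<^sub>M tree_space"
    unfolding prune.abs_eq by measurable
qed

lemma emeasure_shape_law:
  assumes "sets L = sets tree_space"
  shows "emeasure (shape_law L) B = emeasure L {t. shape t \<in> B}"
proof -
  have "shape \<in> L \<rightarrow>\<^sub>M count_space UNIV" using measurable_shape assms by (simp cong: measurable_cong_sets)
  moreover have "space L = UNIV" using sets_eq_imp_space_eq[OF assms] by simp
  ultimately show ?thesis unfolding shape_law_def by (subst emeasure_distr) (auto simp: vimage_def)
qed

lemma measure_shape_law_pos:
  assumes "sets L = sets tree_space" "0 < measure (shape_law L) {\<tau>}"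
  shows "0 < emeasure L {t. shape t = \<tau>}"
  using assms by (simp add: measure_def emeasure_shape_law enn2real_positive_iff)

section \<open>The law of the pruned tree\<close>

context tokunaga_law
begin

abbreviation pruned_law :: "real utree measure" where
  "pruned_law \<equiv> distr M tree_space prune_metric"

text \<open>Order k + 1 is half as likely as order k, and pruning turns its law into that of order k
  with edge rate \<open>b / c\<close>, that is, with lengths multiplied by \<open>c\<close>. Trees
  of order 1 become empty and are kept out by the condition on \<open>A\<close>.\<close>

lemma emeasure_pruned_law:
  assumes A [measurable]: "A \<in> sets tree_space" and "empty_tree \<notin> A"
  shows "emeasure pruned_law A = ennreal (1 / 2) * emeasure M (scale_tree c -` A)"
proof -
  have c0: "0 < c" using c by simp
  let ?i = "\<lambda>t. indicator A (forget_embedding t) :: ennreal"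
  let ?g = "\<lambda>k. order_law c (b / c) k ?i"
  have prM: "prune_metric \<in> M \<rightarrow>\<^sub>M tree_space" by measurable
  have scM: "scale_tree c \<in> M \<rightarrow>\<^sub>M tree_space" by measurable
  have "emeasure pruned_law A = (\<integral>\<^sup>+t. indicator A t \<partial>pruned_law)" by simp
  also have "\<dots> = (\<integral>\<^sup>+t. indicator A (prune_metric t) \<partial>M)"
    by (rule nn_integral_distr[OF prM]) simp
  also have "\<dots> = (\<integral>\<^sup>+K. ennreal (1 / 2 ^ K) * order_law c b K (\<lambda>t. indicator A (prune_metric (forget_embedding t))) \<partial>count_space {1..})"
    by (rule nn_integral_M) measurable
  also have "\<dots> = (\<integral>\<^sup>+k. ennreal (1 / 2 ^ Suc k) * order_law c b (Suc k) (\<lambda>t. ?i (prune_pl t)) \<partial>count_space UNIV)"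
    unfolding prune.abs_eq by (intro nn_integral_bij_count_space[symmetric] bij_betwI[of _ _ _ "\<lambda>k. k - 1"]) auto
  also have "\<dots> = (\<integral>\<^sup>+k. ennreal (1 / 2 ^ Suc k) * ?g k \<partial>count_space UNIV)"
    by (intro nn_integral_cong, subst order_law_prune[OF c b]) (auto simp: indicator_def)
  also have "\<dots> = (\<integral>\<^sup>+k. ennreal (1 / 2) * (ennreal (1 / 2 ^ k) * ?g k) \<partial>count_space {1..})"
  proof (subst nn_integral_count_space_indicator, simp, rule nn_integral_cong)
    fix k :: nat
    \<comment> \<open>The index 0 belongs to the trees of order 1, whose pruning lies outside
      \<open>A\<close>.\<close>
    have "?g 0 = 0" using assms(2) by (simp add: order_law_0 empty_tree.abs_eq[symmetric])
    moreover have "ennreal (1 / 2 ^ Suc k) = ennreal (1 / 2) * ennreal (1 / 2 ^ k)"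
      by (subst ennreal_mult[symmetric]) auto
    ultimately show "ennreal (1 / 2 ^ Suc k) * ?g k = ennreal (1 / 2) * (ennreal (1 / 2 ^ k) * ?g k) * indicator {1..} k"
      by (cases k) (auto simp: mult.assoc)
  qed
  also have "\<dots> = ennreal (1 / 2) * (\<integral>\<^sup>+k. ennreal (1 / 2 ^ k) * ?g k \<partial>count_space {1..})"
    by (rule nn_integral_cmult) simp
  also have "(\<integral>\<^sup>+k. ennreal (1 / 2 ^ k) * ?g k \<partial>count_space {1..}) =
      (\<integral>\<^sup>+k. ennreal (1 / 2 ^ k) * order_law c b k (\<lambda>t. indicator A (scale_tree c (forget_embedding t))) \<partial>count_space {1..})"
  proof -
    have "(\<integral>\<^sup>+t. ?i (map_tree (\<lambda>x. c * x) t) \<partial>edge_law b s) = (\<integral>\<^sup>+t. ?i t \<partial>edge_law (b / c) s)" for s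
      by (rule nn_integral_edge_law_scale[OF c0 b]) measurable
    then show ?thesis unfolding order_law_def scale_forget by simp
  qed
  also have "\<dots> = (\<integral>\<^sup>+t. indicator A (scale_tree c t) \<partial>M)"
    by (rule nn_integral_M[symmetric]) measurable
  also have "\<dots> = (\<integral>\<^sup>+t. indicator A t \<partial>distr M tree_space (scale_tree c))"
    by (rule nn_integral_distr[OF scM, symmetric]) simp
  also have "\<dots> = emeasure (distr M tree_space (scale_tree c)) A" by simp
  also have "\<dots> = emeasure M (scale_tree c -` A)"
    by (subst emeasure_distr[OF scM]) auto
  finally show ?thesis .
qed

lemma emeasure_pruned_law_shape:
  assumes "empty_tree \<notin> B"
  shows "emeasure pruned_law {t. shape t \<in> B} = ennreal (1 / 2) * emeasure M {t. shape t \<in> B}"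
proof -
  have "{t. shape t \<in> B} \<in> sets tree_space"
    using measurable_sets[OF measurable_shape, of B] by (simp add: vimage_def)
  from emeasure_pruned_law[OF this] assms show ?thesis
    by (simp add: vimage_def shape_eq_empty_iff[THEN iffD2])
qed

lemma given_shape_pruned_law:
  assumes pos: "0 < emeasure M {t. shape t = forget_embedding s}"
  shows "given_shape pruned_law (forget_embedding s) = shape_edge_law (b / c) s"
proof (rule measure_eqI)
  let ?\<tau> = "forget_embedding s" and ?h = "ennreal (1 / 2)"
  interpret M: prob_space M by (rule prob_space_M)
  have c0: "0 < c" using c by simp
  show "sets (given_shape pruned_law ?\<tau>) = sets (shape_edge_law (b / c) s)"
    by (simp add: given_shape_def)
  fix A assume "A \<in> sets (given_shape pruned_law ?\<tau>)"
  then have A: "A \<in> sets tree_space" by (simp add: given_shape_def)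
  have scA: "scale_tree c -` A \<in> sets tree_space"
    using measurable_sets[OF measurable_scale_tree A, of c] by simp
  have ne: "?\<tau> \<noteq> empty_tree" using shape_reduced(2)[OF pos] by simp
  have "emeasure (given_shape pruned_law ?\<tau>) A =
      emeasure pruned_law ({t. shape t = ?\<tau>} \<inter> A) / emeasure pruned_law {t. shape t = ?\<tau>}"
    unfolding given_shape_def using A by (subst emeasure_uniform_measure) (simp_all add: sets_shape)
  also have "\<dots> = (?h * emeasure M ({t. shape t = ?\<tau>} \<inter> scale_tree c -` A)) / (?h * emeasure M {t. shape t = ?\<tau>})"
  proof -
    have "emeasure pruned_law ({t. shape t = ?\<tau>} \<inter> A) = ?h * emeasure M (scale_tree c -` ({t. shape t = ?\<tau>} \<inter> A))"
    proof (intro emeasure_pruned_law sets.Int sets_shape A)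
      have "shape (empty_tree :: real utree) = empty_tree" by simp
      with ne show "empty_tree \<notin> {t. shape t = ?\<tau>} \<inter> A"
        by (metis (mono_tags) Int_iff mem_Collect_eq)
    qed
    moreover have "scale_tree c -` ({t. shape t = ?\<tau>} \<inter> A) = {t. shape t = ?\<tau>} \<inter> scale_tree c -` A"
      by auto
    moreover have "emeasure pruned_law {t. shape t = ?\<tau>} = ?h * emeasure M {t. shape t = ?\<tau>}"
      using emeasure_pruned_law_shape[of "{?\<tau>}"] ne by simp
    ultimately show ?thesis by simp
  qed
  also have "\<dots> = emeasure M ({t. shape t = ?\<tau>} \<inter> scale_tree c -` A) / emeasure M {t. shape t = ?\<tau>}"
  proof -
    obtain x where x: "emeasure M ({t. shape t = ?\<tau>} \<inter> scale_tree c -` A) = ennreal x" "0 \<le> x"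
      using M.emeasure_eq_measure[of "{t. shape t = ?\<tau>} \<inter> scale_tree c -` A"] by auto
    moreover obtain y where y: "emeasure M {t. shape t = ?\<tau>} = ennreal y" "0 < y"
      using M.emeasure_eq_measure[of "{t. shape t = ?\<tau>}"] pos by (auto simp: zero_less_measure_iff)
    moreover have h: "?h * ennreal z = ennreal (1 / 2 * z)" if "0 \<le> z" for z
      using that by (intro ennreal_mult[symmetric]) auto
    ultimately show ?thesis
      unfolding x(1) y(1) h[OF x(2)] h[OF less_imp_le[OF y(2)]] by (simp add: divide_ennreal)
  qed
  also have "\<dots> = emeasure (given_shape M ?\<tau>) (scale_tree c -` A)"
    unfolding given_shape_def using scA by (subst emeasure_uniform_measure) (simp_all add: sets_M sets_shape)
  also have "\<dots> = emeasure (distr (shape_edge_law b s) tree_space (scale_tree c)) A"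
    unfolding given_shape_eq[OF pos] using A by (subst emeasure_distr) (auto cong: measurable_cong_sets)
  also have "\<dots> = emeasure (shape_edge_law (b / c) s) A"
    unfolding shape_edge_law_scale[OF c0 b] ..
  finally show "emeasure (given_shape pruned_law ?\<tau>) A = emeasure (shape_edge_law (b / c) s) A" .
qed

text \<open>Rescaling leaves shapes alone, so off the empty tree the pruned shape law is half of the
  original one; conditioning on being nonempty removes the factor.\<close>

lemma prune_invariant_shape_M: "prune_invariant_shape M"
proof -
  let ?\<mu> = "shape_law M" and ?\<nu> = "distr (shape_law M) (count_space UNIV) prune_shape"
  interpret M: prob_space M by (rule prob_space_M)
  have nu: "emeasure ?\<nu> B = emeasure pruned_law {t. shape t \<in> B}" for B
  proof -
    have "{t. shape t \<in> B} \<in> sets tree_space"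
      using measurable_sets[OF measurable_shape, of B] by (simp add: vimage_def)
    then have "emeasure pruned_law {t. shape t \<in> B} = emeasure M {t. shape (prune_metric t) \<in> B}"
      by (subst emeasure_distr) (auto simp: vimage_def cong: measurable_cong_sets)
    also have "\<dots> = emeasure ?\<mu> (prune_shape -` B)"
      by (simp add: emeasure_shape_law[OF sets_M] shape_prune)
    also have "\<dots> = emeasure ?\<nu> B"
      by (subst emeasure_distr) (auto simp: shape_law_def)
    finally show ?thesis ..
  qed
  have "AE t in M. shape t \<noteq> empty_tree"
    by (rule AE_M, simp) measurable
  then have ne: "AE t in M. t \<noteq> empty_tree"
    by (rule eventually_mono) simp
  have M_ne: "emeasure M {t. shape t \<in> B - {empty_tree}} = emeasure M {t. shape t \<in> B}" for B
  proof (rule emeasure_eq_AE)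
    show "AE t in M. t \<in> {t. shape t \<in> B - {empty_tree}} \<longleftrightarrow> t \<in> {t. shape t \<in> B}"
      using ne by (rule eventually_mono) auto
    show "{t. shape t \<in> B - {empty_tree}} \<in> sets M" "{t. shape t \<in> B} \<in> sets M"
      using measurable_sets[OF measurable_shape, of B] measurable_sets[OF measurable_shape, of "B - {empty_tree}"]
      by (simp_all add: vimage_def sets_M)
  qed
  have "uniform_measure ?\<nu> (- {empty_tree}) = ?\<mu>"
  proof (rule measure_eqI)
    fix B
    have "emeasure (uniform_measure ?\<nu> (- {empty_tree})) B = emeasure ?\<nu> (- {empty_tree} \<inter> B) / emeasure ?\<nu> (- {empty_tree})"
      by (rule emeasure_uniform_measure) auto
    also have "- {empty_tree} \<inter> B = B - {empty_tree}" by auto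
    also have "emeasure ?\<nu> (B - {empty_tree}) = ennreal (1 / 2) * emeasure ?\<mu> B"
      unfolding nu using emeasure_pruned_law_shape[of "B - {empty_tree}"] M_ne[of B] by (simp add: emeasure_shape_law[OF sets_M])
    also have "emeasure ?\<nu> (- {empty_tree}) = ennreal (1 / 2)"
      unfolding nu using emeasure_pruned_law_shape[of "UNIV - {empty_tree}"] M_ne[of UNIV] M.emeasure_space_1
      by (simp add: Compl_eq_Diff_UNIV)
    also have "ennreal (1 / 2) * emeasure ?\<mu> B / ennreal (1 / 2) = emeasure ?\<mu> B"
      by (subst mult.commute, rule ennreal_mult_divide_eq) simp_all
    finally show "emeasure (uniform_measure ?\<nu> (- {empty_tree})) B = emeasure ?\<mu> B" .
  qed (simp add: shape_law_def)
  then show ?thesis by (simp add: prune_invariant_shape_def Let_def)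
qed

lemma metric_trees_M: "AE t in M. t \<in> metric_trees"
  by (rule AE_M) (auto simp: forget_in_metric_trees_iff)

end

section \<open>Existence and uniqueness of the scaling exponent\<close>

locale tokunaga_embedding = tokunaga_law + planar_embedding
begin

text \<open>Formulated as an equivalence and for any positive \<zeta>, because both directions are
  used: with \<zeta> = c to prove self-similarity, and with an unknown exponent to identify
  it.\<close>

lemma cond_length_density_pruned_law:
  assumes z: "0 < \<zeta>" and pos: "0 < emeasure M {t. shape t = \<tau>}" and f: "cond_length_density E M \<tau> f"
  shows "rel_lengths_law E pruned_law \<tau> = rel_lengths_law E M \<tau>"
    and "cond_length_density E pruned_law \<tau> (\<lambda>x l. f x (l / \<zeta>) / \<zeta>) \<longleftrightarrow>
      distr (given_shape pruned_law \<tau>) (vectors (num_edges \<tau>) \<Otimes>\<^sub>M lborel) (lengths (num_edges \<tau>)) =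
      distr (distr (given_shape M \<tau>) (vectors (num_edges \<tau>) \<Otimes>\<^sub>M lborel) (lengths (num_edges \<tau>)))
        (vectors (num_edges \<tau>) \<Otimes>\<^sub>M lborel) (\<lambda>(x, l). (x, \<zeta> * l))"
proof -
  obtain s where \<tau>: "\<tau> = forget_embedding s" by (induction \<tau> rule: utree.abs_induct) auto
  note pos = pos[unfolded \<tau>]
  note s = shape_reduced[OF pos]
  have c0: "0 < c" using c by simp
  let ?n = "size s"
  let ?\<rho> = "distr (shape_edge_law b s) (vectors ?n) (rel_lengths E ?n)"
  have rel: "distr (shape_edge_law (b / c) s) (vectors ?n) (rel_lengths E ?n) = ?\<rho>"
    by (rule rel_law_scale[OF b s c0])
  show "rel_lengths_law E pruned_law \<tau> = rel_lengths_law E M \<tau>"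
    unfolding rel_lengths_law_def \<tau> num_edges_forget given_shape_eq[OF pos] given_shape_pruned_law[OF pos] rel ..
  have ld: "length_density E ?n (shape_edge_law b s) f"
    using f unfolding cond_length_density_iff \<tau> num_edges_forget given_shape_eq[OF pos] .
  then have fm: "(\<lambda>(x, l). f x l) \<in> borel_measurable (vectors ?n \<Otimes>\<^sub>M lborel)" "\<And>x l. 0 \<le> f x l"
    and joint: "distr (shape_edge_law b s) (vectors ?n \<Otimes>\<^sub>M lborel) (lengths ?n) = density (?\<rho> \<Otimes>\<^sub>M lborel) (\<lambda>(x, l). ennreal (f x l))"
    unfolding length_density_def by blast+
  have "(\<lambda>(x, l). (x, l / \<zeta>)) \<in> vectors ?n \<Otimes>\<^sub>M lborel \<rightarrow>\<^sub>M vectors ?n \<Otimes>\<^sub>M lborel" by measurable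
  from measurable_compose[OF this fm(1)] have [measurable]: "(\<lambda>(x, l). f x (l / \<zeta>)) \<in> borel_measurable (vectors ?n \<Otimes>\<^sub>M lborel)"
    by (simp add: split_def)
  have fm': "(\<lambda>(x, l). f x (l / \<zeta>) / \<zeta>) \<in> borel_measurable (vectors ?n \<Otimes>\<^sub>M lborel)" "\<forall>x l. 0 \<le> f x (l / \<zeta>) / \<zeta>"
    using fm(2) z by (measurable, simp)
  show "cond_length_density E pruned_law \<tau> (\<lambda>x l. f x (l / \<zeta>) / \<zeta>) \<longleftrightarrow>
      distr (given_shape pruned_law \<tau>) (vectors (num_edges \<tau>) \<Otimes>\<^sub>M lborel) (lengths (num_edges \<tau>)) =
      distr (distr (given_shape M \<tau>) (vectors (num_edges \<tau>) \<Otimes>\<^sub>M lborel) (lengths (num_edges \<tau>)))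
        (vectors (num_edges \<tau>) \<Otimes>\<^sub>M lborel) (\<lambda>(x, l). (x, \<zeta> * l))"
    unfolding cond_length_density_iff \<tau> num_edges_forget given_shape_eq[OF pos] given_shape_pruned_law[OF pos]
      length_density_def rel joint
    using fm' density_scale_length[OF prob_space_rel_law[OF b s] _ z fm] by simp
qed

lemma self_similar_M: "self_similar E M c"
proof -
  have c0: "0 < c" using c by simp
  have "\<exists>f. 0 < emeasure M {t. shape t = \<tau>} \<longrightarrow> cond_length_density E M \<tau> f" for \<tau>
  proof (cases "0 < emeasure M {t. shape t = \<tau>}")
    case True
    obtain s where \<tau>: "\<tau> = forget_embedding s" by (induction \<tau> rule: utree.abs_induct) auto
    note pos = True[unfolded \<tau>]
    from ex_length_density[OF b shape_reduced[OF pos]] show ?thesis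
      unfolding cond_length_density_iff \<tau> num_edges_forget given_shape_eq[OF pos] by blast
  qed simp
  \<comment> \<open>The densities are chosen once for every shape; the same family has to serve the
    tree, its random complete subtrees and its pruning.\<close>
  then obtain F where F: "0 < emeasure M {t. shape t = \<tau>} \<Longrightarrow> cond_length_density E M \<tau> (F \<tau>)" for \<tau>
    by metis
  have "coordinated E M F"
    unfolding coordinated_def Let_def
  proof (intro allI impI, elim conjE, intro conjI allI impI)
    fix H K :: nat and \<tau> assume K: "1 \<le> K" "K \<le> H"
    note Q = random_complete_subtree_eq[OF K]
    show "shape_law (random_complete_subtree M H K) = shape_law (given_order M K)" unfolding Q ..
    assume "0 < measure (shape_law (given_order M K)) {\<tau>}"
    then have "0 < emeasure (given_order M K) {t. shape t = \<tau>}"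
      by (intro measure_shape_law_pos) simp_all
    note gs = given_shape_given_order[OF K(1) this]
    show "rel_lengths_law E (random_complete_subtree M H K) \<tau> = rel_lengths_law E M \<tau>"
      unfolding rel_lengths_law_def Q gs(1) ..
    show "cond_length_density E (random_complete_subtree M H K) \<tau> (F \<tau>)"
      using F[OF gs(2)] unfolding cond_length_density_iff Q gs(1) .
  qed
  moreover have "prune_scales_lengths E M F c"
    unfolding prune_scales_lengths_def Let_def
  proof (intro allI impI, elim conjE)
    fix \<tau> :: "unit utree" assume \<tau>: "\<tau> \<noteq> empty_tree" and "0 < measure (shape_law pruned_law) {\<tau>}"
    then have "0 < emeasure pruned_law {t. shape t = \<tau>}"
      by (intro measure_shape_law_pos) simp_all
    then have pos: "0 < emeasure M {t. shape t = \<tau>}"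
      using emeasure_pruned_law_shape[of "{\<tau>}"] \<tau> by (auto simp: zero_less_iff_neq_zero)
    obtain s where s: "\<tau> = forget_embedding s" by (induction \<tau> rule: utree.abs_induct) auto
    note pos' = pos[unfolded s]
    have "distr (given_shape pruned_law \<tau>) (vectors (num_edges \<tau>) \<Otimes>\<^sub>M lborel) (lengths (num_edges \<tau>)) =
      distr (distr (given_shape M \<tau>) (vectors (num_edges \<tau>) \<Otimes>\<^sub>M lborel) (lengths (num_edges \<tau>)))
        (vectors (num_edges \<tau>) \<Otimes>\<^sub>M lborel) (\<lambda>(x, l). (x, c * l))"
      unfolding s num_edges_forget given_shape_eq[OF pos'] given_shape_pruned_law[OF pos']
      by (rule lengths_law_scale[OF b shape_reduced[OF pos'] c0])
    then show "rel_lengths_law E pruned_law \<tau> = rel_lengths_law E M \<tau> \<and>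
        cond_length_density E pruned_law \<tau> (\<lambda>x l. F \<tau> x (l / c) / c)"
      using cond_length_density_pruned_law[OF c0 pos F[OF pos]] by simp
  qed
  moreover have "cond_length_density E M \<tau> (F \<tau>)" if "0 < measure (shape_law M) {\<tau>}" for \<tau>
    by (rule F, rule measure_shape_law_pos[OF sets_M that])
  ultimately show ?thesis
    unfolding self_similar_def using c0 prob_space_M sets_M metric_trees_M prune_invariant_shape_M by blast
qed

text \<open>The scaling exponent is determined by the length of the tree with a single edge.\<close>

lemma self_similar_unique:
  assumes "self_similar E M \<zeta>"
  shows "\<zeta> = c"
proof -
  have c0: "0 < c" using c by simp
  from assms obtain F where z: "0 < \<zeta>" and F: "\<And>\<tau>. 0 < measure (shape_law M) {\<tau>} \<Longrightarrow> cond_length_density E M \<tau> (F \<tau>)"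
    and ps: "prune_scales_lengths E M F \<zeta>"
    unfolding self_similar_def by blast
  let ?s = "Node Leaf () Leaf" and ?\<tau> = "forget_embedding (Node Leaf () Leaf)"
  let ?V = "vectors 1 \<Otimes>\<^sub>M (lborel :: real measure)"
  interpret M: prob_space M by (rule prob_space_M)
  \<comment> \<open>A reduced tree of order 1 is a single edge, and order 1 has probability
    1/2.\<close>
  have "emeasure M {t. shape t = ?\<tau>} \<ge> ennreal (1 / 2)"
  proof -
    have "ennreal (1 / 2) = ennreal (1 / 2 ^ 1) * order_law c b 1 (\<lambda>_. 1)"
      by (simp add: order_law_1[OF c b])
    also have "order_law c b 1 (\<lambda>_. 1) = order_law c b 1 (\<lambda>t. indicator {t. shape t = ?\<tau>} (forget_embedding t))"
    proof (rule order_law_cong[OF b])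
      fix t :: "real tree" assume t: "strahler t = 1" "reduced t"
      then obtain x where "t = Node Leaf x Leaf" by (cases t) (auto simp: max_def le_Suc_eq Suc_le_eq split: if_splits)
      then show "1 = (indicator {t. shape t = ?\<tau>} (forget_embedding t) :: ennreal)"
        by (simp add: shape_forget)
    qed
    also have "ennreal (1 / 2 ^ 1) * order_law c b 1 (\<lambda>t. indicator {t. shape t = ?\<tau>} (forget_embedding t)) =
        (\<integral>\<^sup>+t. indicator {t. shape t = ?\<tau>} t * indicator {t. order t = 1} t \<partial>M)"
      by (rule nn_integral_order[symmetric]) (auto intro: sets_shape)
    also have "\<dots> \<le> (\<integral>\<^sup>+t. indicator {t. shape t = ?\<tau>} t \<partial>M)"
      by (intro nn_integral_mono) (auto split: split_indicator)
    also have "\<dots> = emeasure M {t. shape t = ?\<tau>}"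
      by (simp add: sets_M sets_shape)
    finally show ?thesis .
  qed
  moreover have "0 < ennreal (1 / 2)" by (rule ennreal_less_zero_iff[THEN iffD2]) simp
  ultimately have pos: "0 < emeasure M {t. shape t = ?\<tau>}"
    by (rule less_le_trans[rotated])
  have "measure (shape_law M) {?\<tau>} = measure M {t. shape t = ?\<tau>}"
    by (simp add: measure_def emeasure_shape_law[OF sets_M])
  then have pM: "0 < measure (shape_law M) {?\<tau>}"
    using pos M.emeasure_eq_measure by (simp add: zero_less_measure_iff)
  have ne: "?\<tau> \<noteq> empty_tree" by simp
  have "emeasure (shape_law pruned_law) {?\<tau>} = emeasure pruned_law {t. shape t \<in> {?\<tau>}}"
    by (rule emeasure_shape_law) simp
  also have "\<dots> = ennreal (1 / 2) * emeasure M {t. shape t \<in> {?\<tau>}}"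
    by (rule emeasure_pruned_law_shape) (use ne[symmetric] in \<open>simp only: singleton_iff not_False_eq_True\<close>)
  also have "\<dots> = ennreal (1 / 2 * measure M {t. shape t = ?\<tau>})"
    unfolding singleton_iff M.emeasure_eq_measure by (rule ennreal_mult[symmetric]) auto
  finally have e: "emeasure (shape_law pruned_law) {?\<tau>} = ennreal (1 / 2 * measure M {t. shape t = ?\<tau>})" .
  have "0 < measure M {t. shape t = ?\<tau>}"
    using pos unfolding M.emeasure_eq_measure by simp
  then have pN: "0 < measure (shape_law pruned_law) {?\<tau>}"
    unfolding measure_def[of "shape_law pruned_law"] e by simp
  from ps pN ne have "cond_length_density E pruned_law ?\<tau> (\<lambda>x l. F ?\<tau> x (l / \<zeta>) / \<zeta>)"
    unfolding prune_scales_lengths_def Let_def by blast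
  \<comment> \<open>The equivalence for the unknown exponent, read from densities to laws: the
    pruned law at rate \<open>b / c\<close> on one side, the length multiplied by \<zeta> on the
    other.\<close>
  then have joint: "distr (shape_edge_law (b / c) ?s) ?V (lengths 1) = distr (distr (shape_edge_law b ?s) ?V (lengths 1)) ?V (\<lambda>(x, l). (x, \<zeta> * l))"
    using cond_length_density_pruned_law(2)[OF z pos F[OF pM]]
    unfolding num_edges_forget given_shape_eq[OF pos] given_shape_pruned_law[OF pos] by simp
  have len: "(\<integral>\<^sup>+t. g (tree_length t) \<partial>shape_edge_law a ?s) = (\<integral>\<^sup>+x. g x \<partial>exponential a)"
    if "0 < a" and [measurable]: "g \<in> borel_measurable borel" for a g
  proof -
    let ?S = "\<lambda>t. sum_list (preorder t) :: real"
    have S [measurable]: "?S \<in> borel_measurable (tree_sigma borel)"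
      using measurable_compose[OF measurable_forget_embedding measurable_tree_length] by (simp add: tree_length_forget)
    note gS = measurable_compose[OF S that(2)]
    have R: "(\<integral>\<^sup>+R. g (?S (Node L x R)) \<partial>edge_law a Leaf) = g (x + ?S L)" for L x
      by (subst nn_integral_edge_law_Leaf, rule measurable_compose[OF _ gS], measurable)
    have L: "(\<integral>\<^sup>+L. g (x + ?S L) \<partial>edge_law a Leaf) = g x" for x
      by (subst nn_integral_edge_law_Leaf, rule measurable_compose[OF borel_measurable_add[OF borel_measurable_const S] that(2)]) simp
    have "(\<integral>\<^sup>+t. g (tree_length t) \<partial>shape_edge_law a ?s) = (\<integral>\<^sup>+t. g (?S t) \<partial>edge_law a ?s)"
      using nn_integral_shape_edge_law[OF measurable_compose[OF measurable_tree_length that(2)], of a ?s]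
      by (simp add: tree_length_forget)
    also have "\<dots> = (\<integral>\<^sup>+x. \<integral>\<^sup>+L. \<integral>\<^sup>+R. g (?S (Node L x R)) \<partial>edge_law a Leaf \<partial>edge_law a Leaf \<partial>exponential a)"
      by (rule nn_integral_edge_law_Node[OF that(1) gS])
    finally show ?thesis unfolding R L .
  qed
  have lm: "lengths 1 \<in> shape_edge_law a ?s \<rightarrow>\<^sub>M ?V" for a by measurable
  have zm: "(\<lambda>(x, l). (x, \<zeta> * l)) \<in> ?V \<rightarrow>\<^sub>M ?V" by measurable
  \<comment> \<open>The probability of exceeding length 1 is exp (- b / c) on one side and exp (- b
    / \<zeta>) on the other, which suffices to compare the rates.\<close>
  let ?g = "indicator {1 <..} :: real \<Rightarrow> ennreal"
  have gm: "(\<lambda>p. ?g (snd p)) \<in> borel_measurable ?V" by measurable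
  have gm': "(\<lambda>p. ?g (snd p)) \<in> borel_measurable (distr X ?V h)" for X :: "'x measure" and h
    unfolding measurable_distr_eq1 by (rule gm)
  have zm': "(\<lambda>(x, l). (x, \<zeta> * l)) \<in> distr X ?V h \<rightarrow>\<^sub>M ?V" for X :: "'x measure" and h
    unfolding measurable_distr_eq1 by (rule zm)
  have "(\<integral>\<^sup>+x. ?g x \<partial>exponential (b / c)) = (\<integral>\<^sup>+t. ?g (tree_length t) \<partial>shape_edge_law (b / c) ?s)"
    using b c0 by (intro len[symmetric]) auto
  also have "\<dots> = (\<integral>\<^sup>+p. ?g (snd p) \<partial>distr (shape_edge_law (b / c) ?s) ?V (lengths 1))"
    using nn_integral_distr[OF lm gm'] by (simp only: snd_conv)
  also have "\<dots> = (\<integral>\<^sup>+p. ?g (snd (case p of (x, l) \<Rightarrow> (x, \<zeta> * l))) \<partial>distr (shape_edge_law b ?s) ?V (lengths 1))"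
    unfolding joint by (rule nn_integral_distr[OF zm' gm'])
  also have "\<dots> = (\<integral>\<^sup>+t. ?g (snd (case lengths 1 t of (x, l) \<Rightarrow> (x, \<zeta> * l))) \<partial>shape_edge_law b ?s)"
    by (rule nn_integral_distr[OF lm measurable_compose[OF zm' gm]])
  also have "\<dots> = (\<integral>\<^sup>+t. ?g (\<zeta> * tree_length t) \<partial>shape_edge_law b ?s)"
    by (simp only: prod.case snd_conv)
  also have "\<dots> = (\<integral>\<^sup>+x. ?g (\<zeta> * x) \<partial>exponential b)"
    using b by (intro len) auto
  also have "\<dots> = (\<integral>\<^sup>+x. ?g x \<partial>exponential (b / \<zeta>))"
    by (rule nn_integral_exponential_scale[OF z b]) simp
  finally have "emeasure (exponential (b / c)) {1 <..} = emeasure (exponential (b / \<zeta>)) {1 <..}"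
    by simp
  then have "b / c = b / \<zeta>"
    using b c0 z by (simp add: emeasure_exponential_gt)
  then show ?thesis using b c0 z by (simp add: field_simps)
qed

lemma scaling_exponent_M: "scaling_exponent E M = c"
  unfolding scaling_exponent_def by (rule the_equality) (rule self_similar_M, rule self_similar_unique)

end


section \<open>Independent exponential edges\<close>

lemma measurable_with_lengths:
  assumes "\<And>i. i < size s \<Longrightarrow> (\<lambda>x. f x i) \<in> borel_measurable N"
  shows "(\<lambda>x. with_lengths s (f x)) \<in> N \<rightarrow>\<^sub>M tree_sigma borel"
  using assms
proof (induction s arbitrary: f)
  case (Node l u r)
  have [measurable]: "(\<lambda>x. with_lengths l (\<lambda>i. f x (Suc i))) \<in> N \<rightarrow>\<^sub>M tree_sigma borel"
    "(\<lambda>x. with_lengths r (\<lambda>i. f x (Suc (size l + i)))) \<in> N \<rightarrow>\<^sub>M tree_sigma borel"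
    "(\<lambda>x. f x 0) \<in> borel_measurable N"
    by (auto intro!: Node.IH Node.prems)
  show ?case by simp
qed simp

lemma with_lengths_cong:
  "(\<And>i. i < size s \<Longrightarrow> f i = g i) \<Longrightarrow> with_lengths s f = with_lengths s g"
proof (induction s arbitrary: f g)
  case (Node l u r)
  have "with_lengths l (\<lambda>i. f (Suc i)) = with_lengths l (\<lambda>i. g (Suc i))"
    by (rule Node.IH(1)) (simp add: Node.prems)
  moreover have "with_lengths r (\<lambda>i. f (Suc (size l + i))) = with_lengths r (\<lambda>i. g (Suc (size l + i)))"
    by (rule Node.IH(2)) (simp add: Node.prems)
  moreover have "f 0 = g 0" by (rule Node.prems) simp
  ultimately show ?case by simp
qed simp

text \<open>Generalised to an injection \<open>h\<close> into an arbitrary index set: in the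
  induction both subtrees read their shifted coordinates from the same product space, and decoupling
  makes them independent without changing the space.\<close>

lemma nn_integral_with_lengths:
  assumes b: "0 < b" and f: "f \<in> borel_measurable (tree_sigma borel)"
    and h: "inj_on h {..<size s}" "h ` {..<size s} \<subseteq> I"
  shows "(\<integral>\<^sup>+x. f (with_lengths s (\<lambda>i. x (h i))) \<partial>PiM I (\<lambda>_ :: nat. exponential b)) = (\<integral>\<^sup>+t. f t \<partial>edge_law b s)"
  using f h
proof (induction s arbitrary: f h)
  case Leaf
  have "prob_space (PiM I (\<lambda>_ :: nat. exponential b))" by (intro prob_space_PiM prob_space_exponential b)
  then show ?case using Leaf by (simp add: prob_space.emeasure_space_1)
next
  case (Node l u r)
  note [measurable] = Node.prems(1)
  note [measurable (raw)] = borel_measurable_edge_law_integral[OF b]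
  let ?P = "PiM I (\<lambda>_ :: nat. exponential b)"
  let ?hl = "\<lambda>i. h (Suc i)" and ?hr = "\<lambda>i. h (Suc (size l + i))"
  have inj: "inj_on ?hl {..<size l}" "inj_on ?hr {..<size r}"
    by (rule inj_onI, drule inj_onD[OF Node.prems(2)], auto)+
  have sub: "h 0 \<in> I" "?hl ` {..<size l} \<subseteq> I" "?hr ` {..<size r} \<subseteq> I"
    using Node.prems(3) by (auto simp: image_subset_iff)
  have probs: "prob_space ((\<lambda>_ :: nat. exponential b) i)" for i using b by (rule prob_space_exponential)
  have coord: "(\<lambda>x. x i) \<in> borel_measurable ?P" if "i \<in> I" for i
    using measurable_component_singleton[OF that, of "\<lambda>_. exponential b"] by (simp cong: measurable_cong_sets)
  have ml [measurable]: "(\<lambda>x. with_lengths l (\<lambda>i. x (?hl i))) \<in> ?P \<rightarrow>\<^sub>M tree_sigma borel"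
    using sub by (intro measurable_with_lengths coord) auto
  have mr [measurable]: "(\<lambda>x. with_lengths r (\<lambda>i. x (?hr i))) \<in> ?P \<rightarrow>\<^sub>M tree_sigma borel"
    using sub by (intro measurable_with_lengths coord) auto
  have m0 [measurable]: "(\<lambda>x. x (h 0)) \<in> borel_measurable ?P" using sub by (intro coord)
  have ne0: "?hl i \<noteq> h 0" if "i < size l" for i
    using inj_onD[OF Node.prems(2), of "Suc i" 0] that by auto
  have ne0': "?hr i \<noteq> h 0" if "i < size r" for i
    using inj_onD[OF Node.prems(2), of "Suc (size l + i)" 0] that by auto
  have nelr: "?hr i \<noteq> ?hl k" if "i < size r" "k < size l" for i k
    using inj_onD[OF Node.prems(2), of "Suc (size l + i)" "Suc k"] that by auto
  let ?h1 = "\<lambda>x y. f (Node (with_lengths l (\<lambda>i. y (?hl i))) (x (h 0)) (with_lengths r (\<lambda>i. y (?hr i))))"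
  have "(\<integral>\<^sup>+x. f (with_lengths (Node l u r) (\<lambda>i. x (h i))) \<partial>?P) = (\<integral>\<^sup>+x. ?h1 x x \<partial>?P)"
    by simp
  also have "\<dots> = (\<integral>\<^sup>+x. \<integral>\<^sup>+y. ?h1 x y \<partial>?P \<partial>?P)"
  proof (rule nn_integral_PiM_decouple[where J = "{h 0}"])
    show "(\<lambda>(x, y). ?h1 x y) \<in> borel_measurable (?P \<Otimes>\<^sub>M ?P)" by measurable
    fix x y x' y' :: "nat \<Rightarrow> real"
    assume x: "\<And>i. i \<in> I \<Longrightarrow> i \<in> {h 0} \<Longrightarrow> x i = x' i" and y: "\<And>i. i \<in> I \<Longrightarrow> i \<notin> {h 0} \<Longrightarrow> y i = y' i"
    have "x (h 0) = x' (h 0)" using sub by (intro x) auto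
    moreover have "with_lengths l (\<lambda>i. y (?hl i)) = with_lengths l (\<lambda>i. y' (?hl i))"
      using sub ne0 by (intro with_lengths_cong y) auto
    moreover have "with_lengths r (\<lambda>i. y (?hr i)) = with_lengths r (\<lambda>i. y' (?hr i))"
      using sub ne0' by (intro with_lengths_cong y) auto
    ultimately show "?h1 x y = ?h1 x' y'" by simp
  qed (rule probs)
  also have "\<dots> = (\<integral>\<^sup>+x. (\<lambda>z. \<integral>\<^sup>+L. \<integral>\<^sup>+R. f (Node L z R) \<partial>edge_law b r \<partial>edge_law b l) (x (h 0)) \<partial>?P)"
  proof (rule nn_integral_cong)
    fix x :: "nat \<Rightarrow> real"
    let ?z = "x (h 0)"
    let ?h2 = "\<lambda>p q. f (Node (with_lengths l (\<lambda>i. p (?hl i))) ?z (with_lengths r (\<lambda>i. q (?hr i))))"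
    have "(\<integral>\<^sup>+y. ?h2 y y \<partial>?P) = (\<integral>\<^sup>+p. \<integral>\<^sup>+q. ?h2 p q \<partial>?P \<partial>?P)"
    proof (rule nn_integral_PiM_decouple[where J = "?hl ` {..<size l}"])
      show "(\<lambda>(p, q). ?h2 p q) \<in> borel_measurable (?P \<Otimes>\<^sub>M ?P)" by measurable
      fix p q p' q' :: "nat \<Rightarrow> real"
      assume p: "\<And>i. i \<in> I \<Longrightarrow> i \<in> ?hl ` {..<size l} \<Longrightarrow> p i = p' i" and q: "\<And>i. i \<in> I \<Longrightarrow> i \<notin> ?hl ` {..<size l} \<Longrightarrow> q i = q' i"
      have "with_lengths l (\<lambda>i. p (?hl i)) = with_lengths l (\<lambda>i. p' (?hl i))"
        using sub by (intro with_lengths_cong p) auto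
      moreover have "with_lengths r (\<lambda>i. q (?hr i)) = with_lengths r (\<lambda>i. q' (?hr i))"
        using sub nelr by (intro with_lengths_cong q) auto
      ultimately show "?h2 p q = ?h2 p' q'" by simp
    qed (rule probs)
    also have "\<dots> = (\<integral>\<^sup>+p. \<integral>\<^sup>+R. f (Node (with_lengths l (\<lambda>i. p (?hl i))) ?z R) \<partial>edge_law b r \<partial>?P)"
      by (intro nn_integral_cong Node.IH(2) inj sub) measurable
    also have "\<dots> = (\<integral>\<^sup>+L. \<integral>\<^sup>+R. f (Node L ?z R) \<partial>edge_law b r \<partial>edge_law b l)"
      by (intro Node.IH(1) inj sub) measurable
    finally show "(\<integral>\<^sup>+y. ?h1 x y \<partial>?P) = (\<lambda>z. \<integral>\<^sup>+L. \<integral>\<^sup>+R. f (Node L z R) \<partial>edge_law b r \<partial>edge_law b l) (x (h 0))" .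
  qed
  also have "\<dots> = (\<integral>\<^sup>+z. \<integral>\<^sup>+L. \<integral>\<^sup>+R. f (Node L z R) \<partial>edge_law b r \<partial>edge_law b l \<partial>distr ?P (exponential b) (\<lambda>x. x (h 0)))"
  proof (rule nn_integral_distr[symmetric])
    show "(\<lambda>x. x (h 0)) \<in> ?P \<rightarrow>\<^sub>M exponential b"
      by (rule measurable_component_singleton[OF sub(1)])
    have "(\<lambda>z. \<integral>\<^sup>+L. \<integral>\<^sup>+R. f (Node L z R) \<partial>edge_law b r \<partial>edge_law b l) \<in> borel_measurable borel"
      by measurable
    then show "(\<lambda>z. \<integral>\<^sup>+L. \<integral>\<^sup>+R. f (Node L z R) \<partial>edge_law b r \<partial>edge_law b l) \<in> borel_measurable (distr ?P (exponential b) (\<lambda>x. x (h 0)))"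
      unfolding measurable_distr_eq1 measurable_cong_sets[OF sets_exponential refl] .
  qed
  also have "distr ?P (exponential b) (\<lambda>x. x (h 0)) = exponential b"
    using sub(1) by (intro distr_PiM_component probs)
  also have "(\<integral>\<^sup>+z. \<integral>\<^sup>+L. \<integral>\<^sup>+R. f (Node L z R) \<partial>edge_law b r \<partial>edge_law b l \<partial>exponential b) = (\<integral>\<^sup>+t. f t \<partial>edge_law b (Node l u r))"
    by (rule nn_integral_edge_law_Node[OF b, symmetric]) measurable
  finally show ?case .
qed

lemma shape_edge_law_eq_iid:
  assumes b: "0 < b"
  shows "shape_edge_law b s = distr (PiM {..<size s} (\<lambda>_. exponential b)) tree_space (\<lambda>x. forget_embedding (with_lengths s x))"
proof (rule measure_eqI)
  let ?P = "PiM {..<size s} (\<lambda>_ :: nat. exponential b)"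
  have m: "(\<lambda>x. with_lengths s x) \<in> ?P \<rightarrow>\<^sub>M tree_sigma borel"
  proof (rule measurable_with_lengths)
    fix i assume "i < size s"
    then show "(\<lambda>x. x i) \<in> borel_measurable ?P"
      using measurable_component_singleton[of i "{..<size s}" "\<lambda>_. exponential b"] by (simp cong: measurable_cong_sets)
  qed
  have m': "(\<lambda>x. forget_embedding (with_lengths s x)) \<in> ?P \<rightarrow>\<^sub>M tree_space"
    using measurable_compose[OF m measurable_forget_embedding] .
  fix A assume "A \<in> sets (shape_edge_law b s)"
  then have [measurable]: "A \<in> sets tree_space" by simp
  have "emeasure (shape_edge_law b s) A = (\<integral>\<^sup>+t. indicator A t \<partial>shape_edge_law b s)" by simp
  also have "\<dots> = (\<integral>\<^sup>+t. indicator A (forget_embedding t) \<partial>edge_law b s)"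
    by (rule nn_integral_shape_edge_law) measurable
  also have "\<dots> = (\<integral>\<^sup>+x. indicator A (forget_embedding (with_lengths s (\<lambda>i. x (id i)))) \<partial>?P)"
    by (rule nn_integral_with_lengths[OF b, symmetric])
      (auto intro: measurable_compose[OF measurable_forget_embedding borel_measurable_indicator])
  also have "\<dots> = (\<integral>\<^sup>+t. indicator A t \<partial>distr ?P tree_space (\<lambda>x. forget_embedding (with_lengths s x)))"
    by (subst nn_integral_distr[OF m']) simp_all
  also have "\<dots> = emeasure (distr ?P tree_space (\<lambda>x. forget_embedding (with_lengths s x))) A" by simp
  finally show "emeasure (shape_edge_law b s) A = emeasure (distr ?P tree_space (\<lambda>x. forget_embedding (with_lengths s x))) A" .
qed simp

lemma (in tokunaga_law) iid_exponential_edges_M: "iid_exponential_edges M b"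
  unfolding iid_exponential_edges_def
  using given_shape_eq measure_shape_law_pos[OF sets_M] shape_edge_law_eq_iid[OF b] by simp

theorem proposition9:
  fixes \<gamma> c :: real and E :: "real utree \<Rightarrow> real tree"
  assumes "0 < \<gamma>" and "1 \<le> c" and "proper_embedding E"
  shows "self_similar E (tok_law c \<gamma>) (scaling_exponent E (tok_law c \<gamma>)) \<and>
    critical (tok_T c) (tok_lam c \<gamma>) tok_p \<and>
    time_invariant (tok_T c) (tok_lam c \<gamma>) tok_p \<and>
    iid_exponential_edges (tok_law c \<gamma>) (\<gamma> * c) \<and>
    (\<forall>z :: complex. in_domain (tok_T c) z \<and> 1 - c * z \<noteq> 0 \<longrightarrow>
      t_hat (tok_T c) z = (1 - 2 * c * z) * (z - 1) / (1 - c * z)) \<and>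
    horton_R (tok_T c) = 2 * c \<and>
    scaling_exponent E (tok_law c \<gamma>) = c \<and>
    (1 < c \<longrightarrow> growth_L (tok_T c) = ereal c) \<and>
    p_c (scaling_exponent E (tok_law c \<gamma>)) (horton_R (tok_T c)) = 1 / 2"
proof -
  interpret tokunaga_law c "\<gamma> * c" "tok_law c \<gamma>"
    by (rule tokunaga_law_tok_law) fact+
  interpret tokunaga_embedding c "\<gamma> * c" "tok_law c \<gamma>" E
    by unfold_locales fact
  show ?thesis
    unfolding scaling_exponent_M
  proof (intro conjI allI impI)
    show "self_similar E (tok_law c \<gamma>) c" by (rule self_similar_M)
    show "critical (tok_T c) (tok_lam c \<gamma>) tok_p" by (rule critical_tok) fact+
    show "time_invariant (tok_T c) (tok_lam c \<gamma>) tok_p" by (rule time_invariant_tok) fact+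
    show "iid_exponential_edges (tok_law c \<gamma>) (\<gamma> * c)" by (rule iid_exponential_edges_M)
    show "horton_R (tok_T c) = 2 * c" by (rule horton_R_tok) fact
    then show "p_c c (horton_R (tok_T c)) = 1 / 2" using assms(2) by (simp add: p_c_def)
    show "growth_L (tok_T c) = ereal c" if "1 < c" using that by (rule growth_L_tok)
    fix z :: complex
    assume "in_domain (tok_T c) z \<and> 1 - c * z \<noteq> 0"
    then show "t_hat (tok_T c) z = (1 - 2 * c * z) * (z - 1) / (1 - c * z)"
      using t_hat_tok[OF assms(2), of z] by simp
  qed simp
qed

end
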